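(* Let $\iota: R\to A$ be a Frobenius extension and let $T$ be a left $R$-module. Put $U=A\otimes_R T$, $S=\operatorname{End}_R(T)$ and $B=\operatorname{End}_A(U)$. Assume that $U\in\operatorname{add}_R(T)$ as an $R$-module (by restriction along $\iota$). Then the natural ring homomorphism $\rho:S\to B$, $\rho(s)=1_A\otimes s$, is a Frobenius extension, and moreover the canonical evaluation map $$T\otimes_S B\to U,\qquad t\otimes b\mapsto (1\otimes t)b,$$ is an isomorphism of $R$-$B$-bimodules.
   Context: All rings are associative with unit; modules are left modules unless otherwise specified. A ring extension $\iota:R\to A$ is a unital ring homomorphism, and $A$-modules are viewed as $R$-modules by restriction along $\iota$. It is a Frobenius extension if $A$ is finitely generated projective as a left $R$-module and $A\cong\operatorname{Hom}_R(A,R)$ as $A$-$R$-bimodules, where $(af)(x)=f(xa)$ and $(fr)(x)=f(x)r$. For an $R$-module $M$, $\operatorname{add}_R(M)$ is the class of direct summands of finite direct sums of copies of $M$. Endomorphism rings use the right-action convention: for $s_1,s_2\in S$, $t(s_1s_2)=(ts_1)s_2$, i.e. $s_1s_2=s_2\circ s_1$. Thus $T$ is an $R$-$S$-bimodule via $ts=s(t)$, and similarly $U$ is an $A$-$B$-bimodule. Explicitly, $(a\otimes t)\rho(s)=a\otimes ts$. $B$ is an $S$-$S$-bimodule via $\rho$. *)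

theory Defs
  imports "HOL-Algebra.Module" "HOL-Algebra.Generated_Groups" "HOL-Algebra.Free_Abelian_Groups"
begin

section \<open>Modules and bimodules over non-commutative rings\<close>

text \<open>
  The locale \<^locale>\<open>module\<close> of HOL-Algebra requires a commutative ring of scalars, so only
  its record type is reused. As there, the ring fields \<^const>\<open>monoid.mult\<close> and
  \<^const>\<open>one\<close> of a module carry no meaning; they are set to \<^const>\<open>undefined\<close> below.
\<close>

locale left_module = R?: ring R + M?: abelian_group M
  for R :: "('r, 'l) ring_scheme" (structure) and M :: "('r, 'm, 'i) module_scheme" (structure) +
  assumes smult_closed:
      "\<lbrakk>a \<in> carrier R; x \<in> carrier M\<rbrakk> \<Longrightarrow> a \<odot>\<^bsub>M\<^esub> x \<in> carrier M"
    and smult_l_distr: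
      "\<lbrakk>a \<in> carrier R; b \<in> carrier R; x \<in> carrier M\<rbrakk> \<Longrightarrow>
      (a \<oplus> b) \<odot>\<^bsub>M\<^esub> x = a \<odot>\<^bsub>M\<^esub> x \<oplus>\<^bsub>M\<^esub> b \<odot>\<^bsub>M\<^esub> x"
    and smult_r_distr:
      "\<lbrakk>a \<in> carrier R; x \<in> carrier M; y \<in> carrier M\<rbrakk> \<Longrightarrow>
      a \<odot>\<^bsub>M\<^esub> (x \<oplus>\<^bsub>M\<^esub> y) = a \<odot>\<^bsub>M\<^esub> x \<oplus>\<^bsub>M\<^esub> a \<odot>\<^bsub>M\<^esub> y"
    and smult_assoc1:
      "\<lbrakk>a \<in> carrier R; b \<in> carrier R; x \<in> carrier M\<rbrakk> \<Longrightarrow>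
      (a \<otimes> b) \<odot>\<^bsub>M\<^esub> x = a \<odot>\<^bsub>M\<^esub> (b \<odot>\<^bsub>M\<^esub> x)"
    and smult_one:
      "x \<in> carrier M \<Longrightarrow> \<one> \<odot>\<^bsub>M\<^esub> x = x"

record ('p, 'q, 'm) bimodule = "('p, 'm) module" +
  rsmult :: "'m \<Rightarrow> 'q \<Rightarrow> 'm" (infixl \<open>\<odot>\<^sub>r\<index>\<close> 70)

text \<open>A ring \<open>A\<close> as a \<open>P\<close>-\<open>Q\<close>-bimodule along maps \<open>f : P \<rightarrow> A\<close> and \<open>g : Q \<rightarrow> A\<close>.\<close>

definition ring_bimodule ::
    "('p \<Rightarrow> 'a) \<Rightarrow> ('q \<Rightarrow> 'a) \<Rightarrow> ('a, 'k) ring_scheme \<Rightarrow> ('p, 'q, 'a) bimodule" where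
  "ring_bimodule f g A =
     \<lparr>carrier = carrier A, monoid.mult = undefined, one = undefined,
      ring.zero = \<zero>\<^bsub>A\<^esub>, add = add A,
      smult = (\<lambda>p x. f p \<otimes>\<^bsub>A\<^esub> x), rsmult = (\<lambda>x q. x \<otimes>\<^bsub>A\<^esub> g q)\<rparr>"

definition restrict_scalars ::
    "('r \<Rightarrow> 'a) \<Rightarrow> ('a, 'm, 'k) module_scheme \<Rightarrow> ('r, 'm) module" where
  "restrict_scalars \<iota> M =
     \<lparr>carrier = carrier M, monoid.mult = undefined, one = undefined,
      ring.zero = \<zero>\<^bsub>M\<^esub>, add = add M, smult = (\<lambda>r x. \<iota> r \<odot>\<^bsub>M\<^esub> x)\<rparr>"

definition lmod_hom ::
    "('r, 'l) ring_scheme \<Rightarrow> ('r, 'm, 'i) module_scheme \<Rightarrow> ('r, 'n, 'j) module_scheme \<Rightarrow>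
     ('m \<Rightarrow> 'n) set" where
  "lmod_hom R M N =
     {h \<in> carrier M \<rightarrow> carrier N.
        (\<forall>x\<in>carrier M. \<forall>y\<in>carrier M. h (x \<oplus>\<^bsub>M\<^esub> y) = h x \<oplus>\<^bsub>N\<^esub> h y) \<and>
        (\<forall>r\<in>carrier R. \<forall>x\<in>carrier M. h (r \<odot>\<^bsub>M\<^esub> x) = r \<odot>\<^bsub>N\<^esub> h x)}"

definition lmod_iso ::
    "('r, 'l) ring_scheme \<Rightarrow> ('r, 'm, 'i) module_scheme \<Rightarrow> ('r, 'n, 'j) module_scheme \<Rightarrow>
     ('m \<Rightarrow> 'n) set" where
  "lmod_iso R M N = {h \<in> lmod_hom R M N. bij_betw h (carrier M) (carrier N)}"

definition bimodule_iso ::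
    "('p, 'k) ring_scheme \<Rightarrow> ('q, 'l) ring_scheme \<Rightarrow>
     ('p, 'q, 'm, 'i) bimodule_scheme \<Rightarrow> ('p, 'q, 'n, 'j) bimodule_scheme \<Rightarrow> ('m \<Rightarrow> 'n) set" where
  "bimodule_iso P Q M N =
     {h \<in> lmod_iso P M N.
        \<forall>x\<in>carrier M. \<forall>q\<in>carrier Q. h (x \<odot>\<^sub>r\<^bsub>M\<^esub> q) = h x \<odot>\<^sub>r\<^bsub>N\<^esub> q}"

text \<open>
  For an \<open>R\<close>-\<open>A\<close>-bimodule \<open>M\<close> and an \<open>R\<close>-\<open>Q\<close>-bimodule \<open>N\<close>, the \<open>A\<close>-\<open>Q\<close>-bimodule of left
  \<open>R\<close>-linear maps. Elements are extensional functions, so that equality of homomorphisms is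
  equality on the carrier.
\<close>

definition hom_bimodule ::
    "('r, 'l) ring_scheme \<Rightarrow> ('r, 'a, 'm, 'i) bimodule_scheme \<Rightarrow>
     ('r, 'q, 'n, 'j) bimodule_scheme \<Rightarrow> ('a, 'q, 'm \<Rightarrow> 'n) bimodule" where
  "hom_bimodule R M N =
     \<lparr>carrier = lmod_hom R M N \<inter> extensional (carrier M),
      monoid.mult = undefined, one = undefined,
      ring.zero = (\<lambda>x\<in>carrier M. \<zero>\<^bsub>N\<^esub>),
      add = (\<lambda>f g. \<lambda>x\<in>carrier M. f x \<oplus>\<^bsub>N\<^esub> g x),
      smult = (\<lambda>a f. \<lambda>x\<in>carrier M. f (x \<odot>\<^sub>r\<^bsub>M\<^esub> a)),
      rsmult = (\<lambda>f q. \<lambda>x\<in>carrier M. f x \<odot>\<^sub>r\<^bsub>N\<^esub> q)\<rparr>"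

text \<open>Endomorphisms act on the right: the product \<open>f g\<close> is \<open>g \<circ> f\<close>.\<close>

definition End_ring ::
    "('r, 'l) ring_scheme \<Rightarrow> ('r, 'm, 'i) module_scheme \<Rightarrow> ('m \<Rightarrow> 'm) ring" where
  "End_ring R M =
     \<lparr>carrier = lmod_hom R M M \<inter> extensional (carrier M),
      monoid.mult = (\<lambda>f g. compose (carrier M) g f),
      one = (\<lambda>x\<in>carrier M. x),
      ring.zero = (\<lambda>x\<in>carrier M. \<zero>\<^bsub>M\<^esub>),
      add = (\<lambda>f g. \<lambda>x\<in>carrier M. f x \<oplus>\<^bsub>M\<^esub> g x)\<rparr>"

definition End_bimodule ::
    "('r, 'm, 'i) module_scheme \<Rightarrow> ('r, 'm \<Rightarrow> 'm, 'm) bimodule" where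
  "End_bimodule M =
     \<lparr>carrier = carrier M, monoid.mult = undefined, one = undefined,
      ring.zero = \<zero>\<^bsub>M\<^esub>, add = add M, smult = smult M, rsmult = (\<lambda>x f. f x)\<rparr>"


section \<open>Direct summands, finitely generated and projective modules\<close>

definition direct_sum ::
    "('r, 'm, 'i) module_scheme \<Rightarrow> ('r, 'n, 'j) module_scheme \<Rightarrow> ('r, 'm \<times> 'n) module" where
  "direct_sum M N =
     \<lparr>carrier = carrier M \<times> carrier N, monoid.mult = undefined, one = undefined,
      ring.zero = (\<zero>\<^bsub>M\<^esub>, \<zero>\<^bsub>N\<^esub>),
      add = (\<lambda>(x, y) (x', y'). (x \<oplus>\<^bsub>M\<^esub> x', y \<oplus>\<^bsub>N\<^esub> y')),
      smult = (\<lambda>r (x, y). (r \<odot>\<^bsub>M\<^esub> x, r \<odot>\<^bsub>N\<^esub> y))\<rparr>"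

text \<open>
  The complement may be sought in the type of the ambient module, since every complement
  is isomorphic to a submodule of it.
\<close>

definition direct_summand ::
    "('r, 'l) ring_scheme \<Rightarrow> ('r, 'm, 'i) module_scheme \<Rightarrow> ('r, 'n, 'j) module_scheme \<Rightarrow> bool" where
  "direct_summand R M N \<longleftrightarrow>
     (\<exists>M' :: ('r, 'n) module.
        left_module R M' \<and> lmod_iso R (direct_sum M M') N \<noteq> {})"

text \<open>The direct sum of copies of \<open>M\<close> indexed by \<open>I\<close>.\<close>

definition copower :: "'c set \<Rightarrow> ('r, 'm, 'i) module_scheme \<Rightarrow> ('r, 'c \<Rightarrow> 'm) module" where
  "copower I M =
     \<lparr>carrier = {f \<in> I \<rightarrow>\<^sub>E carrier M. finite {i \<in> I. f i \<noteq> \<zero>\<^bsub>M\<^esub>}},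
      monoid.mult = undefined, one = undefined,
      ring.zero = (\<lambda>i\<in>I. \<zero>\<^bsub>M\<^esub>),
      add = (\<lambda>f g. \<lambda>i\<in>I. f i \<oplus>\<^bsub>M\<^esub> g i),
      smult = (\<lambda>r f. \<lambda>i\<in>I. r \<odot>\<^bsub>M\<^esub> f i)\<rparr>"

text \<open>Membership of \<open>N\<close> in the class \<open>add\<close> of \<open>M\<close>.\<close>

definition in_add ::
    "('r, 'l) ring_scheme \<Rightarrow> ('r, 'n, 'j) module_scheme \<Rightarrow> ('r, 'm, 'i) module_scheme \<Rightarrow> bool" where
  "in_add R N M \<longleftrightarrow> (\<exists>n::nat. direct_summand R N (copower {..<n} M))"

definition finitely_generated ::
    "('r, 'l) ring_scheme \<Rightarrow> ('r, 'm, 'i) module_scheme \<Rightarrow> bool" where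
  "finitely_generated R M \<longleftrightarrow>
     (\<exists>X. finite X \<and> X \<subseteq> carrier M \<and>
        (\<forall>m\<in>carrier M. \<exists>c \<in> X \<rightarrow> carrier R. m = (\<Oplus>\<^bsub>M\<^esub>x\<in>X. c x \<odot>\<^bsub>M\<^esub> x)))"

text \<open>
  Projective modules are the direct summands of free modules. Index sets in the type of
  the module suffice: \<open>M\<close> is a quotient of the free module on its own carrier, and this
  quotient map splits as soon as \<open>M\<close> is a direct summand of any free module.
\<close>

definition projective ::
    "('r, 'l) ring_scheme \<Rightarrow> ('r, 'm, 'i) module_scheme \<Rightarrow> bool" where
  "projective R M \<longleftrightarrow>
     (\<exists>I :: 'm set. direct_summand R M (copower I (ring_bimodule (\<lambda>r. r) (\<lambda>r. r) R)))"


section \<open>Frobenius extensions\<close>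

definition frobenius_extension ::
    "('r, 'l) ring_scheme \<Rightarrow> ('a, 'k) ring_scheme \<Rightarrow> ('r \<Rightarrow> 'a) \<Rightarrow> bool" where
  "frobenius_extension R A \<iota> \<longleftrightarrow>
     ring R \<and> ring A \<and> \<iota> \<in> ring_hom R A \<and>
     finitely_generated R (ring_bimodule \<iota> (\<lambda>a. a) A) \<and>
     projective R (ring_bimodule \<iota> (\<lambda>a. a) A) \<and>
     bimodule_iso A R (ring_bimodule (\<lambda>a. a) \<iota> A)
       (hom_bimodule R (ring_bimodule \<iota> (\<lambda>a. a) A) (ring_bimodule (\<lambda>r. r) (\<lambda>r. r) R)) \<noteq> {}"


section \<open>Tensor products\<close>

text \<open>
  The tensor product over \<open>S\<close> of a right \<open>S\<close>-module \<open>X\<close> and a left \<open>S\<close>-module \<open>Y\<close> is the free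
  abelian group on pairs modulo the subgroup generated by the usual relations; its
  elements are cosets. The left action on \<open>X\<close> plays no role until \<open>tensor_module\<close>.
\<close>

abbreviation tensor_free ::
    "('p, 's, 'x, 'i) bimodule_scheme \<Rightarrow> ('s, 'y, 'j) module_scheme \<Rightarrow>
     (('x \<times> 'y) \<Rightarrow>\<^sub>0 int) monoid" where
  "tensor_free X Y \<equiv> free_Abelian_group (carrier X \<times> carrier Y)"

definition tensor_relations ::
    "('s, 'l) ring_scheme \<Rightarrow> ('p, 's, 'x, 'i) bimodule_scheme \<Rightarrow> ('s, 'y, 'j) module_scheme \<Rightarrow>
     (('x \<times> 'y) \<Rightarrow>\<^sub>0 int) set" where
  "tensor_relations S X Y =
     {frag_of (x \<oplus>\<^bsub>X\<^esub> x', y) - frag_of (x, y) - frag_of (x', y) | x x' y.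
        x \<in> carrier X \<and> x' \<in> carrier X \<and> y \<in> carrier Y} \<union>
     {frag_of (x, y \<oplus>\<^bsub>Y\<^esub> y') - frag_of (x, y) - frag_of (x, y') | x y y'.
        x \<in> carrier X \<and> y \<in> carrier Y \<and> y' \<in> carrier Y} \<union>
     {frag_of (x \<odot>\<^sub>r\<^bsub>X\<^esub> s, y) - frag_of (x, s \<odot>\<^bsub>Y\<^esub> y) | x s y.
        x \<in> carrier X \<and> s \<in> carrier S \<and> y \<in> carrier Y}"

definition tensor_kernel ::
    "('s, 'l) ring_scheme \<Rightarrow> ('p, 's, 'x, 'i) bimodule_scheme \<Rightarrow> ('s, 'y, 'j) module_scheme \<Rightarrow>
     (('x \<times> 'y) \<Rightarrow>\<^sub>0 int) set" where
  "tensor_kernel S X Y = generate (tensor_free X Y) (tensor_relations S X Y)"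

definition tensor_group ::
    "('s, 'l) ring_scheme \<Rightarrow> ('p, 's, 'x, 'i) bimodule_scheme \<Rightarrow> ('s, 'y, 'j) module_scheme \<Rightarrow>
     (('x \<times> 'y) \<Rightarrow>\<^sub>0 int) set ring" where
  "tensor_group S X Y =
     (let Q = tensor_free X Y Mod tensor_kernel S X Y
      in \<lparr>carrier = carrier Q, monoid.mult = undefined, one = undefined,
          ring.zero = \<one>\<^bsub>Q\<^esub>, add = monoid.mult Q\<rparr>)"

definition pure_tensor ::
    "('s, 'l) ring_scheme \<Rightarrow> ('p, 's, 'x, 'i) bimodule_scheme \<Rightarrow> ('s, 'y, 'j) module_scheme \<Rightarrow>
     'x \<Rightarrow> 'y \<Rightarrow> (('x \<times> 'y) \<Rightarrow>\<^sub>0 int) set" where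
  "pure_tensor S X Y x y = tensor_kernel S X Y #>\<^bsub>tensor_free X Y\<^esub> frag_of (x, y)"

text \<open>
  The additive map on a tensor product determined by \<open>x \<otimes> y \<mapsto> \<beta> x y\<close>, where \<open>\<beta>\<close> is a balanced
  biadditive map to an abelian group \<open>G\<close>: the \<open>\<int>\<close>-linear extension of \<open>\<beta>\<close> is constant on each
  coset, and its value there is taken.
\<close>

definition tensor_lift ::
    "('g, 'l) ring_scheme \<Rightarrow> ('x \<Rightarrow> 'y \<Rightarrow> 'g) \<Rightarrow> (('x \<times> 'y) \<Rightarrow>\<^sub>0 int) set \<Rightarrow> 'g" where
  "tensor_lift G \<beta> C =
     the_elem ((\<lambda>c. \<Oplus>\<^bsub>G\<^esub>p\<in>Poly_Mapping.keys c.
        [Poly_Mapping.lookup c p] \<cdot>\<^bsub>G\<^esub> \<beta> (fst p) (snd p)) ` C)"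

text \<open>The endomorphism \<open>f \<otimes> g\<close> of \<open>X \<otimes>\<^sub>S Y\<close>.\<close>

definition tensor_map ::
    "('s, 'l) ring_scheme \<Rightarrow> ('p, 's, 'x, 'i) bimodule_scheme \<Rightarrow> ('s, 'y, 'j) module_scheme \<Rightarrow>
     ('x \<Rightarrow> 'x) \<Rightarrow> ('y \<Rightarrow> 'y) \<Rightarrow>
     (('x \<times> 'y) \<Rightarrow>\<^sub>0 int) set \<Rightarrow> (('x \<times> 'y) \<Rightarrow>\<^sub>0 int) set" where
  "tensor_map S X Y f g =
     tensor_lift (tensor_group S X Y) (\<lambda>x y. pure_tensor S X Y (f x) (g y))"

definition tensor_module ::
    "('s, 'l) ring_scheme \<Rightarrow> ('p, 's, 'x, 'i) bimodule_scheme \<Rightarrow> ('s, 'y, 'j) module_scheme \<Rightarrow>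
     ('p, (('x \<times> 'y) \<Rightarrow>\<^sub>0 int) set) module" where
  "tensor_module S X Y =
     \<lparr>carrier = carrier (tensor_group S X Y), monoid.mult = undefined, one = undefined,
      ring.zero = \<zero>\<^bsub>tensor_group S X Y\<^esub>, add = add (tensor_group S X Y),
      smult = (\<lambda>p. tensor_map S X Y (\<lambda>x. p \<odot>\<^bsub>X\<^esub> x) (\<lambda>y. y))\<rparr>"

definition tensor_bimodule ::
    "('s, 'l) ring_scheme \<Rightarrow> ('p, 's, 'x, 'i) bimodule_scheme \<Rightarrow> ('s, 'q, 'y, 'j) bimodule_scheme \<Rightarrow>
     ('p, 'q, (('x \<times> 'y) \<Rightarrow>\<^sub>0 int) set) bimodule" where
  "tensor_bimodule S X Y =
     \<lparr>carrier = carrier (tensor_group S X Y), monoid.mult = undefined, one = undefined,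
      ring.zero = \<zero>\<^bsub>tensor_group S X Y\<^esub>, add = add (tensor_group S X Y),
      smult = (\<lambda>p. tensor_map S X Y (\<lambda>x. p \<odot>\<^bsub>X\<^esub> x) (\<lambda>y. y)),
      rsmult = (\<lambda>u q. tensor_map S X Y (\<lambda>x. x) (\<lambda>y. y \<odot>\<^sub>r\<^bsub>Y\<^esub> q) u)\<rparr>"


section \<open>The induced module and its endomorphism ring\<close>

definition induced_module ::
    "('r, 'l) ring_scheme \<Rightarrow> ('a, 'k) ring_scheme \<Rightarrow> ('r \<Rightarrow> 'a) \<Rightarrow> ('r, 't, 'i) module_scheme \<Rightarrow>
     ('a, (('a \<times> 't) \<Rightarrow>\<^sub>0 int) set) module" where
  "induced_module R A \<iota> T = tensor_module R (ring_bimodule (\<lambda>a. a) \<iota> A) T"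

text \<open>\<open>s \<mapsto> 1\<^sub>A \<otimes> s\<close>, made extensional so as to land in the endomorphism ring of \<open>A \<otimes>\<^sub>R T\<close>.\<close>

definition induced_endo ::
    "('r, 'l) ring_scheme \<Rightarrow> ('a, 'k) ring_scheme \<Rightarrow> ('r \<Rightarrow> 'a) \<Rightarrow> ('r, 't, 'i) module_scheme \<Rightarrow>
     ('t \<Rightarrow> 't) \<Rightarrow> (('a \<times> 't) \<Rightarrow>\<^sub>0 int) set \<Rightarrow> (('a \<times> 't) \<Rightarrow>\<^sub>0 int) set" where
  "induced_endo R A \<iota> T s =
     restrict (tensor_map R (ring_bimodule (\<lambda>a. a) \<iota> A) T (\<lambda>a. a) s)
       (carrier (induced_module R A \<iota> T))"

text \<open>The evaluation \<open>T \<otimes>\<^sub>S B \<rightarrow> A \<otimes>\<^sub>R T\<close>, \<open>t \<otimes> b \<mapsto> (1 \<otimes> t) b\<close>.\<close>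

definition canonical_eval ::
    "('r, 'l) ring_scheme \<Rightarrow> ('a, 'k) ring_scheme \<Rightarrow> ('r \<Rightarrow> 'a) \<Rightarrow> ('r, 't, 'i) module_scheme \<Rightarrow>
     (('t \<times> ((('a \<times> 't) \<Rightarrow>\<^sub>0 int) set \<Rightarrow> (('a \<times> 't) \<Rightarrow>\<^sub>0 int) set)) \<Rightarrow>\<^sub>0 int) set \<Rightarrow>
     (('a \<times> 't) \<Rightarrow>\<^sub>0 int) set" where
  "canonical_eval R A \<iota> T =
     tensor_lift (induced_module R A \<iota> T)
       (\<lambda>t b. b (pure_tensor R (ring_bimodule (\<lambda>a. a) \<iota> A) T \<one>\<^bsub>A\<^esub> t))"

end

theory Submission
  imports Defs
begin

text \<open>
  A Frobenius extension \<open>R \<rightarrow> A\<close> is the same as a Frobenius system: an \<open>R\<close>-bilinear \<open>E : A \<rightarrow> R\<close> and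
  finitely many \<open>x\<^sub>i, y\<^sub>i\<close> in \<open>A\<close> with \<open>\<Sum> E(a y\<^sub>i) x\<^sub>i = a = \<Sum> y\<^sub>i E(x\<^sub>i a)\<close>. Put \<open>\<epsilon>(a \<otimes> t) = E(a) t\<close>
  (called \<open>ET\<close> below); then \<open>u = \<Sum> y\<^sub>i \<otimes> \<epsilon>(x\<^sub>i u)\<close>, so \<open>U\<close> is both induced and coinduced from \<open>T\<close>: every
  \<open>R\<close>-linear \<open>q : T \<rightarrow> U\<close> has the form \<open>q(t) = (1 \<otimes> t) b\<close> and every \<open>R\<close>-linear \<open>p : U \<rightarrow> T\<close> the form
  \<open>p(u) = \<epsilon>(u b)\<close>, each for a unique \<open>b\<close> in \<open>B\<close>, called \<open>up q\<close> and \<open>down p\<close>. By hypothesis there are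
  \<open>p\<^sub>j : U \<rightarrow> T\<close> and \<open>q\<^sub>j : T \<rightarrow> U\<close> with \<open>\<Sum> q\<^sub>j(p\<^sub>j(u)) = u\<close>. Then \<open>E\<^sub>B(b)(t) = \<epsilon>((1 \<otimes> t) b)\<close>, \<open>up q\<^sub>j\<close> and
  \<open>down p\<^sub>j\<close> form a Frobenius system for \<open>\<rho>\<close>, and \<open>u \<mapsto> \<Sum> p\<^sub>j(u) \<otimes> up q\<^sub>j\<close> inverts the evaluation map.
\<close>

section \<open>Additive maps and modules\<close>

text \<open>Behind the elements stands a chain of natural isomorphisms. Induction gives
  \<open>B = Hom_R(T, U)\<close> and coinduction gives \<open>B = Hom_R(U, T)\<close>. Since
  \<open>U\<close> lies in add of \<open>T\<close>, the functor \<open>Hom_R(T, -)\<close> puts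
  \<open>B\<close> into add of \<open>S\<close> as a left \<open>S\<close>-module, so
  \<open>B\<close> is finitely generated projective. Composition identifies
  \<open>Hom_R(U, T)\<close> with \<open>Hom_S(Hom_R(T, U), S)\<close>: this is clear for
  \<open>U = T\<close> and passes to finite sums and summands. Together this reads
  \<open>B = Hom_S(B, S)\<close>, and evaluation is invertible for the same reason. The proof runs
  the chain on elements: each isomorphism becomes an explicit finite expansion, so that bimodule
  compatibility shrinks to two linearity laws for \<open>EB\<close> and no naturality squares have
  to be tracked. Products in \<open>B\<close> are read from left to right, in accordance with the
  right action; hence the \<open>up (q j)\<close> take the part of the family \<open>x\<close> and
  the \<open>down (p j)\<close> that of \<open>y\<close>. Tensor products are quotients of free
  abelian groups, so equations between maps out of them are reduced to pure tensors.\<close>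

definition add_hom :: "('a, 'l) ring_scheme \<Rightarrow> ('b, 'k) ring_scheme \<Rightarrow> ('a \<Rightarrow> 'b) set" where
  "add_hom G H =
     {h \<in> carrier G \<rightarrow> carrier H.
        \<forall>x\<in>carrier G. \<forall>y\<in>carrier G. h (x \<oplus>\<^bsub>G\<^esub> y) = h x \<oplus>\<^bsub>H\<^esub> h y}"

lemma add_homI:
  assumes "\<And>x. x \<in> carrier G \<Longrightarrow> h x \<in> carrier H"
    and "\<And>x y. x \<in> carrier G \<Longrightarrow> y \<in> carrier G \<Longrightarrow> h (x \<oplus>\<^bsub>G\<^esub> y) = h x \<oplus>\<^bsub>H\<^esub> h y"
  shows "h \<in> add_hom G H"
  using assms by (auto simp: add_hom_def)

lemma add_hom_closed: "h \<in> add_hom G H \<Longrightarrow> x \<in> carrier G \<Longrightarrow> h x \<in> carrier H"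
  by (auto simp: add_hom_def)

lemma add_hom_add:
  "h \<in> add_hom G H \<Longrightarrow> x \<in> carrier G \<Longrightarrow> y \<in> carrier G \<Longrightarrow> h (x \<oplus>\<^bsub>G\<^esub> y) = h x \<oplus>\<^bsub>H\<^esub> h y"
  by (auto simp: add_hom_def)

lemma add_hom_compose:
  "g \<in> add_hom H K \<Longrightarrow> h \<in> add_hom G H \<Longrightarrow> (\<lambda>x. g (h x)) \<in> add_hom G K"
  by (auto simp: add_hom_def Pi_iff)

lemma add_hom_zero:
  assumes "abelian_group G" "abelian_group H" "h \<in> add_hom G H"
  shows "h \<zero>\<^bsub>G\<^esub> = \<zero>\<^bsub>H\<^esub>"
proof -
  interpret G: abelian_group G by fact
  interpret H: abelian_group H by fact
  have "h \<zero>\<^bsub>G\<^esub> \<oplus>\<^bsub>H\<^esub> h \<zero>\<^bsub>G\<^esub> = h \<zero>\<^bsub>G\<^esub>"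
    using add_hom_add[OF assms(3) G.zero_closed G.zero_closed] by simp
  then show ?thesis
    using add_hom_closed[OF assms(3) G.zero_closed] by (metis H.add.l_cancel_one H.r_zero)
qed

lemma add_hom_neg:
  assumes "abelian_group G" "abelian_group H" "h \<in> add_hom G H" "x \<in> carrier G"
  shows "h (\<ominus>\<^bsub>G\<^esub> x) = \<ominus>\<^bsub>H\<^esub> h x"
proof -
  interpret G: abelian_group G by fact
  interpret H: abelian_group H by fact
  have "h (\<ominus>\<^bsub>G\<^esub> x) \<oplus>\<^bsub>H\<^esub> h x = \<zero>\<^bsub>H\<^esub>"
    using add_hom_add[OF assms(3), of "\<ominus>\<^bsub>G\<^esub> x" x] assms(4) add_hom_zero[OF assms(1-3)]
    by (simp add: G.l_neg)
  then show ?thesis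
    by (metis H.minus_equality G.a_inv_closed add_hom_closed assms(3,4))
qed

text \<open>For infinite \<open>J\<close> both sums are zero by convention and \<open>h\<close>
  preserves zero, so the induction includes that case. Most calculations with finite expansions
  apply this to a composite of additive maps.\<close>

lemma add_hom_finsum:
  assumes "abelian_group G" "abelian_group H" "h \<in> add_hom G H" "f \<in> J \<rightarrow> carrier G"
  shows "h (\<Oplus>\<^bsub>G\<^esub>j\<in>J. f j) = (\<Oplus>\<^bsub>H\<^esub>j\<in>J. h (f j))"
proof -
  interpret G: abelian_group G by fact
  interpret H: abelian_group H by fact
  note [simp] = add_hom_zero[OF assms(1-3)] add_hom_add[OF assms(3)] add_hom_closed[OF assms(3)]
  show ?thesis
    using assms(4)
    by (induction J rule: infinite_finite_induct) (auto simp: Pi_def)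
qed

lemma finsum_add_hom_family:
  assumes "abelian_group G" "abelian_group H" "\<And>j. j \<in> J \<Longrightarrow> h j \<in> add_hom G H"
  shows "(\<lambda>x. \<Oplus>\<^bsub>H\<^esub>j\<in>J. h j x) \<in> add_hom G H"
proof -
  interpret G: abelian_group G by fact
  interpret H: abelian_group H by fact
  note [simp] = add_hom_closed[OF assms(3)]
  show ?thesis
  proof (rule add_homI)
    fix x y assume xy: "x \<in> carrier G" "y \<in> carrier G"
    have "(\<Oplus>\<^bsub>H\<^esub>j\<in>J. h j (x \<oplus>\<^bsub>G\<^esub> y)) = (\<Oplus>\<^bsub>H\<^esub>j\<in>J. h j x \<oplus>\<^bsub>H\<^esub> h j y)"
      using xy by (intro H.finsum_cong) (auto simp: add_hom_add[OF assms(3)] simp_implies_def)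
    also have "\<dots> = (\<Oplus>\<^bsub>H\<^esub>j\<in>J. h j x) \<oplus>\<^bsub>H\<^esub> (\<Oplus>\<^bsub>H\<^esub>j\<in>J. h j y)"
      using xy by (intro H.finsum_addf) auto
    finally show "(\<Oplus>\<^bsub>H\<^esub>j\<in>J. h j (x \<oplus>\<^bsub>G\<^esub> y)) = (\<Oplus>\<^bsub>H\<^esub>j\<in>J. h j x) \<oplus>\<^bsub>H\<^esub> (\<Oplus>\<^bsub>H\<^esub>j\<in>J. h j y)" .
  qed auto
qed

lemma abelian_group_transfer:
  assumes "abelian_group G"
    and "carrier H = carrier G" "\<zero>\<^bsub>H\<^esub> = \<zero>\<^bsub>G\<^esub>" "add H = add G"
  shows "abelian_group H"
  using abelian_groupE[OF assms(1)] by (intro abelian_groupI) (auto simp: assms(2-4))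

text \<open>Records such as \<open>ring_bimodule\<close> and \<open>restrict_scalars\<close> share
  carrier, zero and addition with the structure they come from, yet their sums are different terms.
  The identity is an additive map between the two, and additive maps commute with sums.\<close>

lemma finsum_transfer:
  assumes "abelian_group G"
    and "carrier H = carrier G" "\<zero>\<^bsub>H\<^esub> = \<zero>\<^bsub>G\<^esub>" "add H = add G" "f \<in> J \<rightarrow> carrier G"
  shows "finsum H f J = finsum G f J"
proof -
  have "abelian_group H" by (rule abelian_group_transfer[OF assms(1-4)])
  moreover have "(\<lambda>x. x) \<in> add_hom G H"
    using assms by (auto simp: add_hom_def)
  ultimately show ?thesis
    using add_hom_finsum[OF assms(1) _ _ assms(5)] by fastforce
qed

lemma left_module_abelian_group: "left_module R M \<Longrightarrow> abelian_group M"
  by (simp add: left_module_def)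

lemma left_module_ring: "left_module R M \<Longrightarrow> ring R"
  by (simp add: left_module_def)

lemma left_moduleI:
  assumes "ring R" "abelian_group M"
    and "\<And>a x. \<lbrakk>a \<in> carrier R; x \<in> carrier M\<rbrakk> \<Longrightarrow> a \<odot>\<^bsub>M\<^esub> x \<in> carrier M"
    and "\<And>a b x. \<lbrakk>a \<in> carrier R; b \<in> carrier R; x \<in> carrier M\<rbrakk> \<Longrightarrow>
      (a \<oplus>\<^bsub>R\<^esub> b) \<odot>\<^bsub>M\<^esub> x = a \<odot>\<^bsub>M\<^esub> x \<oplus>\<^bsub>M\<^esub> b \<odot>\<^bsub>M\<^esub> x"
    and "\<And>a x y. \<lbrakk>a \<in> carrier R; x \<in> carrier M; y \<in> carrier M\<rbrakk> \<Longrightarrow>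
      a \<odot>\<^bsub>M\<^esub> (x \<oplus>\<^bsub>M\<^esub> y) = a \<odot>\<^bsub>M\<^esub> x \<oplus>\<^bsub>M\<^esub> a \<odot>\<^bsub>M\<^esub> y"
    and "\<And>a b x. \<lbrakk>a \<in> carrier R; b \<in> carrier R; x \<in> carrier M\<rbrakk> \<Longrightarrow>
      (a \<otimes>\<^bsub>R\<^esub> b) \<odot>\<^bsub>M\<^esub> x = a \<odot>\<^bsub>M\<^esub> (b \<odot>\<^bsub>M\<^esub> x)"
    and "\<And>x. x \<in> carrier M \<Longrightarrow> \<one>\<^bsub>R\<^esub> \<odot>\<^bsub>M\<^esub> x = x"
  shows "left_module R M"
  using assms by (simp add: left_module_def left_module_axioms_def)

lemma lmod_homI:
  assumes "h \<in> add_hom M N"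
    and "\<And>r x. r \<in> carrier R \<Longrightarrow> x \<in> carrier M \<Longrightarrow> h (r \<odot>\<^bsub>M\<^esub> x) = r \<odot>\<^bsub>N\<^esub> h x"
  shows "h \<in> lmod_hom R M N"
  using assms by (auto simp: lmod_hom_def add_hom_def)

lemma lmod_hom_add_hom: "h \<in> lmod_hom R M N \<Longrightarrow> h \<in> add_hom M N"
  by (auto simp: lmod_hom_def add_hom_def)

lemma lmod_hom_closed: "h \<in> lmod_hom R M N \<Longrightarrow> x \<in> carrier M \<Longrightarrow> h x \<in> carrier N"
  by (auto simp: lmod_hom_def)

lemma lmod_hom_add:
  "h \<in> lmod_hom R M N \<Longrightarrow> x \<in> carrier M \<Longrightarrow> y \<in> carrier M \<Longrightarrow> h (x \<oplus>\<^bsub>M\<^esub> y) = h x \<oplus>\<^bsub>N\<^esub> h y"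
  by (auto simp: lmod_hom_def)

lemma lmod_hom_smult:
  "h \<in> lmod_hom R M N \<Longrightarrow> r \<in> carrier R \<Longrightarrow> x \<in> carrier M \<Longrightarrow> h (r \<odot>\<^bsub>M\<^esub> x) = r \<odot>\<^bsub>N\<^esub> h x"
  by (auto simp: lmod_hom_def)

lemma lmod_hom_compose:
  "g \<in> lmod_hom R N K \<Longrightarrow> h \<in> lmod_hom R M N \<Longrightarrow> (\<lambda>x. g (h x)) \<in> lmod_hom R M K"
  by (auto simp: lmod_hom_def Pi_iff)

context left_module
begin

lemma smult_add_hom: "a \<in> carrier R \<Longrightarrow> (\<lambda>x. a \<odot>\<^bsub>M\<^esub> x) \<in> add_hom M M"
  by (intro add_homI smult_closed smult_r_distr)

lemma smult_add_hom_scalar: "x \<in> carrier M \<Longrightarrow> (\<lambda>a. a \<odot>\<^bsub>M\<^esub> x) \<in> add_hom R M"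
  by (intro add_homI smult_closed smult_l_distr)

lemma smult_r_null: "a \<in> carrier R \<Longrightarrow> a \<odot>\<^bsub>M\<^esub> \<zero>\<^bsub>M\<^esub> = \<zero>\<^bsub>M\<^esub>"
  using add_hom_zero[OF _ _ smult_add_hom] M.abelian_group_axioms by blast

lemma smult_finsum:
  "a \<in> carrier R \<Longrightarrow> f \<in> J \<rightarrow> carrier M \<Longrightarrow>
   a \<odot>\<^bsub>M\<^esub> (\<Oplus>\<^bsub>M\<^esub>j\<in>J. f j) = (\<Oplus>\<^bsub>M\<^esub>j\<in>J. a \<odot>\<^bsub>M\<^esub> f j)"
  using add_hom_finsum[OF _ _ smult_add_hom] M.abelian_group_axioms by blast

lemma finsum_smult:
  "x \<in> carrier M \<Longrightarrow> f \<in> J \<rightarrow> carrier R \<Longrightarrow>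
   (\<Oplus>\<^bsub>R\<^esub>j\<in>J. f j) \<odot>\<^bsub>M\<^esub> x = (\<Oplus>\<^bsub>M\<^esub>j\<in>J. f j \<odot>\<^bsub>M\<^esub> x)"
  using add_hom_finsum[OF _ _ smult_add_hom_scalar] M.abelian_group_axioms R.abelian_group_axioms
  by blast

end

lemma (in ring) mult_left_add_hom: "a \<in> carrier R \<Longrightarrow> (\<lambda>x. a \<otimes> x) \<in> add_hom R R"
  by (auto intro: add_homI simp: r_distr)

lemma (in ring) mult_right_add_hom: "a \<in> carrier R \<Longrightarrow> (\<lambda>x. x \<otimes> a) \<in> add_hom R R"
  by (auto intro: add_homI simp: l_distr)

lemma ring_bimodule_simps [simp]:
  "carrier (ring_bimodule f g A) = carrier A"
  "\<zero>\<^bsub>ring_bimodule f g A\<^esub> = \<zero>\<^bsub>A\<^esub>"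
  "add (ring_bimodule f g A) = add A"
  "p \<odot>\<^bsub>ring_bimodule f g A\<^esub> x = f p \<otimes>\<^bsub>A\<^esub> x"
  "x \<odot>\<^sub>r\<^bsub>ring_bimodule f g A\<^esub> q = x \<otimes>\<^bsub>A\<^esub> g q"
  by (simp_all add: ring_bimodule_def)

lemma restrict_scalars_simps [simp]:
  "carrier (restrict_scalars \<iota> M) = carrier M"
  "\<zero>\<^bsub>restrict_scalars \<iota> M\<^esub> = \<zero>\<^bsub>M\<^esub>"
  "add (restrict_scalars \<iota> M) = add M"
  "r \<odot>\<^bsub>restrict_scalars \<iota> M\<^esub> x = \<iota> r \<odot>\<^bsub>M\<^esub> x"
  by (simp_all add: restrict_scalars_def)

lemma End_bimodule_simps [simp]:
  "carrier (End_bimodule M) = carrier M"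
  "\<zero>\<^bsub>End_bimodule M\<^esub> = \<zero>\<^bsub>M\<^esub>"
  "add (End_bimodule M) = add M"
  "p \<odot>\<^bsub>End_bimodule M\<^esub> x = p \<odot>\<^bsub>M\<^esub> x"
  "x \<odot>\<^sub>r\<^bsub>End_bimodule M\<^esub> q = q x"
  by (simp_all add: End_bimodule_def)

lemma add_hom_carrier_cong:
  assumes "carrier G' = carrier G" "add G' = add G" "carrier H' = carrier H" "add H' = add H"
  shows "add_hom G' H' = add_hom G H"
  using assms by (simp add: add_hom_def)

lemma ring_bimodule_abelian_group: "ring A \<Longrightarrow> abelian_group (ring_bimodule f g A)"
  by (rule abelian_group_transfer[of A]) (simp_all add: ring.is_abelian_group)

lemma ring_bimodule_left_module:
  assumes "ring P" "ring A" "f \<in> ring_hom P A"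
  shows "left_module P (ring_bimodule f g A)"
proof -
  interpret P: ring P by fact
  interpret A: ring A by fact
  show ?thesis
    using assms(1) ring_bimodule_abelian_group[OF assms(2)] ring_hom_closed[OF assms(3)]
    by (intro left_moduleI)
      (auto simp: ring_hom_add[OF assms(3)] ring_hom_mult[OF assms(3)] ring_hom_one[OF assms(3)]
        A.l_distr A.r_distr A.m_assoc)
qed

lemma restrict_scalars_left_module:
  assumes "ring R" "left_module A M" "\<iota> \<in> ring_hom R A"
  shows "left_module R (restrict_scalars \<iota> M)"
proof -
  interpret M: left_module A M by fact
  show ?thesis
    using assms(1) ring_hom_closed[OF assms(3)] abelian_group_transfer[of M "restrict_scalars \<iota> M"]
      M.M.abelian_group_axioms
    by (intro left_moduleI)
      (auto simp: ring_hom_add[OF assms(3)] ring_hom_mult[OF assms(3)] ring_hom_one[OF assms(3)]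
        M.smult_closed M.smult_l_distr M.smult_r_distr M.smult_assoc1 M.smult_one)
qed

section \<open>Split homomorphisms and dual bases\<close>

lemma direct_sum_simps [simp]:
  "carrier (direct_sum M N) = carrier M \<times> carrier N"
  "\<zero>\<^bsub>direct_sum M N\<^esub> = (\<zero>\<^bsub>M\<^esub>, \<zero>\<^bsub>N\<^esub>)"
  "(x, y) \<oplus>\<^bsub>direct_sum M N\<^esub> (x', y') = (x \<oplus>\<^bsub>M\<^esub> x', y \<oplus>\<^bsub>N\<^esub> y')"
  "r \<odot>\<^bsub>direct_sum M N\<^esub> (x, y) = (r \<odot>\<^bsub>M\<^esub> x, r \<odot>\<^bsub>N\<^esub> y)"
  by (simp_all add: direct_sum_def)

text \<open>\<open>i\<close> is the inclusion of the first summand followed by the given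
  isomorphism; \<open>p\<close> is the inverse isomorphism followed by the first projection. Later
  arguments work with this retract form instead of a complement.\<close>

lemma direct_summand_split:
  fixes M :: "('r, 'm, 'i) module_scheme" and N :: "('r, 'n, 'j) module_scheme"
  assumes "left_module R M" "left_module R N" "direct_summand R M N"
  obtains i p where "i \<in> lmod_hom R M N" "p \<in> lmod_hom R N M" "\<And>x. x \<in> carrier M \<Longrightarrow> p (i x) = x"
proof -
  interpret M: left_module R M by fact
  interpret N: left_module R N by fact
  obtain M' :: "('r, 'n) module" and h
    where M': "left_module R M'" and h: "h \<in> lmod_iso R (direct_sum M M') N"
    using assms(3) by (auto simp: direct_summand_def)
  interpret M': left_module R M' by fact
  let ?D = "direct_sum M M'"
  have hh: "h \<in> lmod_hom R ?D N" and bij: "bij_betw h (carrier ?D) (carrier N)"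
    using h by (auto simp: lmod_iso_def)
  define g where "g = inv_into (carrier ?D) h"
  have hc: "h d \<in> carrier N" if "d \<in> carrier ?D" for d
    using hh that by (rule lmod_hom_closed)
  have gh: "g (h d) = d" if "d \<in> carrier ?D" for d
    using bij that by (simp add: g_def bij_betw_def inv_into_f_f)
  \<comment> \<open>Writing elements of \<open>N\<close> as values of \<open>h\<close> lets the
    linearity of the inverse \<open>g\<close> be read off from that of \<open>h\<close>.\<close>
  have *: "\<exists>d\<in>carrier ?D. n = h d" if "n \<in> carrier N" for n
    using that bij_betw_imp_surj_on[OF bij] by (metis imageE)
  show thesis
  proof
    show "(\<lambda>x. h (x, \<zero>\<^bsub>M'\<^esub>)) \<in> lmod_hom R M N"
    proof (intro lmod_homI add_homI)
      fix x y assume xy: "x \<in> carrier M" "y \<in> carrier M"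
      show "h (x \<oplus>\<^bsub>M\<^esub> y, \<zero>\<^bsub>M'\<^esub>) = h (x, \<zero>\<^bsub>M'\<^esub>) \<oplus>\<^bsub>N\<^esub> h (y, \<zero>\<^bsub>M'\<^esub>)"
        using lmod_hom_add[OF hh, of "(x, \<zero>\<^bsub>M'\<^esub>)" "(y, \<zero>\<^bsub>M'\<^esub>)"] xy by simp
    next
      fix r x assume rx: "r \<in> carrier R" "x \<in> carrier M"
      show "h (r \<odot>\<^bsub>M\<^esub> x, \<zero>\<^bsub>M'\<^esub>) = r \<odot>\<^bsub>N\<^esub> h (x, \<zero>\<^bsub>M'\<^esub>)"
        using lmod_hom_smult[OF hh, of r "(x, \<zero>\<^bsub>M'\<^esub>)"] rx by (simp add: M'.smult_r_null)
    qed (simp add: hc)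
    show "(\<lambda>n. fst (g n)) \<in> lmod_hom R N M"
    proof (intro lmod_homI add_homI)
      fix x assume "x \<in> carrier N"
      then show "fst (g x) \<in> carrier M" using *[of x] gh by auto
    next
      fix x y assume "x \<in> carrier N" "y \<in> carrier N"
      then obtain c d where cd: "c \<in> carrier ?D" "d \<in> carrier ?D" "x = h c" "y = h d"
        using * by blast
      then have "x \<oplus>\<^bsub>N\<^esub> y = h (c \<oplus>\<^bsub>?D\<^esub> d)" by (simp add: lmod_hom_add[OF hh])
      moreover have "c \<oplus>\<^bsub>?D\<^esub> d \<in> carrier ?D" "fst (c \<oplus>\<^bsub>?D\<^esub> d) = fst c \<oplus>\<^bsub>M\<^esub> fst d"
        using cd by auto
      ultimately show "fst (g (x \<oplus>\<^bsub>N\<^esub> y)) = fst (g x) \<oplus>\<^bsub>M\<^esub> fst (g y)"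
        using cd gh by metis
    next
      fix r x assume r: "r \<in> carrier R" and "x \<in> carrier N"
      then obtain c where c: "c \<in> carrier ?D" "x = h c"
        using * by blast
      then have "r \<odot>\<^bsub>N\<^esub> x = h (r \<odot>\<^bsub>?D\<^esub> c)" using r by (simp add: lmod_hom_smult[OF hh])
      moreover have "r \<odot>\<^bsub>?D\<^esub> c \<in> carrier ?D" "fst (r \<odot>\<^bsub>?D\<^esub> c) = r \<odot>\<^bsub>M\<^esub> fst c"
        using c r by (auto simp: M.smult_closed M'.smult_closed)
      ultimately show "fst (g (r \<odot>\<^bsub>N\<^esub> x)) = r \<odot>\<^bsub>M\<^esub> fst (g x)"
        using c gh by metis
    qed
    show "fst (g (h (x, \<zero>\<^bsub>M'\<^esub>))) = x" if "x \<in> carrier M" for x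
      using that gh by simp
  qed
qed

text \<open>Every \<open>n\<close> differs from \<open>i (p n)\<close> by an element of the kernel
  of \<open>p\<close>, so this kernel is a complement of the image of \<open>i\<close>.\<close>

lemma split_direct_summand:
  fixes M :: "('r, 'm, 'i) module_scheme" and N :: "('r, 'n, 'j) module_scheme"
  assumes "left_module R M" "left_module R N"
    and i: "i \<in> lmod_hom R M N" and p: "p \<in> lmod_hom R N M"
    and pi: "\<And>x. x \<in> carrier M \<Longrightarrow> p (i x) = x"
  shows "direct_summand R M N"
proof -
  interpret M: left_module R M by fact
  interpret N: left_module R N by fact
  \<comment> \<open>The kernel sits inside \<open>carrier N\<close>, so it has the element type that
    \<open>direct_summand\<close> demands of a complement.\<close>
  define K :: "('r, 'n) module" where
    "K = \<lparr>carrier = {n \<in> carrier N. p n = \<zero>\<^bsub>M\<^esub>}, monoid.mult = undefined, one = undefined,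
      ring.zero = \<zero>\<^bsub>N\<^esub>, add = add N, smult = smult N\<rparr>"
  have K [simp]: "carrier K = {n \<in> carrier N. p n = \<zero>\<^bsub>M\<^esub>}" "\<zero>\<^bsub>K\<^esub> = \<zero>\<^bsub>N\<^esub>" "add K = add N"
    "smult K = smult N"
    by (simp_all add: K_def)
  note [simp] = lmod_hom_closed[OF i] lmod_hom_closed[OF p] lmod_hom_add[OF i] lmod_hom_add[OF p]
    lmod_hom_smult[OF i] lmod_hom_smult[OF p] pi
    add_hom_zero[OF N.M.abelian_group_axioms M.M.abelian_group_axioms lmod_hom_add_hom[OF p]]
    add_hom_neg[OF N.M.abelian_group_axioms M.M.abelian_group_axioms lmod_hom_add_hom[OF p]]
    N.smult_closed M.smult_closed M.smult_r_null
  have "abelian_group K"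
  proof (rule abelian_groupI)
    fix x assume "x \<in> carrier K"
    then show "\<exists>y\<in>carrier K. y \<oplus>\<^bsub>K\<^esub> x = \<zero>\<^bsub>K\<^esub>"
      by (intro bexI[of _ "\<ominus>\<^bsub>N\<^esub> x"]) (auto simp: N.M.l_neg)
  qed (auto simp: N.M.a_ac)
  then have K': "left_module R K"
    by (intro left_moduleI left_module_ring[OF assms(1)])
      (auto simp: N.smult_l_distr N.smult_r_distr N.smult_assoc1 N.smult_one)
  have "(\<lambda>(x, k). i x \<oplus>\<^bsub>N\<^esub> k) \<in> lmod_iso R (direct_sum M K) N"
    unfolding lmod_iso_def
  proof (intro CollectI conjI lmod_homI add_homI)
    show "bij_betw (\<lambda>(x, k). i x \<oplus>\<^bsub>N\<^esub> k) (carrier (direct_sum M K)) (carrier N)"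
    proof (rule bij_betw_byWitness[where f' = "\<lambda>n. (p n, n \<ominus>\<^bsub>N\<^esub> i (p n))"])
      show "\<forall>a\<in>carrier (direct_sum M K).
        (\<lambda>n. (p n, n \<ominus>\<^bsub>N\<^esub> i (p n))) ((\<lambda>(x, k). i x \<oplus>\<^bsub>N\<^esub> k) a) = a"
        by (auto simp: a_minus_def N.M.a_ac N.M.r_neg2 N.M.r_neg)
      show "\<forall>n\<in>carrier N. (\<lambda>(x, k). i x \<oplus>\<^bsub>N\<^esub> k) (p n, n \<ominus>\<^bsub>N\<^esub> i (p n)) = n"
        by (auto simp: a_minus_def N.M.a_lcomm N.M.r_neg)
      show "(\<lambda>n. (p n, n \<ominus>\<^bsub>N\<^esub> i (p n))) ` carrier N \<subseteq> carrier (direct_sum M K)"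
        by (auto simp: a_minus_def M.M.r_neg)
    qed auto
  qed (auto simp: N.M.a_ac N.smult_r_distr)
  with K' show ?thesis
    unfolding direct_summand_def by blast
qed

section \<open>Direct sums of copies of a module\<close>

lemma copower_simps [simp]:
  "carrier (copower I M) = {f \<in> I \<rightarrow>\<^sub>E carrier M. finite {i \<in> I. f i \<noteq> \<zero>\<^bsub>M\<^esub>}}"
  "\<zero>\<^bsub>copower I M\<^esub> = (\<lambda>i\<in>I. \<zero>\<^bsub>M\<^esub>)"
  "f \<oplus>\<^bsub>copower I M\<^esub> g = (\<lambda>i\<in>I. f i \<oplus>\<^bsub>M\<^esub> g i)"
  "r \<odot>\<^bsub>copower I M\<^esub> f = (\<lambda>i\<in>I. r \<odot>\<^bsub>M\<^esub> f i)"
  by (simp_all add: copower_def)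

lemma copower_left_module:
  assumes "left_module R M"
  shows "left_module R (copower I M)"
proof -
  interpret M: left_module R M by fact
  have fin_add: "finite {i \<in> I. f i \<oplus>\<^bsub>M\<^esub> g i \<noteq> \<zero>\<^bsub>M\<^esub>}"
    if "finite {i \<in> I. f i \<noteq> \<zero>\<^bsub>M\<^esub>}" "finite {i \<in> I. g i \<noteq> \<zero>\<^bsub>M\<^esub>}" for f g
    by (rule finite_subset[OF _ finite_UnI[OF that]]) auto
  have fin_neg: "finite {i \<in> I. \<ominus>\<^bsub>M\<^esub> f i \<noteq> \<zero>\<^bsub>M\<^esub>}" if "finite {i \<in> I. f i \<noteq> \<zero>\<^bsub>M\<^esub>}" for f
    by (rule finite_subset[OF _ that]) auto
  have fin_smult: "finite {i \<in> I. r \<odot>\<^bsub>M\<^esub> f i \<noteq> \<zero>\<^bsub>M\<^esub>}"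
    if "r \<in> carrier R" "finite {i \<in> I. f i \<noteq> \<zero>\<^bsub>M\<^esub>}" for r f
    by (rule finite_subset[OF _ that(2)]) (auto simp: M.smult_r_null that(1))
  have cong: "{i. i \<in> I \<and> (i \<in> I \<longrightarrow> P i)} = {i \<in> I. P i}" for P by auto
  show ?thesis
  proof (intro left_moduleI M.R.ring_axioms abelian_groupI)
    fix f assume f: "f \<in> carrier (copower I M)"
    show "\<exists>g\<in>carrier (copower I M). g \<oplus>\<^bsub>copower I M\<^esub> f = \<zero>\<^bsub>copower I M\<^esub>"
      using f fin_neg by (intro bexI[of _ "\<lambda>i\<in>I. \<ominus>\<^bsub>M\<^esub> f i"])
        (auto simp: M.M.l_neg PiE_iff cong cong: conj_cong intro!: restrict_ext)
  qed (auto simp: PiE_iff fin_add fin_smult extensional_def fun_eq_iff M.M.a_ac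
        M.smult_closed M.smult_l_distr M.smult_r_distr M.smult_assoc1 M.smult_one cong: conj_cong)
qed

lemma copower_eval_hom:
  assumes "k \<in> I"
  shows "(\<lambda>f. f k) \<in> lmod_hom R (copower I M) M"
  using assms by (auto intro!: lmod_homI add_homI)

definition copower_single :: "'c set \<Rightarrow> ('r, 'm, 'i) module_scheme \<Rightarrow> 'c \<Rightarrow> 'm \<Rightarrow> 'c \<Rightarrow> 'm" where
  "copower_single I M k t = (\<lambda>i\<in>I. if i = k then t else \<zero>\<^bsub>M\<^esub>)"

lemma copower_single_hom:
  assumes "left_module R M"
  shows "copower_single I M k \<in> lmod_hom R M (copower I M)"
proof -
  interpret M: left_module R M by fact
  have fin: "finite {i \<in> I. (if i = k then t else \<zero>\<^bsub>M\<^esub>) \<noteq> \<zero>\<^bsub>M\<^esub>}" for t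
    by (rule finite_subset[of _ "{k}"]) auto
  show ?thesis
    by (intro lmod_homI add_homI)
      (auto simp: copower_single_def fin M.smult_r_null cong: conj_cong)
qed

text \<open>\<open>J\<close> may exceed the support of \<open>f\<close>. This matters for dual
  bases, where a single finite \<open>J\<close> has to serve all elements of a module at
  once.\<close>

lemma copower_expand:
  assumes M: "left_module R M" and f: "f \<in> carrier (copower I M)"
    and J: "finite J" "J \<subseteq> I" "\<And>i. i \<in> I - J \<Longrightarrow> f i = \<zero>\<^bsub>M\<^esub>"
  shows "f = (\<Oplus>\<^bsub>copower I M\<^esub>k\<in>J. copower_single I M k (f k))" (is "f = ?s")
proof -
  interpret M: left_module R M by fact
  interpret C: left_module R "copower I M" by (rule copower_left_module[OF M])
  have fk: "f k \<in> carrier M" if "k \<in> I" for k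
    using f that by auto
  have sc: "(\<lambda>k. copower_single I M k (f k)) \<in> J \<rightarrow> carrier (copower I M)"
    using J(2) by (intro Pi_I lmod_hom_closed[OF copower_single_hom[OF M]] fk) auto
  have s: "?s \<in> carrier (copower I M)"
    using sc by (rule C.M.finsum_closed)
  have "f i = ?s i" if i: "i \<in> I" for i
  proof -
    \<comment> \<open>Evaluation at \<open>i\<close> is additive, hence passes through the sum;
      afterwards only the term \<open>k = i\<close> can be nonzero.\<close>
    have "?s i = (\<Oplus>\<^bsub>M\<^esub>k\<in>J. copower_single I M k (f k) i)"
      using add_hom_finsum[OF C.M.abelian_group_axioms M.M.abelian_group_axioms
          lmod_hom_add_hom[OF copower_eval_hom[OF i]] sc] .
    also have "\<dots> = (\<Oplus>\<^bsub>M\<^esub>k\<in>J. if i = k then f k else \<zero>\<^bsub>M\<^esub>)"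
      using i by (simp add: copower_single_def)
    also have "\<dots> = f i"
    proof (cases "i \<in> J")
      case True
      then show ?thesis
        using J fk by (intro M.M.finsum_singleton) auto
    next
      case False
      have "(\<Oplus>\<^bsub>M\<^esub>k\<in>J. if i = k then f k else \<zero>\<^bsub>M\<^esub>) = (\<Oplus>\<^bsub>M\<^esub>k\<in>J. \<zero>\<^bsub>M\<^esub>)"
        using False J fk by (intro M.M.finsum_cong) (auto simp: simp_implies_def)
      then show ?thesis using False i J(3) by simp
    qed
    finally show ?thesis by simp
  qed
  then show ?thesis
    using f s by (intro extensionalityI[of _ I]) (auto simp: PiE_iff)
qed

text \<open>For a splitting of \<open>N\<close> off a finite power of \<open>M\<close>,
  \<open>p j\<close> is the \<open>j\<close>-th component of the inclusion and \<open>q j\<close> is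
  the retraction restricted to the \<open>j\<close>-th copy. The sum of all
  \<open>q j (p j u)\<close> is then the retraction applied to the included
  \<open>u\<close>.\<close>

lemma in_add_decomposition:
  assumes M: "left_module R M" and N: "left_module R N" and "in_add R N M"
  obtains n :: nat and p q where
    "\<And>j. p j \<in> lmod_hom R N M" "\<And>j. q j \<in> lmod_hom R M N"
    "\<And>u. u \<in> carrier N \<Longrightarrow> (\<Oplus>\<^bsub>N\<^esub>j\<in>{..<n}. q j (p j u)) = u"
proof -
  interpret M: left_module R M by fact
  interpret N: left_module R N by fact
  obtain n :: nat where n: "direct_summand R N (copower {..<n} M)"
    using assms(3) by (auto simp: in_add_def)
  let ?C = "copower {..<n} M"
  interpret C: left_module R ?C by (rule copower_left_module[OF M])
  obtain i \<pi> where i: "i \<in> lmod_hom R N ?C" and \<pi>: "\<pi> \<in> lmod_hom R ?C N"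
    and \<pi>i: "\<And>u. u \<in> carrier N \<Longrightarrow> \<pi> (i u) = u"
    using direct_summand_split[OF N C.left_module_axioms n] by metis
  \<comment> \<open>For \<open>j\<close> outside \<open>{..<n}\<close> the value
    \<open>i u j\<close> is \<open>undefined\<close>, so \<open>p j\<close> is set to zero there.
    With this default every \<open>p j\<close> is a homomorphism; \<open>copower_single\<close>
    vanishes by itself at such \<open>j\<close>.\<close>
  define p where "p j = (if j < n then (\<lambda>u. i u j) else (\<lambda>u. \<zero>\<^bsub>M\<^esub>))" for j
  define q where "q j = (\<lambda>t. \<pi> (copower_single {..<n} M j t))" for j
  have zero: "(\<lambda>u. \<zero>\<^bsub>M\<^esub>) \<in> lmod_hom R N M"
    by (auto intro!: lmod_homI add_homI simp: M.smult_r_null)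
  show thesis
  proof
    show "p j \<in> lmod_hom R N M" for j
      using lmod_hom_compose[OF copower_eval_hom i, of j] zero by (auto simp: p_def)
    show "q j \<in> lmod_hom R M N" for j
      unfolding q_def by (rule lmod_hom_compose[OF \<pi> copower_single_hom[OF M]])
    fix u assume u: "u \<in> carrier N"
    have iu: "i u \<in> carrier ?C" using lmod_hom_closed[OF i u] .
    have "(\<Oplus>\<^bsub>N\<^esub>j\<in>{..<n}. q j (p j u)) = (\<Oplus>\<^bsub>N\<^esub>j\<in>{..<n}. \<pi> (copower_single {..<n} M j (i u j)))"
      using iu lmod_hom_closed[OF \<pi> lmod_hom_closed[OF copower_single_hom[OF M]]]
      by (intro N.M.finsum_cong') (auto simp: p_def q_def PiE_iff)
    also have "\<dots> = \<pi> (\<Oplus>\<^bsub>?C\<^esub>j\<in>{..<n}. copower_single {..<n} M j (i u j))"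
    proof (rule add_hom_finsum[symmetric, OF C.M.abelian_group_axioms N.M.abelian_group_axioms
            lmod_hom_add_hom[OF \<pi>]])
      show "(\<lambda>j. copower_single {..<n} M j (i u j)) \<in> {..<n} \<rightarrow> carrier ?C"
        using iu by (intro Pi_I lmod_hom_closed[OF copower_single_hom[OF M]]) (auto simp: PiE_mem)
    qed
    also have "\<dots> = u"
      using copower_expand[OF M iu, of "{..<n}"] \<pi>i[OF u] by simp
    finally show "(\<Oplus>\<^bsub>N\<^esub>j\<in>{..<n}. q j (p j u)) = u" .
  qed
qed

section \<open>Dual bases of finitely generated projective modules\<close>

abbreviation regular :: "('r, 'l) ring_scheme \<Rightarrow> ('r, 'r, 'r) bimodule" where
  "regular R \<equiv> ring_bimodule (\<lambda>r. r) (\<lambda>r. r) R"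

lemma regular_left_module: "ring R \<Longrightarrow> left_module R (regular R)"
  by (rule ring_bimodule_left_module) (auto intro: ring_hom_memI)

lemma (in left_module) lmod_hom_finsum_smult:
  assumes "h \<in> lmod_hom R M N" "abelian_group N" "c \<in> J \<rightarrow> carrier R" "x \<in> J \<rightarrow> carrier M"
  shows "h (\<Oplus>\<^bsub>M\<^esub>j\<in>J. c j \<odot>\<^bsub>M\<^esub> x j) = (\<Oplus>\<^bsub>N\<^esub>j\<in>J. c j \<odot>\<^bsub>N\<^esub> h (x j))"
proof -
  interpret N: abelian_group N by fact
  have cl: "c j \<odot>\<^bsub>M\<^esub> x j \<in> carrier M" if "j \<in> J" for j
    using assms(3,4) that by (intro smult_closed) auto
  have "h (\<Oplus>\<^bsub>M\<^esub>j\<in>J. c j \<odot>\<^bsub>M\<^esub> x j) = (\<Oplus>\<^bsub>N\<^esub>j\<in>J. h (c j \<odot>\<^bsub>M\<^esub> x j))"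
    using cl by (intro add_hom_finsum[OF M.abelian_group_axioms assms(2) lmod_hom_add_hom[OF assms(1)]]) auto
  also have "\<dots> = (\<Oplus>\<^bsub>N\<^esub>j\<in>J. c j \<odot>\<^bsub>N\<^esub> h (x j))"
  proof (rule N.finsum_cong'[OF refl])
    show eq: "h (c j \<odot>\<^bsub>M\<^esub> x j) = c j \<odot>\<^bsub>N\<^esub> h (x j)" if "j \<in> J" for j
      using assms(3,4) that by (intro lmod_hom_smult[OF assms(1)]) auto
    show "(\<lambda>j. c j \<odot>\<^bsub>N\<^esub> h (x j)) \<in> J \<rightarrow> carrier N"
      using lmod_hom_closed[OF assms(1) cl] by (auto simp: eq)
  qed
  finally show ?thesis .
qed

text \<open>Projectivity embeds \<open>M\<close> as a retract into a free module with a possibly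
  infinite basis. The functionals are the coordinates of the embedding and the elements are the
  images of the basis vectors; finite generation cuts the basis down to a finite part.\<close>

lemma projective_dual_basis:
  fixes R :: "('r, 'l) ring_scheme" and M :: "('r, 'm, 'i) module_scheme"
  assumes M: "left_module R M" and fg: "finitely_generated R M" and proj: "projective R M"
  obtains K :: "'m set" and x f where
    "finite K" "x \<in> K \<rightarrow> carrier M" "\<And>k. k \<in> K \<Longrightarrow> f k \<in> lmod_hom R M (regular R)"
    "\<And>m. m \<in> carrier M \<Longrightarrow> (\<Oplus>\<^bsub>M\<^esub>k\<in>K. f k m \<odot>\<^bsub>M\<^esub> x k) = m"
proof -
  interpret M: left_module R M by fact
  let ?R = "regular R"
  have R: "left_module R ?R" by (rule regular_left_module[OF M.R.ring_axioms])
  interpret R': left_module R ?R by (rule R)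
  obtain I :: "'m set" where "direct_summand R M (copower I ?R)"
    using proj by (auto simp: projective_def)
  let ?C = "copower I ?R"
  interpret C: left_module R ?C by (rule copower_left_module[OF R])
  obtain i \<pi> where i: "i \<in> lmod_hom R M ?C" and \<pi>: "\<pi> \<in> lmod_hom R ?C M"
    and \<pi>i: "\<And>u. u \<in> carrier M \<Longrightarrow> \<pi> (i u) = u"
    using direct_summand_split[OF M C.left_module_axioms \<open>direct_summand R M ?C\<close>] by metis
  obtain X where X: "finite X" "X \<subseteq> carrier M"
    and gen: "\<And>m. m \<in> carrier M \<Longrightarrow> \<exists>c \<in> X \<rightarrow> carrier R. m = (\<Oplus>\<^bsub>M\<^esub>x\<in>X. c x \<odot>\<^bsub>M\<^esub> x)"
    using fg by (auto simp: finitely_generated_def)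
  \<comment> \<open>The coordinates that occur in some generator: a finite union of finite
    supports.\<close>
  define K where "K = (\<Union>x\<in>X. {k \<in> I. i x k \<noteq> \<zero>\<^bsub>R\<^esub>})"
  have ic: "i m \<in> carrier ?C" if "m \<in> carrier M" for m
    using lmod_hom_closed[OF i that] .
  have ic2: "i m k \<in> carrier R" if "m \<in> carrier M" "k \<in> I" for m k
    using ic[OF that(1)] that(2) by auto
  have finK: "finite K"
    unfolding K_def
  proof (rule finite_UN_I[OF X(1)])
    fix z assume "z \<in> X"
    then show "finite {k \<in> I. i z k \<noteq> \<zero>\<^bsub>R\<^esub>}"
      using ic[of z] X(2) by auto
  qed
  have KI: "K \<subseteq> I" by (auto simp: K_def)
  \<comment> \<open>The \<open>k\<close>-th coordinate is linear and vanishes on all generators,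
    hence on all of \<open>M\<close>.\<close>
  have supp: "i m k = \<zero>\<^bsub>R\<^esub>" if m: "m \<in> carrier M" and k: "k \<in> I - K" for m k
  proof -
    obtain c where c: "c \<in> X \<rightarrow> carrier R" "m = (\<Oplus>\<^bsub>M\<^esub>x\<in>X. c x \<odot>\<^bsub>M\<^esub> x)"
      using gen[OF m] by blast
    have i_k: "(\<lambda>m. i m k) \<in> lmod_hom R M ?R"
      using lmod_hom_compose[OF copower_eval_hom i] k by blast
    have "i m k = (\<Oplus>\<^bsub>?R\<^esub>x\<in>X. c x \<odot>\<^bsub>?R\<^esub> i x k)"
      using M.lmod_hom_finsum_smult[OF i_k R'.M.abelian_group_axioms c(1), of "\<lambda>x. x"] X c(2) by auto
    also have "\<dots> = (\<Oplus>\<^bsub>?R\<^esub>x\<in>X. \<zero>\<^bsub>?R\<^esub>)"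
      using k c(1) by (intro R'.M.finsum_cong') (auto simp: K_def Pi_iff)
    finally show ?thesis
      using R'.M.finsum_zero[of X] by simp
  qed
  define x where "x k = \<pi> (copower_single I ?R k \<one>\<^bsub>R\<^esub>)" for k
  show thesis
  proof
    show "finite K" by (rule finK)
    show "x \<in> K \<rightarrow> carrier M"
      unfolding x_def
      using lmod_hom_closed[OF \<pi> lmod_hom_closed[OF copower_single_hom[OF R]]] by auto
    show "(\<lambda>m. i m k) \<in> lmod_hom R M ?R" if "k \<in> K" for k
      using lmod_hom_compose[OF copower_eval_hom i] that KI by blast
    fix m assume m: "m \<in> carrier M"
    have single: "copower_single I ?R k \<in> lmod_hom R ?R ?C" for k
      by (rule copower_single_hom[OF R])
    have sc: "(\<lambda>k. copower_single I ?R k (i m k)) \<in> K \<rightarrow> carrier ?C"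
      using lmod_hom_closed[OF single] ic2[OF m] KI by (auto simp del: copower_simps)
    have "(\<Oplus>\<^bsub>M\<^esub>k\<in>K. i m k \<odot>\<^bsub>M\<^esub> x k) = (\<Oplus>\<^bsub>M\<^esub>k\<in>K. \<pi> (copower_single I ?R k (i m k)))"
    proof (rule M.M.finsum_cong'[OF refl])
      show "(\<lambda>k. \<pi> (copower_single I ?R k (i m k))) \<in> K \<rightarrow> carrier M"
        using sc lmod_hom_closed[OF \<pi>] by blast
      fix k assume k: "k \<in> K"
      \<comment> \<open>The scalar is written as a multiple of one, so that linearity can move it
        into the \<open>k\<close>-th copy of \<open>R\<close>.\<close>
      have "i m k \<odot>\<^bsub>M\<^esub> x k = \<pi> (copower_single I ?R k (i m k \<odot>\<^bsub>?R\<^esub> \<one>\<^bsub>R\<^esub>))"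
        using lmod_hom_smult[OF lmod_hom_compose[OF \<pi> single], of "i m k" "\<one>\<^bsub>R\<^esub>" k] ic2[OF m, of k] k KI
        unfolding x_def by auto
      then show "i m k \<odot>\<^bsub>M\<^esub> x k = \<pi> (copower_single I ?R k (i m k))"
        using ic2[OF m, of k] k KI by auto
    qed
    also have "\<dots> = \<pi> (\<Oplus>\<^bsub>?C\<^esub>k\<in>K. copower_single I ?R k (i m k))"
      by (rule add_hom_finsum[symmetric, OF C.M.abelian_group_axioms M.M.abelian_group_axioms
            lmod_hom_add_hom[OF \<pi>] sc])
    also have "\<dots> = m"
      using copower_expand[OF R ic[OF m] finK KI] supp[OF m] \<pi>i[OF m] by simp
    finally show "(\<Oplus>\<^bsub>M\<^esub>k\<in>K. i m k \<odot>\<^bsub>M\<^esub> x k) = m" .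
  qed
qed

text \<open>\<open>projective\<close> expects a free module indexed by elements of \<open>M\<close>,
  whereas \<open>J\<close> may have any type. The basis is therefore reindexed by the set of its
  elements, which can merge several indices into one.\<close>

lemma dual_basis_projective:
  assumes M: "left_module R M" and fin: "finite J" and x: "x \<in> J \<rightarrow> carrier M"
    and f: "\<And>j. j \<in> J \<Longrightarrow> f j \<in> lmod_hom R M (regular R)"
    and basis: "\<And>m. m \<in> carrier M \<Longrightarrow> (\<Oplus>\<^bsub>M\<^esub>j\<in>J. f j m \<odot>\<^bsub>M\<^esub> x j) = m"
  shows "finitely_generated R M" "projective R M"
proof -
  interpret M: left_module R M by fact
  have R: "left_module R (regular R)" by (rule regular_left_module[OF M.R.ring_axioms])
  interpret R': left_module R "regular R" by (rule R)
  define X where "X = x ` J"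
  \<comment> \<open>Indices with the same basis element \<open>z\<close> are merged by adding their
    functionals; with \<open>J\<close> partitioned into the fibres of \<open>x\<close>, the
    expansion of \<open>m\<close> is unchanged.\<close>
  define g where "g z m = (\<Oplus>\<^bsub>R\<^esub>j\<in>{j \<in> J. x j = z}. f j m)" for z m
  have X: "finite X" "X \<subseteq> carrier M"
    using fin x by (auto simp: X_def)
  have fc: "f j m \<in> carrier R" if "j \<in> J" "m \<in> carrier M" for j m
    using lmod_hom_closed[OF f] that by auto
  have gc: "g z m \<in> carrier R" if "m \<in> carrier M" for z m
    unfolding g_def using fc that by auto
  have g_hom: "g z \<in> lmod_hom R M (regular R)" for z
  proof (rule lmod_homI)
    have "(\<lambda>m. g z m) \<in> add_hom M R"
      unfolding g_def
    proof (rule finsum_add_hom_family[OF M.M.abelian_group_axioms M.R.abelian_group_axioms])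
      show "f j \<in> add_hom M R" if "j \<in> {j \<in> J. x j = z}" for j
        using lmod_hom_add_hom[OF f] that by (auto simp: add_hom_def)
    qed
    then show "g z \<in> add_hom M (regular R)" by (simp add: add_hom_def)
    fix r m assume rm: "r \<in> carrier R" "m \<in> carrier M"
    have "g z (r \<odot>\<^bsub>M\<^esub> m) = (\<Oplus>\<^bsub>R\<^esub>j\<in>{j \<in> J. x j = z}. r \<otimes>\<^bsub>R\<^esub> f j m)"
      unfolding g_def using rm fc by (intro M.R.finsum_cong') (auto simp: lmod_hom_smult[OF f])
    also have "\<dots> = r \<otimes>\<^bsub>R\<^esub> g z m"
      unfolding g_def using rm fc
      by (intro add_hom_finsum[symmetric, OF _ _ M.R.mult_left_add_hom] M.R.abelian_group_axioms) auto
    finally show "g z (r \<odot>\<^bsub>M\<^esub> m) = r \<odot>\<^bsub>regular R\<^esub> g z m" by simp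
  qed
  have merged: "(\<Oplus>\<^bsub>M\<^esub>z\<in>X. g z m \<odot>\<^bsub>M\<^esub> z) = m" if m: "m \<in> carrier M" for m
  proof -
    have cl: "f j m \<odot>\<^bsub>M\<^esub> x j \<in> carrier M" if "j \<in> J" for j
      using x that m fc by (intro M.smult_closed) auto
    have "(\<Oplus>\<^bsub>M\<^esub>z\<in>X. g z m \<odot>\<^bsub>M\<^esub> z) = (\<Oplus>\<^bsub>M\<^esub>z\<in>X. \<Oplus>\<^bsub>M\<^esub>j\<in>{j \<in> J. x j = z}. f j m \<odot>\<^bsub>M\<^esub> x j)"
    proof (rule M.M.finsum_cong'[OF refl])
      show "(\<lambda>z. \<Oplus>\<^bsub>M\<^esub>j\<in>{j \<in> J. x j = z}. f j m \<odot>\<^bsub>M\<^esub> x j) \<in> X \<rightarrow> carrier M"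
        using cl by (intro Pi_I M.M.finsum_closed) auto
      fix z assume z: "z \<in> X"
      have "g z m \<odot>\<^bsub>M\<^esub> z = (\<Oplus>\<^bsub>M\<^esub>j\<in>{j \<in> J. x j = z}. f j m \<odot>\<^bsub>M\<^esub> z)"
        unfolding g_def using z X fc m by (intro M.finsum_smult) auto
      also have "\<dots> = (\<Oplus>\<^bsub>M\<^esub>j\<in>{j \<in> J. x j = z}. f j m \<odot>\<^bsub>M\<^esub> x j)"
        using cl by (intro M.M.finsum_cong') auto
      finally show "g z m \<odot>\<^bsub>M\<^esub> z = (\<Oplus>\<^bsub>M\<^esub>j\<in>{j \<in> J. x j = z}. f j m \<odot>\<^bsub>M\<^esub> x j)" .
    qed
    also have "\<dots> = (\<Oplus>\<^bsub>M\<^esub>j\<in>(\<Union>z\<in>X. {j \<in> J. x j = z}). f j m \<odot>\<^bsub>M\<^esub> x j)"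
      using fin X cl by (intro M.M.add.finprod_UN_disjoint[symmetric]) (auto simp: pairwise_def disjnt_def)
    also have "(\<Union>z\<in>X. {j \<in> J. x j = z}) = J"
      by (auto simp: X_def)
    finally show ?thesis using basis[OF m] by simp
  qed
  show "finitely_generated R M"
    unfolding finitely_generated_def
  proof (intro exI[of _ X] conjI ballI X)
    fix m assume m: "m \<in> carrier M"
    show "\<exists>c\<in>X \<rightarrow> carrier R. m = (\<Oplus>\<^bsub>M\<^esub>x\<in>X. c x \<odot>\<^bsub>M\<^esub> x)"
      using merged[OF m] gc[OF m] by (intro bexI[of _ "\<lambda>z. g z m"]) auto
  qed
  have finX: "finite {i \<in> X. P i}" for P using X by simp
  let ?C = "copower X (regular R)"
  show "projective R M"
    unfolding projective_def
  proof (intro exI[of _ X] split_direct_summand[OF M copower_left_module[OF R]])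
    show "(\<lambda>m. \<lambda>z\<in>X. g z m) \<in> lmod_hom R M ?C"
      by (intro lmod_homI add_homI)
        (auto simp: finX gc lmod_hom_add[OF g_hom] lmod_hom_smult[OF g_hom] fun_eq_iff)
    show "(\<lambda>h. \<Oplus>\<^bsub>M\<^esub>z\<in>X. h z \<odot>\<^bsub>M\<^esub> z) \<in> lmod_hom R ?C M"
    proof (rule lmod_homI)
      show "(\<lambda>h. \<Oplus>\<^bsub>M\<^esub>z\<in>X. h z \<odot>\<^bsub>M\<^esub> z) \<in> add_hom ?C M"
      proof (rule finsum_add_hom_family)
        show "abelian_group ?C" by (rule left_module_abelian_group[OF copower_left_module[OF R]])
        show "(\<lambda>h. h z \<odot>\<^bsub>M\<^esub> z) \<in> add_hom ?C M" if "z \<in> X" for z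
          using that X(2)
          by (intro add_homI) (auto simp: PiE_mem subset_iff intro!: M.smult_closed M.smult_l_distr)
      qed (rule M.M.abelian_group_axioms)
      fix r h assume rh: "r \<in> carrier R" "h \<in> carrier ?C"
      then have hz: "h z \<in> carrier R" if "z \<in> X" for z using that by auto
      have "(\<Oplus>\<^bsub>M\<^esub>z\<in>X. (r \<odot>\<^bsub>?C\<^esub> h) z \<odot>\<^bsub>M\<^esub> z) = (\<Oplus>\<^bsub>M\<^esub>z\<in>X. r \<odot>\<^bsub>M\<^esub> (h z \<odot>\<^bsub>M\<^esub> z))"
        using rh hz X(2) by (intro M.M.finsum_cong') (auto simp: M.smult_assoc1 intro!: M.smult_closed)
      also have "\<dots> = r \<odot>\<^bsub>M\<^esub> (\<Oplus>\<^bsub>M\<^esub>z\<in>X. h z \<odot>\<^bsub>M\<^esub> z)"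
        using rh hz X(2) by (intro M.smult_finsum[symmetric]) (auto intro!: M.smult_closed)
      finally show "(\<Oplus>\<^bsub>M\<^esub>z\<in>X. (r \<odot>\<^bsub>?C\<^esub> h) z \<odot>\<^bsub>M\<^esub> z) = r \<odot>\<^bsub>M\<^esub> (\<Oplus>\<^bsub>M\<^esub>z\<in>X. h z \<odot>\<^bsub>M\<^esub> z)" .
    qed
    fix m assume m: "m \<in> carrier M"
    have "(\<Oplus>\<^bsub>M\<^esub>z\<in>X. (\<lambda>z\<in>X. g z m) z \<odot>\<^bsub>M\<^esub> z) = (\<Oplus>\<^bsub>M\<^esub>z\<in>X. g z m \<odot>\<^bsub>M\<^esub> z)"
      using gc[OF m] X(2) by (intro M.M.finsum_cong') (auto intro!: M.smult_closed)
    then show "(\<Oplus>\<^bsub>M\<^esub>z\<in>X. (\<lambda>z\<in>X. g z m) z \<odot>\<^bsub>M\<^esub> z) = m"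
      using merged[OF m] by simp
  qed
qed

section \<open>Frobenius systems\<close>

text \<open>\<open>expand_x\<close> says that the \<open>x j\<close> with the functionals given by
  \<open>E (a y j)\<close> form a dual basis of \<open>A\<close> as a left \<open>R\<close>-module.
  \<open>expand_y\<close> makes an element of \<open>A\<close> recoverable from the functional it
  induces through \<open>E\<close>. The index type is left free: a system for \<open>A\<close> will
  be indexed by elements of \<open>A\<close>, the one for \<open>B\<close> by natural
  numbers.\<close>

locale frobenius_system = R?: ring R + A?: ring A
  for R :: "('r, 'l) ring_scheme" and A :: "('a, 'k) ring_scheme" +
  fixes \<iota> :: "'r \<Rightarrow> 'a" and E :: "'a \<Rightarrow> 'r" and J :: "'j set" and x y :: "'j \<Rightarrow> 'a"
  assumes ring_hom: "\<iota> \<in> ring_hom R A"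
    and E_add_hom: "E \<in> add_hom A R"
    and E_left: "\<lbrakk>r \<in> carrier R; a \<in> carrier A\<rbrakk> \<Longrightarrow> E (\<iota> r \<otimes>\<^bsub>A\<^esub> a) = r \<otimes>\<^bsub>R\<^esub> E a"
    and E_right: "\<lbrakk>r \<in> carrier R; a \<in> carrier A\<rbrakk> \<Longrightarrow> E (a \<otimes>\<^bsub>A\<^esub> \<iota> r) = E a \<otimes>\<^bsub>R\<^esub> r"
    and finite_J: "finite J"
    and x_closed: "j \<in> J \<Longrightarrow> x j \<in> carrier A"
    and y_closed: "j \<in> J \<Longrightarrow> y j \<in> carrier A"
    and expand_x: "a \<in> carrier A \<Longrightarrow> (\<Oplus>\<^bsub>A\<^esub>j\<in>J. \<iota> (E (a \<otimes>\<^bsub>A\<^esub> y j)) \<otimes>\<^bsub>A\<^esub> x j) = a"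
    and expand_y: "a \<in> carrier A \<Longrightarrow> (\<Oplus>\<^bsub>A\<^esub>j\<in>J. y j \<otimes>\<^bsub>A\<^esub> \<iota> (E (x j \<otimes>\<^bsub>A\<^esub> a))) = a"
begin

lemma \<iota>_closed: "r \<in> carrier R \<Longrightarrow> \<iota> r \<in> carrier A"
  using ring_hom by (rule ring_hom_closed)

lemma E_closed: "a \<in> carrier A \<Longrightarrow> E a \<in> carrier R"
  using E_add_hom by (rule add_hom_closed)

abbreviation A_left where "A_left \<equiv> ring_bimodule \<iota> (\<lambda>a. a) A"

lemma A_left_module: "left_module R A_left"
  by (rule ring_bimodule_left_module[OF R.ring_axioms A.ring_axioms ring_hom])

lemma finsum_A_left: "f \<in> K \<rightarrow> carrier A \<Longrightarrow> finsum A_left f K = finsum A f K"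
  by (rule finsum_transfer[OF A.abelian_group_axioms]) auto

lemma E_mult_hom: "a \<in> carrier A \<Longrightarrow> (\<lambda>z. E (z \<otimes>\<^bsub>A\<^esub> a)) \<in> lmod_hom R A_left (regular R)"
  using E_left \<iota>_closed E_closed add_hom_add[OF E_add_hom]
  by (intro lmod_homI add_homI) (auto simp: A.l_distr A.m_assoc)

text \<open>The bimodule isomorphism sends \<open>a\<close> to the functional
  \<open>z \<mapsto> E (z a)\<close>. The two expansions provide its inverse, and
  \<open>E_right\<close> its right linearity.\<close>

lemma frobenius_extension: "frobenius_extension R A \<iota>"
proof -
  interpret L: left_module R A_left by (rule A_left_module)
  interpret RR: left_module R "regular R" by (rule regular_left_module[OF R.ring_axioms])
  have terms: "(\<lambda>j. \<iota> (E (a \<otimes>\<^bsub>A\<^esub> y j)) \<otimes>\<^bsub>A\<^esub> x j) \<in> J \<rightarrow> carrier A" if "a \<in> carrier A" for a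
    using that by (auto intro!: A.m_closed \<iota>_closed E_closed x_closed y_closed)
  have proj: "finitely_generated R A_left" "projective R A_left"
  proof -
    have x: "x \<in> J \<rightarrow> carrier A_left" by (simp add: x_closed)
    have f: "(\<lambda>z. E (z \<otimes>\<^bsub>A\<^esub> y j)) \<in> lmod_hom R A_left (regular R)" if "j \<in> J" for j
      by (rule E_mult_hom[OF y_closed[OF that]])
    have basis: "(\<Oplus>\<^bsub>A_left\<^esub>j\<in>J. E (m \<otimes>\<^bsub>A\<^esub> y j) \<odot>\<^bsub>A_left\<^esub> x j) = m" if "m \<in> carrier A_left" for m
      using finsum_A_left[OF terms] expand_x that by simp
    show "finitely_generated R A_left" "projective R A_left"
      by (rule dual_basis_projective[OF A_left_module finite_J x f basis]; assumption)+
  qed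
  let ?Al = "ring_bimodule (\<lambda>a. a) \<iota> A"
  let ?H = "hom_bimodule R A_left (regular R)"
  define \<phi> where "\<phi> a = (\<lambda>z\<in>carrier A. E (z \<otimes>\<^bsub>A\<^esub> a))" for a
  have \<phi>_hom: "\<phi> a \<in> carrier ?H" if "a \<in> carrier A" for a
    using E_mult_hom[OF that] by (auto simp: hom_bimodule_def \<phi>_def lmod_hom_def A.m_closed \<iota>_closed)
  have "\<phi> \<in> bimodule_iso A R ?Al ?H"
    unfolding bimodule_iso_def lmod_iso_def
  proof (intro CollectI conjI ballI lmod_homI add_homI)
    show "\<phi> a \<in> carrier ?H" if "a \<in> carrier ?Al" for a
      using \<phi>_hom that by simp
    show "\<phi> (a \<oplus>\<^bsub>?Al\<^esub> b) = \<phi> a \<oplus>\<^bsub>?H\<^esub> \<phi> b" if "a \<in> carrier ?Al" "b \<in> carrier ?Al" for a b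
      using that add_hom_add[OF E_add_hom] by (auto simp: hom_bimodule_def \<phi>_def A.r_distr)
    show "\<phi> (r \<odot>\<^bsub>?Al\<^esub> a) = r \<odot>\<^bsub>?H\<^esub> \<phi> a" if "r \<in> carrier A" "a \<in> carrier ?Al" for r a
      using that by (auto simp: hom_bimodule_def \<phi>_def A.m_assoc)
    show "\<phi> (a \<odot>\<^sub>r\<^bsub>?Al\<^esub> r) = \<phi> a \<odot>\<^sub>r\<^bsub>?H\<^esub> r" if "a \<in> carrier ?Al" "r \<in> carrier R" for r a
      using that by (auto simp: hom_bimodule_def \<phi>_def A.m_assoc[symmetric] \<iota>_closed E_right)
    show "bij_betw \<phi> (carrier ?Al) (carrier ?H)"
      unfolding bij_betw_def
    proof (intro conjI inj_onI equalityI subsetI)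
      fix a b assume ab: "a \<in> carrier ?Al" "b \<in> carrier ?Al" and eq: "\<phi> a = \<phi> b"
      have "E (z \<otimes>\<^bsub>A\<^esub> a) = E (z \<otimes>\<^bsub>A\<^esub> b)" if "z \<in> carrier A" for z
        using fun_cong[OF eq, of z] that by (simp add: \<phi>_def)
      \<comment> \<open>By \<open>expand_y\<close> an element \<open>a\<close> is determined by the
        finitely many values \<open>E (x j a)\<close>.\<close>
      then have "(\<Oplus>\<^bsub>A\<^esub>j\<in>J. y j \<otimes>\<^bsub>A\<^esub> \<iota> (E (x j \<otimes>\<^bsub>A\<^esub> a))) = (\<Oplus>\<^bsub>A\<^esub>j\<in>J. y j \<otimes>\<^bsub>A\<^esub> \<iota> (E (x j \<otimes>\<^bsub>A\<^esub> b)))"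
        using ab by (intro A.finsum_cong')
            (auto simp: x_closed intro!: A.m_closed \<iota>_closed E_closed x_closed y_closed)
      then show "a = b"
        using expand_y ab by simp
    next
      fix f assume "f \<in> \<phi> ` carrier ?Al"
      then show "f \<in> carrier ?H" using \<phi>_hom by auto
    next
      fix f assume "f \<in> carrier ?H"
      then have f: "f \<in> lmod_hom R A_left (regular R)" and ext: "f \<in> extensional (carrier A)"
        by (auto simp: hom_bimodule_def)
      have fc: "f z \<in> carrier R" if "z \<in> carrier A" for z
        using lmod_hom_closed[OF f] that by simp
      \<comment> \<open>The preimage of \<open>f\<close> is forced by \<open>expand_y\<close>: there
        \<open>E (x j b)\<close> has to equal \<open>f (x j)\<close>. That it works is
        \<open>expand_x\<close>, since \<open>E (z b)\<close> becomes \<open>f\<close> of the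
        expansion of \<open>z\<close>.\<close>
      define b where "b = (\<Oplus>\<^bsub>A\<^esub>j\<in>J. y j \<otimes>\<^bsub>A\<^esub> \<iota> (f (x j)))"
      have bt: "(\<lambda>j. y j \<otimes>\<^bsub>A\<^esub> \<iota> (f (x j))) \<in> J \<rightarrow> carrier A"
        by (auto intro!: A.m_closed \<iota>_closed fc x_closed y_closed)
      then have b: "b \<in> carrier A" unfolding b_def by (rule A.finsum_closed)
      have "E (z \<otimes>\<^bsub>A\<^esub> b) = f z" if z: "z \<in> carrier A" for z
      proof -
        have "E (z \<otimes>\<^bsub>A\<^esub> b) = (\<Oplus>\<^bsub>R\<^esub>j\<in>J. E (z \<otimes>\<^bsub>A\<^esub> (y j \<otimes>\<^bsub>A\<^esub> \<iota> (f (x j)))))"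
          unfolding b_def
          by (rule add_hom_finsum[OF A.abelian_group_axioms R.abelian_group_axioms
                add_hom_compose[OF E_add_hom A.mult_left_add_hom[OF z]] bt])
        also have "\<dots> = (\<Oplus>\<^bsub>R\<^esub>j\<in>J. E (z \<otimes>\<^bsub>A\<^esub> y j) \<otimes>\<^bsub>R\<^esub> f (x j))"
          using z by (intro R.finsum_cong')
            (auto simp: A.m_assoc[symmetric] E_right \<iota>_closed x_closed y_closed fc E_closed)
        also have "\<dots> = (\<Oplus>\<^bsub>regular R\<^esub>j\<in>J. E (z \<otimes>\<^bsub>A\<^esub> y j) \<odot>\<^bsub>regular R\<^esub> f (x j))"
          using z by (subst finsum_transfer[OF R.abelian_group_axioms])
            (auto simp: x_closed y_closed fc E_closed)
        also have "\<dots> = f (\<Oplus>\<^bsub>A_left\<^esub>j\<in>J. E (z \<otimes>\<^bsub>A\<^esub> y j) \<odot>\<^bsub>A_left\<^esub> x j)"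
          using z by (intro L.lmod_hom_finsum_smult[symmetric, OF f RR.M.abelian_group_axioms])
            (auto simp: x_closed y_closed E_closed)
        also have "\<dots> = f z"
          using finsum_A_left[OF terms[OF z]] expand_x[OF z] by simp
        finally show ?thesis .
      qed
      then have "\<phi> b = f"
        using ext by (intro extensionalityI[of _ "carrier A"]) (auto simp: \<phi>_def)
      then show "f \<in> \<phi> ` carrier ?Al" using b by force
    qed
  qed
  then show ?thesis
    unfolding frobenius_extension_def
    using R.ring_axioms A.ring_axioms ring_hom proj by blast
qed

end

text \<open>A dual basis supplies the \<open>x j\<close> and functionals \<open>f j\<close>; the
  Frobenius isomorphism \<open>\<phi>\<close> turns each \<open>f j\<close> into an element
  \<open>y j\<close>. The first expansion is the dual basis property, the second follows from
  injectivity of \<open>\<phi>\<close>.\<close>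

lemma frobenius_extension_system:
  fixes R :: "('r, 'l) ring_scheme" and A :: "('a, 'k) ring_scheme"
  assumes "frobenius_extension R A \<iota>"
  obtains E and J :: "'a set" and x y where "frobenius_system R A \<iota> E J x y"
proof -
  have ring: "ring R" "ring A" and \<iota>: "\<iota> \<in> ring_hom R A"
    and fg: "finitely_generated R (ring_bimodule \<iota> (\<lambda>a. a) A)"
    and proj: "projective R (ring_bimodule \<iota> (\<lambda>a. a) A)"
    using assms by (auto simp: frobenius_extension_def)
  interpret R: ring R by fact
  interpret A: ring A by fact
  let ?L = "ring_bimodule \<iota> (\<lambda>a. a) A"
  let ?Al = "ring_bimodule (\<lambda>a. a) \<iota> A"
  let ?H = "hom_bimodule R ?L (regular R)"
  have L: "left_module R ?L" by (rule ring_bimodule_left_module[OF ring \<iota>])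
  have \<iota>c: "\<iota> r \<in> carrier A" if "r \<in> carrier R" for r
    using ring_hom_closed[OF \<iota> that] .
  obtain \<phi> where \<phi>: "\<phi> \<in> bimodule_iso A R ?Al ?H"
    using assms by (auto simp: frobenius_extension_def)
  then have \<phi>_lin: "\<phi> \<in> lmod_hom A ?Al ?H" and \<phi>_bij: "bij_betw \<phi> (carrier A) (carrier ?H)"
    and \<phi>_right: "\<And>a r. a \<in> carrier A \<Longrightarrow> r \<in> carrier R \<Longrightarrow> \<phi> (a \<otimes>\<^bsub>A\<^esub> \<iota> r) = \<phi> a \<odot>\<^sub>r\<^bsub>?H\<^esub> r"
    by (auto simp: bimodule_iso_def lmod_iso_def)
  \<comment> \<open>Left linearity over \<open>A\<close> determines \<open>\<phi>\<close> by its
    value at one: \<open>\<phi> a\<close> is \<open>a\<close> acting on \<open>E\<close>, that is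
    \<open>z \<mapsto> E (z a)\<close>.\<close>
  define E where "E = \<phi> \<one>\<^bsub>A\<^esub>"
  have E: "E \<in> lmod_hom R ?L (regular R)"
    using lmod_hom_closed[OF \<phi>_lin, of "\<one>\<^bsub>A\<^esub>"] by (simp add: E_def hom_bimodule_def)
  have Ec: "E a \<in> carrier R" if "a \<in> carrier A" for a
    using lmod_hom_closed[OF E] that by simp
  have \<phi>E: "\<phi> a z = E (z \<otimes>\<^bsub>A\<^esub> a)" if "a \<in> carrier A" "z \<in> carrier A" for a z
    using lmod_hom_smult[OF \<phi>_lin that(1), of "\<one>\<^bsub>A\<^esub>"] that by (simp add: E_def hom_bimodule_def)
  have E_add: "E \<in> add_hom A R"
    using lmod_hom_add_hom[OF E] by (simp add: add_hom_def)
  have E_left: "E (\<iota> r \<otimes>\<^bsub>A\<^esub> a) = r \<otimes>\<^bsub>R\<^esub> E a" if "r \<in> carrier R" "a \<in> carrier A" for r a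
    using lmod_hom_smult[OF E that(1)] that by simp
  have E_right: "E (a \<otimes>\<^bsub>A\<^esub> \<iota> r) = E a \<otimes>\<^bsub>R\<^esub> r" if "r \<in> carrier R" "a \<in> carrier A" for r a
  proof -
    \<comment> \<open>The functional \<open>\<phi> (\<iota> r)\<close> is computed in two ways: from
      left linearity over \<open>A\<close>, and from right linearity over \<open>R\<close> applied
      to one times \<open>\<iota> r\<close>.\<close>
    have "E (a \<otimes>\<^bsub>A\<^esub> \<iota> r) = \<phi> (\<one>\<^bsub>A\<^esub> \<otimes>\<^bsub>A\<^esub> \<iota> r) a"
      using \<phi>E[of "\<iota> r" a] that \<iota>c by simp
    also have "\<dots> = E a \<otimes>\<^bsub>R\<^esub> r"
      using \<phi>_right[of "\<one>\<^bsub>A\<^esub>" r] that by (simp add: hom_bimodule_def E_def)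
    finally show ?thesis .
  qed
  obtain J :: "'a set" and x f where J: "finite J" "x \<in> J \<rightarrow> carrier ?L"
    and f: "\<And>j. j \<in> J \<Longrightarrow> f j \<in> lmod_hom R ?L (regular R)"
    and basis: "\<And>m. m \<in> carrier ?L \<Longrightarrow> (\<Oplus>\<^bsub>?L\<^esub>j\<in>J. f j m \<odot>\<^bsub>?L\<^esub> x j) = m"
    by (rule projective_dual_basis[OF L fg proj]) (rule that)
  have xc: "x j \<in> carrier A" if "j \<in> J" for j
    using J(2) that by auto
  \<comment> \<open>Surjectivity of \<open>\<phi>\<close>: the functional \<open>f j\<close> is
    represented by an element, which becomes \<open>y j\<close>.\<close>
  have "\<exists>b\<in>carrier A. \<forall>z\<in>carrier A. E (z \<otimes>\<^bsub>A\<^esub> b) = f j z" if "j \<in> J" for j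
  proof -
    have "restrict (f j) (carrier A) \<in> carrier ?H"
      using f[OF that] by (auto simp: hom_bimodule_def lmod_hom_def A.m_closed \<iota>c)
    then obtain b where b: "b \<in> carrier A" "\<phi> b = restrict (f j) (carrier A)"
      using bij_betw_imp_surj_on[OF \<phi>_bij] by (metis imageE)
    have "E (z \<otimes>\<^bsub>A\<^esub> b) = f j z" if "z \<in> carrier A" for z
      using \<phi>E[of b z] b that by simp
    then show ?thesis using b(1) by blast
  qed
  then obtain y where yc: "\<And>j. j \<in> J \<Longrightarrow> y j \<in> carrier A"
    and y: "\<And>j z. j \<in> J \<Longrightarrow> z \<in> carrier A \<Longrightarrow> E (z \<otimes>\<^bsub>A\<^esub> y j) = f j z"
    by metis
  have expand_x: "(\<Oplus>\<^bsub>A\<^esub>j\<in>J. \<iota> (E (a \<otimes>\<^bsub>A\<^esub> y j)) \<otimes>\<^bsub>A\<^esub> x j) = a" if a: "a \<in> carrier A" for a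
  proof -
    have "(\<Oplus>\<^bsub>A\<^esub>j\<in>J. \<iota> (E (a \<otimes>\<^bsub>A\<^esub> y j)) \<otimes>\<^bsub>A\<^esub> x j) = (\<Oplus>\<^bsub>A\<^esub>j\<in>J. \<iota> (f j a) \<otimes>\<^bsub>A\<^esub> x j)"
      using a xc y Ec yc \<iota>c by (intro A.finsum_cong') (auto intro!: A.m_closed simp flip: y)
    also have "\<dots> = (\<Oplus>\<^bsub>?L\<^esub>j\<in>J. \<iota> (f j a) \<otimes>\<^bsub>A\<^esub> x j)"
      using a xc Ec yc \<iota>c
      by (intro finsum_transfer[symmetric, OF A.abelian_group_axioms])
        (auto intro!: A.m_closed simp flip: y)
    also have "\<dots> = a" using basis a by simp
    finally show ?thesis .
  qed
  have expand_y: "(\<Oplus>\<^bsub>A\<^esub>j\<in>J. y j \<otimes>\<^bsub>A\<^esub> \<iota> (E (x j \<otimes>\<^bsub>A\<^esub> a))) = a" if a: "a \<in> carrier A" for a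
  proof -
    define b where "b = (\<Oplus>\<^bsub>A\<^esub>j\<in>J. y j \<otimes>\<^bsub>A\<^esub> \<iota> (E (x j \<otimes>\<^bsub>A\<^esub> a)))"
    have bt: "(\<lambda>j. y j \<otimes>\<^bsub>A\<^esub> \<iota> (E (x j \<otimes>\<^bsub>A\<^esub> a))) \<in> J \<rightarrow> carrier A"
      using a by (auto intro!: A.m_closed \<iota>c Ec xc yc)
    then have b: "b \<in> carrier A" unfolding b_def by (rule A.finsum_closed)
    \<comment> \<open>Moving the scalars through \<open>E\<close> turns the sum for
      \<open>E (z b)\<close> into \<open>E\<close> of the first expansion of \<open>z\<close>,
      multiplied on the right by \<open>a\<close>; so \<open>a\<close> and the sum \<open>b\<close>
      induce the same functional.\<close>
    have "\<phi> b z = \<phi> a z" if z: "z \<in> carrier A" for z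
    proof -
      have "E (z \<otimes>\<^bsub>A\<^esub> b) = (\<Oplus>\<^bsub>R\<^esub>j\<in>J. E (z \<otimes>\<^bsub>A\<^esub> (y j \<otimes>\<^bsub>A\<^esub> \<iota> (E (x j \<otimes>\<^bsub>A\<^esub> a)))))"
        unfolding b_def
        by (rule add_hom_finsum[OF A.abelian_group_axioms R.abelian_group_axioms
              add_hom_compose[OF E_add A.mult_left_add_hom[OF z]] bt])
      also have "\<dots> = (\<Oplus>\<^bsub>R\<^esub>j\<in>J. E ((\<iota> (E (z \<otimes>\<^bsub>A\<^esub> y j)) \<otimes>\<^bsub>A\<^esub> x j) \<otimes>\<^bsub>A\<^esub> a))"
      proof (rule R.finsum_cong'[OF refl])
        show "(\<lambda>j. E (\<iota> (E (z \<otimes>\<^bsub>A\<^esub> y j)) \<otimes>\<^bsub>A\<^esub> x j \<otimes>\<^bsub>A\<^esub> a)) \<in> J \<rightarrow> carrier R"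
          using a z by (auto intro!: A.m_closed \<iota>c Ec xc yc)
        fix j assume j: "j \<in> J"
        have "E (z \<otimes>\<^bsub>A\<^esub> (y j \<otimes>\<^bsub>A\<^esub> \<iota> (E (x j \<otimes>\<^bsub>A\<^esub> a)))) = E ((z \<otimes>\<^bsub>A\<^esub> y j) \<otimes>\<^bsub>A\<^esub> \<iota> (E (x j \<otimes>\<^bsub>A\<^esub> a)))"
          using a z j by (simp add: A.m_assoc \<iota>c Ec xc yc)
        also have "\<dots> = E (z \<otimes>\<^bsub>A\<^esub> y j) \<otimes>\<^bsub>R\<^esub> E (x j \<otimes>\<^bsub>A\<^esub> a)"
          using a z j by (simp add: E_right Ec xc yc)
        also have "\<dots> = E (\<iota> (E (z \<otimes>\<^bsub>A\<^esub> y j)) \<otimes>\<^bsub>A\<^esub> (x j \<otimes>\<^bsub>A\<^esub> a))"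
          using a z j by (simp add: E_left Ec xc yc)
        also have "\<dots> = E ((\<iota> (E (z \<otimes>\<^bsub>A\<^esub> y j)) \<otimes>\<^bsub>A\<^esub> x j) \<otimes>\<^bsub>A\<^esub> a)"
          using a z j by (simp add: A.m_assoc \<iota>c Ec xc yc)
        finally show "E (z \<otimes>\<^bsub>A\<^esub> (y j \<otimes>\<^bsub>A\<^esub> \<iota> (E (x j \<otimes>\<^bsub>A\<^esub> a)))) = E ((\<iota> (E (z \<otimes>\<^bsub>A\<^esub> y j)) \<otimes>\<^bsub>A\<^esub> x j) \<otimes>\<^bsub>A\<^esub> a)" .
      qed
      also have "\<dots> = E ((\<Oplus>\<^bsub>A\<^esub>j\<in>J. \<iota> (E (z \<otimes>\<^bsub>A\<^esub> y j)) \<otimes>\<^bsub>A\<^esub> x j) \<otimes>\<^bsub>A\<^esub> a)"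
        using a z
        by (intro add_hom_finsum[symmetric, OF A.abelian_group_axioms R.abelian_group_axioms
              add_hom_compose[OF E_add A.mult_right_add_hom]])
          (auto intro!: A.m_closed \<iota>c Ec xc yc)
      finally show ?thesis
        using expand_x[OF z] a b z by (simp add: \<phi>E)
    qed
    moreover have "\<phi> b \<in> extensional (carrier A)" "\<phi> a \<in> extensional (carrier A)"
      using lmod_hom_closed[OF \<phi>_lin] a b by (auto simp: hom_bimodule_def)
    ultimately have "\<phi> b = \<phi> a"
      by (intro extensionalityI)
    then show ?thesis
      using \<phi>_bij a b by (auto simp: bij_betw_def b_def dest: inj_onD)
  qed
  have "frobenius_system R A \<iota> E J x y"
    by unfold_locales (use \<iota> E_add E_left E_right J(1) xc yc expand_x expand_y in auto)
  then show thesis by (rule that)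
qed

section \<open>Endomorphism rings\<close>

lemma End_ring_simps [simp]:
  "carrier (End_ring R M) = lmod_hom R M M \<inter> extensional (carrier M)"
  "f \<otimes>\<^bsub>End_ring R M\<^esub> g = compose (carrier M) g f"
  "\<one>\<^bsub>End_ring R M\<^esub> = (\<lambda>x\<in>carrier M. x)"
  "\<zero>\<^bsub>End_ring R M\<^esub> = (\<lambda>x\<in>carrier M. \<zero>\<^bsub>M\<^esub>)"
  "f \<oplus>\<^bsub>End_ring R M\<^esub> g = (\<lambda>x\<in>carrier M. f x \<oplus>\<^bsub>M\<^esub> g x)"
  by (simp_all add: End_ring_def)

context left_module
begin

lemma restrict_lmod_hom: "h \<in> lmod_hom R M N \<Longrightarrow> restrict h (carrier M) \<in> lmod_hom R M N"
  by (auto simp: lmod_hom_def smult_closed)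

lemma End_ring_eqI:
  assumes "f \<in> carrier (End_ring R M)" "g \<in> carrier (End_ring R M)"
    and "\<And>x. x \<in> carrier M \<Longrightarrow> f x = g x"
  shows "f = g"
  using assms by (auto intro: extensionalityI)

lemma ring_End_ring: "ring (End_ring R M)"
proof -
  let ?S = "End_ring R M"
  have add: "f \<oplus>\<^bsub>?S\<^esub> g \<in> carrier ?S" if "f \<in> carrier ?S" "g \<in> carrier ?S" for f g
    using that by (auto simp: lmod_hom_def smult_closed Pi_iff M.a_ac smult_r_distr)
  have zero: "\<zero>\<^bsub>?S\<^esub> \<in> carrier ?S"
    by (auto simp: lmod_hom_def smult_closed smult_r_null)
  have one: "\<one>\<^bsub>?S\<^esub> \<in> carrier ?S"
    by (auto simp: lmod_hom_def smult_closed)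
  have mult: "f \<otimes>\<^bsub>?S\<^esub> g \<in> carrier ?S" if "f \<in> carrier ?S" "g \<in> carrier ?S" for f g
    using that by (auto simp: lmod_hom_def smult_closed Pi_iff compose_def)
  have neg: "\<exists>g\<in>carrier ?S. g \<oplus>\<^bsub>?S\<^esub> f = \<zero>\<^bsub>?S\<^esub>" if "f \<in> carrier ?S" for f
  proof (rule bexI[of _ "\<lambda>x\<in>carrier M. \<ominus>\<^bsub>M\<^esub> f x"])
    have f: "f \<in> lmod_hom R M M" using that by simp
    have "\<ominus>\<^bsub>M\<^esub> (r \<odot>\<^bsub>M\<^esub> z) = r \<odot>\<^bsub>M\<^esub> (\<ominus>\<^bsub>M\<^esub> z)" if "r \<in> carrier R" "z \<in> carrier M" for r z
      using add_hom_neg[OF _ _ smult_add_hom[OF that(1)] that(2)] M.abelian_group_axioms by simp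
    then show "(\<lambda>x\<in>carrier M. \<ominus>\<^bsub>M\<^esub> f x) \<in> carrier ?S"
      using lmod_hom_closed[OF f] lmod_hom_add[OF f] lmod_hom_smult[OF f]
      by (auto intro!: lmod_homI add_homI simp: smult_closed M.minus_add)
    show "(\<lambda>x\<in>carrier M. \<ominus>\<^bsub>M\<^esub> f x) \<oplus>\<^bsub>?S\<^esub> f = \<zero>\<^bsub>?S\<^esub>"
      using lmod_hom_closed[OF f] by (auto simp: M.l_neg)
  qed
  show ?thesis
  proof (intro ringI abelian_groupI monoidI)
    fix f g h assume "f \<in> carrier ?S" "g \<in> carrier ?S" "h \<in> carrier ?S"
    then have [simp]: "f z \<in> carrier M" "g z \<in> carrier M" "h z \<in> carrier M"
      and "h (f z \<oplus>\<^bsub>M\<^esub> g z) = h (f z) \<oplus>\<^bsub>M\<^esub> h (g z)" if "z \<in> carrier M" for z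
      using that by (auto simp: lmod_hom_def Pi_iff)
    then show "f \<oplus>\<^bsub>?S\<^esub> g \<oplus>\<^bsub>?S\<^esub> h = f \<oplus>\<^bsub>?S\<^esub> (g \<oplus>\<^bsub>?S\<^esub> h)"
      "f \<otimes>\<^bsub>?S\<^esub> g \<otimes>\<^bsub>?S\<^esub> h = f \<otimes>\<^bsub>?S\<^esub> (g \<otimes>\<^bsub>?S\<^esub> h)"
      "(f \<oplus>\<^bsub>?S\<^esub> g) \<otimes>\<^bsub>?S\<^esub> h = f \<otimes>\<^bsub>?S\<^esub> h \<oplus>\<^bsub>?S\<^esub> g \<otimes>\<^bsub>?S\<^esub> h"
      "h \<otimes>\<^bsub>?S\<^esub> (f \<oplus>\<^bsub>?S\<^esub> g) = h \<otimes>\<^bsub>?S\<^esub> f \<oplus>\<^bsub>?S\<^esub> h \<otimes>\<^bsub>?S\<^esub> g"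
      by (auto simp: compose_def M.a_ac)
  next
    fix f g assume "f \<in> carrier ?S" "g \<in> carrier ?S"
    then have "f z \<in> carrier M" "g z \<in> carrier M" if "z \<in> carrier M" for z
      using that by (auto simp: lmod_hom_def)
    then show "f \<oplus>\<^bsub>?S\<^esub> g = g \<oplus>\<^bsub>?S\<^esub> f"
      by (auto simp: M.a_ac)
  next
    fix f assume "f \<in> carrier ?S"
    then have "f z \<in> carrier M" if "z \<in> carrier M" for z
      using that by (auto simp: lmod_hom_def)
    moreover have "f \<in> extensional (carrier M)"
      using \<open>f \<in> carrier ?S\<close> by simp
    ultimately show "\<zero>\<^bsub>?S\<^esub> \<oplus>\<^bsub>?S\<^esub> f = f" "\<one>\<^bsub>?S\<^esub> \<otimes>\<^bsub>?S\<^esub> f = f" "f \<otimes>\<^bsub>?S\<^esub> \<one>\<^bsub>?S\<^esub> = f"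
      by (auto simp: compose_def fun_eq_iff extensional_def)
  qed (use add zero one mult neg in auto)
qed

lemma End_eval_add_hom: "u \<in> carrier M \<Longrightarrow> (\<lambda>f. f u) \<in> add_hom (End_ring R M) M"
  by (auto intro!: add_homI simp: lmod_hom_def)

text \<open>Evaluation at \<open>u\<close> is additive on the endomorphism ring and so passes
  through abstract finite sums of endomorphisms.\<close>

lemma End_finsum_apply:
  assumes "u \<in> carrier M" "f \<in> J \<rightarrow> carrier (End_ring R M)"
  shows "(\<Oplus>\<^bsub>End_ring R M\<^esub>j\<in>J. f j) u = (\<Oplus>\<^bsub>M\<^esub>j\<in>J. f j u)"
  by (rule add_hom_finsum[OF ring.is_abelian_group[OF ring_End_ring] M.abelian_group_axioms
        End_eval_add_hom[OF assms(1)] assms(2)])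

end

section \<open>Tensor products\<close>

text \<open>The sum inside \<open>tensor_lift\<close>, isolated so that its additivity can be proved
  on the free group, before cosets enter.\<close>

definition frag_sum :: "('g, 'l) ring_scheme \<Rightarrow> ('p \<Rightarrow> 'g) \<Rightarrow> ('p \<Rightarrow>\<^sub>0 int) \<Rightarrow> 'g" where
  "frag_sum G b c = (\<Oplus>\<^bsub>G\<^esub>p\<in>Poly_Mapping.keys c. [Poly_Mapping.lookup c p] \<cdot>\<^bsub>G\<^esub> b p)"

context abelian_group
begin

lemma int_add_pow_0: "[(0 :: int)] \<cdot> x = \<zero>"
  by (simp add: add_pow_def int_pow_def2)

lemma int_add_pow_add: "x \<in> carrier G \<Longrightarrow> [(k + l :: int)] \<cdot> x = [k] \<cdot> x \<oplus> [l] \<cdot> x"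
  using group.int_pow_mult[OF a_group, of x k l] by (simp add: add_pow_def)

text \<open>Cancellation can make the support of \<open>c + d\<close> smaller than those of
  \<open>c\<close> and \<open>d\<close>. Comparing the three sums calls for one index set containing
  all supports.\<close>

lemma frag_sum_superset:
  assumes "finite Z" "Poly_Mapping.keys c \<subseteq> Z" "b \<in> Z \<rightarrow> carrier G"
  shows "frag_sum G b c = (\<Oplus>p\<in>Z. [Poly_Mapping.lookup c p] \<cdot> b p)"
  unfolding frag_sum_def
proof (rule add.finprod_mono_neutral_cong_left[OF assms(1,2)])
  fix p assume "p \<in> Z - Poly_Mapping.keys c"
  then have "Poly_Mapping.lookup c p = 0"
    by (simp add: in_keys_iff)
  then show "[Poly_Mapping.lookup c p] \<cdot> b p = \<zero>"
    by (simp add: int_add_pow_0)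
qed (use assms(3) in auto)

lemma frag_sum_closed:
  "b \<in> S \<rightarrow> carrier G \<Longrightarrow> Poly_Mapping.keys c \<subseteq> S \<Longrightarrow> frag_sum G b c \<in> carrier G"
  unfolding frag_sum_def by (rule finsum_closed) auto

lemma frag_sum_add:
  assumes "b \<in> S \<rightarrow> carrier G" "Poly_Mapping.keys c \<subseteq> S" "Poly_Mapping.keys d \<subseteq> S"
  shows "frag_sum G b (c + d) = frag_sum G b c \<oplus> frag_sum G b d"
proof -
  let ?Z = "Poly_Mapping.keys c \<union> Poly_Mapping.keys d"
  have Z: "finite ?Z" "b \<in> ?Z \<rightarrow> carrier G" "Poly_Mapping.keys (c + d) \<subseteq> ?Z"
    using assms Poly_Mapping.keys_add[of c d] by auto
  have "frag_sum G b (c + d) = (\<Oplus>p\<in>?Z. [Poly_Mapping.lookup (c + d) p] \<cdot> b p)"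
    by (rule frag_sum_superset[OF Z(1,3,2)])
  also have "\<dots> = (\<Oplus>p\<in>?Z. [Poly_Mapping.lookup c p] \<cdot> b p \<oplus> [Poly_Mapping.lookup d p] \<cdot> b p)"
    using Z(2) by (intro finsum_cong') (auto simp: lookup_add int_add_pow_add Pi_iff)
  also have "\<dots> = frag_sum G b c \<oplus> frag_sum G b d"
    using Z by (simp add: frag_sum_superset[OF Z(1) _ Z(2)] finsum_addf Pi_iff)
  finally show ?thesis .
qed

lemma frag_sum_frag_of: "b p \<in> carrier G \<Longrightarrow> frag_sum G b (frag_of p) = b p"
  by (simp add: frag_sum_def keys_frag_of)

lemma frag_sum_zero: "frag_sum G b 0 = \<zero>"
  by (simp add: frag_sum_def)

lemma frag_sum_diff:
  assumes "b \<in> S \<rightarrow> carrier G" "Poly_Mapping.keys c \<subseteq> S" "Poly_Mapping.keys d \<subseteq> S"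
  shows "frag_sum G b (c - d) = frag_sum G b c \<ominus> frag_sum G b d"
proof -
  have "Poly_Mapping.keys (c - d) \<subseteq> S"
    using assms(2,3) keys_diff[of c d] by blast
  then have "frag_sum G b c = frag_sum G b (c - d) \<oplus> frag_sum G b d"
    and "frag_sum G b (c - d) \<in> carrier G" "frag_sum G b d \<in> carrier G"
    using frag_sum_add[OF assms(1) _ assms(3), of "c - d"] frag_sum_closed[OF assms(1)] assms(3)
    by auto
  then show ?thesis
    by (simp add: a_minus_def a_assoc r_neg)
qed

end

text \<open>The two closure assumptions keep the balancing relations inside the free group on
  \<open>carrier X \<times> carrier Y\<close>.\<close>

locale tensor_product = X?: abelian_group X + Y?: abelian_group Y
  for S :: "('s, 'l) ring_scheme" and X :: "('p, 's, 'x, 'i) bimodule_scheme"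
    and Y :: "('s, 'y, 'j) module_scheme" +
  assumes rsmult_closed: "\<lbrakk>x \<in> carrier X; s \<in> carrier S\<rbrakk> \<Longrightarrow> x \<odot>\<^sub>r\<^bsub>X\<^esub> s \<in> carrier X"
    and lsmult_closed: "\<lbrakk>s \<in> carrier S; y \<in> carrier Y\<rbrakk> \<Longrightarrow> s \<odot>\<^bsub>Y\<^esub> y \<in> carrier Y"
begin

abbreviation "F \<equiv> tensor_free X Y"
abbreviation "K \<equiv> tensor_kernel S X Y"
abbreviation "TG \<equiv> tensor_group S X Y"
abbreviation tens (infixl \<open>\<otimes>\<^sub>t\<close> 70) where "x \<otimes>\<^sub>t y \<equiv> pure_tensor S X Y x y"

definition coset :: "(('x \<times> 'y) \<Rightarrow>\<^sub>0 int) \<Rightarrow> (('x \<times> 'y) \<Rightarrow>\<^sub>0 int) set" where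
  "coset c = K #>\<^bsub>F\<^esub> c"

lemma F_comm_group: "comm_group F"
  by (rule abelian_free_Abelian_group)

lemma F_diff: "c \<in> carrier F \<Longrightarrow> d \<in> carrier F \<Longrightarrow> c - d \<in> carrier F"
  using keys_diff[of c d] by auto

lemma F_add: "c \<in> carrier F \<Longrightarrow> d \<in> carrier F \<Longrightarrow> c + d \<in> carrier F"
  using Poly_Mapping.keys_add[of c d] by auto

lemma frag_of_F: "x \<in> carrier X \<Longrightarrow> y \<in> carrier Y \<Longrightarrow> frag_of (x, y) \<in> carrier F"
  by simp

lemma relations_F: "tensor_relations S X Y \<subseteq> carrier F"
  unfolding tensor_relations_def
  by (auto simp del: carrier_free_Abelian_group_iff
      intro!: F_diff frag_of_F X.a_closed Y.a_closed rsmult_closed lsmult_closed)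

lemma K_subgroup: "subgroup K F"
  unfolding tensor_kernel_def
  by (rule group.generate_is_subgroup[OF group_free_Abelian_group relations_F])

lemma K_normal: "K \<lhd> F"
  by (rule comm_group.subgroup_imp_normal[OF F_comm_group K_subgroup])

lemma relations_K: "r \<in> tensor_relations S X Y \<Longrightarrow> r \<in> K"
  unfolding tensor_kernel_def by (rule generate.incl)

lemma carrier_TG: "carrier TG = coset ` carrier F"
  by (auto simp: tensor_group_def Let_def FactGroup_def RCOSETS_def coset_def
      simp del: carrier_free_Abelian_group_iff)

lemma coset_closed: "c \<in> carrier F \<Longrightarrow> coset c \<in> carrier TG"
  by (simp add: carrier_TG del: carrier_free_Abelian_group_iff)

lemma coset_add:
  "c \<in> carrier F \<Longrightarrow> d \<in> carrier F \<Longrightarrow> coset c \<oplus>\<^bsub>TG\<^esub> coset d = coset (c + d)"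
  using normal.rcos_sum[OF K_normal, of c d] by (simp add: tensor_group_def Let_def coset_def)

lemma coset_K: "c \<in> K \<Longrightarrow> coset c = \<zero>\<^bsub>TG\<^esub>"
  using group.coset_join2[OF group_free_Abelian_group _ K_subgroup, of c]
    subgroup.mem_carrier[OF K_subgroup]
  by (simp add: tensor_group_def Let_def coset_def)

lemma coset_0: "coset 0 = \<zero>\<^bsub>TG\<^esub>"
  using coset_K subgroup.one_closed[OF K_subgroup] by simp

lemma zero_F: "0 \<in> carrier F"
  by simp

lemma uminus_F: "c \<in> carrier F \<Longrightarrow> - c \<in> carrier F"
  by simp

lemma TG_abelian_group: "abelian_group TG"
proof (rule abelian_groupI)
  fix u v w assume "u \<in> carrier TG" "v \<in> carrier TG" "w \<in> carrier TG"
  then show "u \<oplus>\<^bsub>TG\<^esub> v \<oplus>\<^bsub>TG\<^esub> w = u \<oplus>\<^bsub>TG\<^esub> (v \<oplus>\<^bsub>TG\<^esub> w)"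
    unfolding carrier_TG by (auto simp: coset_add F_add add.assoc simp del: carrier_free_Abelian_group_iff)
next
  fix u v assume "u \<in> carrier TG" "v \<in> carrier TG"
  then show "u \<oplus>\<^bsub>TG\<^esub> v \<in> carrier TG" "u \<oplus>\<^bsub>TG\<^esub> v = v \<oplus>\<^bsub>TG\<^esub> u"
    unfolding carrier_TG by (auto simp: coset_add F_add add.commute simp del: carrier_free_Abelian_group_iff)
next
  show zero: "\<zero>\<^bsub>TG\<^esub> \<in> carrier TG"
    unfolding coset_0[symmetric] by (rule coset_closed[OF zero_F])
  fix u assume "u \<in> carrier TG"
  then obtain c where c: "c \<in> carrier F" "u = coset c"
    unfolding carrier_TG by blast
  show "\<zero>\<^bsub>TG\<^esub> \<oplus>\<^bsub>TG\<^esub> u = u"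
    using coset_add[OF zero_F c(1)] c(2) by (simp add: coset_0)
  show "\<exists>v\<in>carrier TG. v \<oplus>\<^bsub>TG\<^esub> u = \<zero>\<^bsub>TG\<^esub>"
    using coset_add[OF uminus_F[OF c(1)] c(1)] coset_closed[OF uminus_F[OF c(1)]] c(2)
    by (auto simp: coset_0)
qed

lemma pure_coset: "x \<otimes>\<^sub>t y = coset (frag_of (x, y))"
  by (simp add: pure_tensor_def coset_def)

lemma pure_closed: "\<lbrakk>x \<in> carrier X; y \<in> carrier Y\<rbrakk> \<Longrightarrow> x \<otimes>\<^sub>t y \<in> carrier TG"
  unfolding pure_coset by (rule coset_closed[OF frag_of_F])

lemma coset_diff_K:
  assumes "c - d \<in> K" "c \<in> carrier F" "d \<in> carrier F"
  shows "coset c = coset d"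
proof -
  interpret TG: abelian_group TG by (rule TG_abelian_group)
  show ?thesis
    using coset_add[OF F_diff[OF assms(2,3)] assms(3)] coset_K[OF assms(1)] coset_closed[OF assms(3)]
    by simp
qed

lemma pure_add_left:
  assumes "x \<in> carrier X" "x' \<in> carrier X" "y \<in> carrier Y"
  shows "(x \<oplus>\<^bsub>X\<^esub> x') \<otimes>\<^sub>t y = x \<otimes>\<^sub>t y \<oplus>\<^bsub>TG\<^esub> x' \<otimes>\<^sub>t y"
proof -
  have "frag_of (x \<oplus>\<^bsub>X\<^esub> x', y) - frag_of (x, y) - frag_of (x', y) \<in> K"
    using assms by (intro relations_K) (auto simp: tensor_relations_def)
  then have "coset (frag_of (x \<oplus>\<^bsub>X\<^esub> x', y)) = coset (frag_of (x, y) + frag_of (x', y))"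
    using assms by (intro coset_diff_K F_add frag_of_F) (auto simp: diff_diff_eq)
  then show ?thesis
    using assms by (simp add: pure_coset coset_add)
qed

lemma pure_add_right:
  assumes "x \<in> carrier X" "y \<in> carrier Y" "y' \<in> carrier Y"
  shows "x \<otimes>\<^sub>t (y \<oplus>\<^bsub>Y\<^esub> y') = x \<otimes>\<^sub>t y \<oplus>\<^bsub>TG\<^esub> x \<otimes>\<^sub>t y'"
proof -
  have "frag_of (x, y \<oplus>\<^bsub>Y\<^esub> y') - frag_of (x, y) - frag_of (x, y') \<in> K"
    using assms by (intro relations_K) (auto simp: tensor_relations_def)
  then have "coset (frag_of (x, y \<oplus>\<^bsub>Y\<^esub> y')) = coset (frag_of (x, y) + frag_of (x, y'))"
    using assms by (intro coset_diff_K F_add frag_of_F) (auto simp: diff_diff_eq)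
  then show ?thesis
    using assms by (simp add: pure_coset coset_add)
qed

lemma pure_balanced:
  assumes "x \<in> carrier X" "s \<in> carrier S" "y \<in> carrier Y"
  shows "(x \<odot>\<^sub>r\<^bsub>X\<^esub> s) \<otimes>\<^sub>t y = x \<otimes>\<^sub>t (s \<odot>\<^bsub>Y\<^esub> y)"
proof -
  have "frag_of (x \<odot>\<^sub>r\<^bsub>X\<^esub> s, y) - frag_of (x, s \<odot>\<^bsub>Y\<^esub> y) \<in> K"
    using assms by (intro relations_K) (auto simp: tensor_relations_def)
  then show ?thesis
    unfolding pure_coset using assms by (intro coset_diff_K frag_of_F rsmult_closed lsmult_closed)
qed

lemma pure_left_add_hom: "y \<in> carrier Y \<Longrightarrow> (\<lambda>x. x \<otimes>\<^sub>t y) \<in> add_hom X TG"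
  by (intro add_homI pure_closed pure_add_left)

lemma pure_right_add_hom: "x \<in> carrier X \<Longrightarrow> (\<lambda>y. x \<otimes>\<^sub>t y) \<in> add_hom Y TG"
  by (intro add_homI pure_closed pure_add_right)

text \<open>Sums of pure tensors exhaust the group: zero is the tensor of the two zeros, and the
  negative of a pure tensor is pure again, with the sign moved into the left factor.\<close>

lemma tensor_induct [consumes 1, case_names pure add]:
  assumes u: "u \<in> carrier TG"
    and pure: "\<And>x y. x \<in> carrier X \<Longrightarrow> y \<in> carrier Y \<Longrightarrow> P (x \<otimes>\<^sub>t y)"
    and add: "\<And>u v. u \<in> carrier TG \<Longrightarrow> v \<in> carrier TG \<Longrightarrow> P u \<Longrightarrow> P v \<Longrightarrow> P (u \<oplus>\<^bsub>TG\<^esub> v)"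
  shows "P u"
proof -
  interpret TG: abelian_group TG by (rule TG_abelian_group)
  obtain c where c: "Poly_Mapping.keys c \<subseteq> carrier X \<times> carrier Y" "u = coset c"
    using u unfolding carrier_TG by auto
  have uminus: "coset (- c) = \<ominus>\<^bsub>TG\<^esub> coset c" if "c \<in> carrier F" for c
    using coset_add[OF uminus_F[OF that] that] coset_closed[OF uminus_F[OF that]] coset_closed[OF that]
    by (intro TG.minus_equality[symmetric]) (auto simp: coset_0)
  \<comment> \<open>Induction on the free group proceeds through differences, while
    \<open>add\<close> speaks of sums only; the claim is strengthened to \<open>c\<close> and
    \<open>- c\<close> together.\<close>
  have "P (coset c) \<and> P (coset (- c))"
    using c(1)
  proof (induction c rule: free_Abelian_group_induct[consumes 1, case_names zero diff frag])
    case zero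
    have "\<zero>\<^bsub>X\<^esub> \<otimes>\<^sub>t \<zero>\<^bsub>Y\<^esub> = \<zero>\<^bsub>TG\<^esub>"
      using add_hom_zero[OF X.abelian_group_axioms TG_abelian_group pure_left_add_hom] by simp
    then show ?case
      using pure[of "\<zero>\<^bsub>X\<^esub>" "\<zero>\<^bsub>Y\<^esub>"] by (simp add: coset_0)
  next
    case (diff c d)
    then have F: "c \<in> carrier F" "d \<in> carrier F" "- c \<in> carrier F" "- d \<in> carrier F" by auto
    have "P (coset (c + - d))" "P (coset (- c + d))"
      using add[OF coset_closed coset_closed] F diff.IH coset_add by metis+
    then show ?case by (simp add: add.commute)
  next
    case (frag p)
    then obtain x y where p: "p = (x, y)" "x \<in> carrier X" "y \<in> carrier Y" by auto
    have "coset (- frag_of p) = (\<ominus>\<^bsub>X\<^esub> x) \<otimes>\<^sub>t y"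
      using add_hom_neg[OF X.abelian_group_axioms TG_abelian_group pure_left_add_hom[OF p(3)] p(2)]
        uminus[OF frag_of_F[OF p(2,3)]] p(1) by (simp add: pure_coset)
    then show ?case
      using pure p by (simp add: pure_coset[symmetric])
  qed
  then show ?thesis using c(2) by simp
qed

text \<open>The uniqueness half of the universal property. Identities between maps out of
  \<open>U\<close>, and later out of \<open>W\<close>, are reduced to generators with it.\<close>

lemma tensor_hom_eqI:
  assumes "f \<in> add_hom TG G" "g \<in> add_hom TG G" "u \<in> carrier TG"
    and "\<And>x y. x \<in> carrier X \<Longrightarrow> y \<in> carrier Y \<Longrightarrow> f (x \<otimes>\<^sub>t y) = g (x \<otimes>\<^sub>t y)"
  shows "f u = g u"
  using assms(3) by (induction rule: tensor_induct)
    (simp_all add: assms(4) add_hom_add[OF assms(1)] add_hom_add[OF assms(2)])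

section \<open>Balanced maps and the existence half of the universal property\<close>

definition balanced :: "('g, 'm) ring_scheme \<Rightarrow> ('x \<Rightarrow> 'y \<Rightarrow> 'g) \<Rightarrow> bool" where
  "balanced G \<beta> \<longleftrightarrow>
     (\<forall>y\<in>carrier Y. (\<lambda>x. \<beta> x y) \<in> add_hom X G) \<and> (\<forall>x\<in>carrier X. \<beta> x \<in> add_hom Y G) \<and>
     (\<forall>x\<in>carrier X. \<forall>s\<in>carrier S. \<forall>y\<in>carrier Y. \<beta> (x \<odot>\<^sub>r\<^bsub>X\<^esub> s) y = \<beta> x (s \<odot>\<^bsub>Y\<^esub> y))"

lemma balancedI:
  assumes "\<And>y. y \<in> carrier Y \<Longrightarrow> (\<lambda>x. \<beta> x y) \<in> add_hom X G"
    and "\<And>x. x \<in> carrier X \<Longrightarrow> (\<lambda>y. \<beta> x y) \<in> add_hom Y G"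
    and "\<And>x s y. \<lbrakk>x \<in> carrier X; s \<in> carrier S; y \<in> carrier Y\<rbrakk> \<Longrightarrow>
      \<beta> (x \<odot>\<^sub>r\<^bsub>X\<^esub> s) y = \<beta> x (s \<odot>\<^bsub>Y\<^esub> y)"
  shows "balanced G \<beta>"
  using assms by (simp add: balanced_def)

context
  fixes G :: "('g, 'm) ring_scheme" and \<beta> :: "'x \<Rightarrow> 'y \<Rightarrow> 'g"
  assumes G: "abelian_group G" and \<beta>: "balanced G \<beta>"
begin

interpretation G: abelian_group G by (rule G)

definition "ext = frag_sum G (\<lambda>p. \<beta> (fst p) (snd p))"

lemma \<beta>_closed: "x \<in> carrier X \<Longrightarrow> y \<in> carrier Y \<Longrightarrow> \<beta> x y \<in> carrier G"
  using \<beta> add_hom_closed unfolding balanced_def by metis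

lemma \<beta>_funcset: "(\<lambda>p. \<beta> (fst p) (snd p)) \<in> carrier X \<times> carrier Y \<rightarrow> carrier G"
  using \<beta>_closed by auto

lemma ext_closed: "c \<in> carrier F \<Longrightarrow> ext c \<in> carrier G"
  unfolding ext_def using G.frag_sum_closed[OF \<beta>_funcset] by simp

lemma ext_add: "c \<in> carrier F \<Longrightarrow> d \<in> carrier F \<Longrightarrow> ext (c + d) = ext c \<oplus>\<^bsub>G\<^esub> ext d"
  unfolding ext_def using G.frag_sum_add[OF \<beta>_funcset] by simp

lemma ext_diff: "c \<in> carrier F \<Longrightarrow> d \<in> carrier F \<Longrightarrow> ext (c - d) = ext c \<ominus>\<^bsub>G\<^esub> ext d"
  unfolding ext_def using G.frag_sum_diff[OF \<beta>_funcset] by simp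

lemma ext_pure: "x \<in> carrier X \<Longrightarrow> y \<in> carrier Y \<Longrightarrow> ext (frag_of (x, y)) = \<beta> x y"
  unfolding ext_def using G.frag_sum_frag_of[of "\<lambda>p. \<beta> (fst p) (snd p)" "(x, y)"] \<beta>_closed by simp

lemma ext_0: "ext 0 = \<zero>\<^bsub>G\<^esub>"
  unfolding ext_def by (rule G.frag_sum_zero)

lemma ext_relation:
  assumes "r \<in> tensor_relations S X Y"
  shows "ext r = \<zero>\<^bsub>G\<^esub>"
  using assms unfolding tensor_relations_def
proof (elim UnE CollectE exE conjE)
  fix x x' y assume r: "r = frag_of (x \<oplus>\<^bsub>X\<^esub> x', y) - frag_of (x, y) - frag_of (x', y)"
    and xy: "x \<in> carrier X" "x' \<in> carrier X" "y \<in> carrier Y"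
  have "\<beta> (x \<oplus>\<^bsub>X\<^esub> x') y = \<beta> x y \<oplus>\<^bsub>G\<^esub> \<beta> x' y"
    using \<beta> xy add_hom_add[of "\<lambda>x. \<beta> x y"] unfolding balanced_def by blast
  then show ?thesis
    unfolding r using xy
    by (simp add: ext_diff F_diff frag_of_F ext_pure \<beta>_closed a_minus_def G.a_ac G.r_neg G.r_neg2
        del: carrier_free_Abelian_group_iff)
next
  fix x y y' assume r: "r = frag_of (x, y \<oplus>\<^bsub>Y\<^esub> y') - frag_of (x, y) - frag_of (x, y')"
    and xy: "x \<in> carrier X" "y \<in> carrier Y" "y' \<in> carrier Y"
  have "\<beta> x (y \<oplus>\<^bsub>Y\<^esub> y') = \<beta> x y \<oplus>\<^bsub>G\<^esub> \<beta> x y'"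
    using \<beta> xy add_hom_add[of "\<beta> x"] unfolding balanced_def by blast
  then show ?thesis
    unfolding r using xy
    by (simp add: ext_diff F_diff frag_of_F ext_pure \<beta>_closed a_minus_def G.a_ac G.r_neg G.r_neg2
        del: carrier_free_Abelian_group_iff)
next
  fix x s y assume r: "r = frag_of (x \<odot>\<^sub>r\<^bsub>X\<^esub> s, y) - frag_of (x, s \<odot>\<^bsub>Y\<^esub> y)"
    and xy: "x \<in> carrier X" "s \<in> carrier S" "y \<in> carrier Y"
  have "\<beta> (x \<odot>\<^sub>r\<^bsub>X\<^esub> s) y = \<beta> x (s \<odot>\<^bsub>Y\<^esub> y)"
    using \<beta> xy unfolding balanced_def by blast
  then show ?thesis
    unfolding r using xy
    by (simp add: ext_diff frag_of_F ext_pure \<beta>_closed a_minus_def G.r_neg rsmult_closed lsmult_closed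
        del: carrier_free_Abelian_group_iff)
qed

text \<open>An additive map that kills the generating relations kills the subgroup they
  generate.\<close>

lemma ext_K:
  assumes "k \<in> K"
  shows "ext k = \<zero>\<^bsub>G\<^esub>"
  using assms unfolding tensor_kernel_def
proof (induction rule: generate.induct)
  case (inv h)
  then have h: "h \<in> carrier F" using relations_F by blast
  \<comment> \<open>The inverse is written as a difference so that \<open>ext_diff\<close>
    applies.\<close>
  then have "inv\<^bsub>F\<^esub> h = 0 - h" by simp
  moreover have "ext (0 - h) = \<zero>\<^bsub>G\<^esub>"
    using ext_diff[OF zero_F h] ext_relation[OF inv] by (simp add: ext_0 a_minus_def)
  ultimately show ?case by metis
next
  case (eng h k)
  then have "h \<in> carrier F" "k \<in> carrier F"
    using subgroup.mem_carrier[OF K_subgroup] by (auto simp: tensor_kernel_def)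
  then show ?case
    using eng.IH by (simp add: ext_add del: carrier_free_Abelian_group_iff)
qed (simp_all add: ext_0 ext_relation)

text \<open>Members of a coset differ by elements of the kernel, on which \<open>ext\<close>
  vanishes. The image of the coset is therefore a singleton, and \<open>the_elem\<close> in
  \<open>tensor_lift\<close> returns its only element.\<close>

lemma tensor_lift_coset:
  assumes c: "c \<in> carrier F"
  shows "tensor_lift G \<beta> (coset c) = ext c"
proof -
  have eq: "ext d = ext c" if d: "d \<in> coset c" for d
  proof -
    obtain k where k: "k \<in> K" "d = k + c"
      using d by (auto simp: coset_def r_coset_def)
    then show ?thesis
      using ext_add[OF subgroup.mem_carrier[OF K_subgroup k(1)] c] ext_K[OF k(1)] ext_closed[OF c] by simp
  qed
  have "c \<in> coset c"
    using group.rcos_self[OF group_free_Abelian_group c K_subgroup] by (simp add: coset_def)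
  then have "{ext c} \<subseteq> ext ` coset c" by blast
  moreover have "ext ` coset c \<subseteq> {ext c}"
    unfolding image_subset_iff singleton_iff by (intro ballI eq)
  ultimately have "ext ` coset c = {ext c}" by (rule subset_antisym[rotated])
  then show ?thesis
    by (simp add: tensor_lift_def ext_def frag_sum_def)
qed

lemma tensor_lift_pure:
  "x \<in> carrier X \<Longrightarrow> y \<in> carrier Y \<Longrightarrow> tensor_lift G \<beta> (x \<otimes>\<^sub>t y) = \<beta> x y"
  unfolding pure_coset by (simp add: tensor_lift_coset ext_pure)

lemma tensor_lift_add_hom: "tensor_lift G \<beta> \<in> add_hom TG G"
proof (rule add_homI)
  fix u v assume "u \<in> carrier TG" "v \<in> carrier TG"
  then obtain c d where "c \<in> carrier F" "u = coset c" "d \<in> carrier F" "v = coset d"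
    unfolding carrier_TG by blast
  then show "tensor_lift G \<beta> (u \<oplus>\<^bsub>TG\<^esub> v) = tensor_lift G \<beta> u \<oplus>\<^bsub>G\<^esub> tensor_lift G \<beta> v"
    by (simp add: tensor_lift_coset coset_add F_add ext_add del: carrier_free_Abelian_group_iff)
next
  fix u assume "u \<in> carrier TG"
  then show "tensor_lift G \<beta> u \<in> carrier G"
    unfolding carrier_TG by (auto simp: tensor_lift_coset ext_closed simp del: carrier_free_Abelian_group_iff)
qed

end

section \<open>Functoriality: the map induced by a pair of linear maps\<close>

context
  fixes f :: "'x \<Rightarrow> 'x" and g :: "'y \<Rightarrow> 'y"
  assumes f: "f \<in> add_hom X X" and g: "g \<in> add_hom Y Y"
    and f_right: "\<And>x s. x \<in> carrier X \<Longrightarrow> s \<in> carrier S \<Longrightarrow> f (x \<odot>\<^sub>r\<^bsub>X\<^esub> s) = f x \<odot>\<^sub>r\<^bsub>X\<^esub> s"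
    and g_left: "\<And>s y. s \<in> carrier S \<Longrightarrow> y \<in> carrier Y \<Longrightarrow> g (s \<odot>\<^bsub>Y\<^esub> y) = s \<odot>\<^bsub>Y\<^esub> g y"
begin

lemma tensor_map_balanced: "balanced TG (\<lambda>x y. f x \<otimes>\<^sub>t g y)"
proof (rule balancedI)
  show "(\<lambda>x. f x \<otimes>\<^sub>t g y) \<in> add_hom X TG" if "y \<in> carrier Y" for y
    by (rule add_hom_compose[OF pure_left_add_hom f]) (rule add_hom_closed[OF g that])
  show "(\<lambda>y. f x \<otimes>\<^sub>t g y) \<in> add_hom Y TG" if "x \<in> carrier X" for x
    by (rule add_hom_compose[OF pure_right_add_hom g]) (rule add_hom_closed[OF f that])
qed (simp add: f_right g_left pure_balanced add_hom_closed[OF f] add_hom_closed[OF g])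

lemma tensor_map_pure:
  "x \<in> carrier X \<Longrightarrow> y \<in> carrier Y \<Longrightarrow> tensor_map S X Y f g (x \<otimes>\<^sub>t y) = f x \<otimes>\<^sub>t g y"
  unfolding tensor_map_def by (rule tensor_lift_pure[OF TG_abelian_group tensor_map_balanced])

lemma tensor_map_add_hom: "tensor_map S X Y f g \<in> add_hom TG TG"
  unfolding tensor_map_def by (rule tensor_lift_add_hom[OF TG_abelian_group tensor_map_balanced])

end

end

lemma tensor_module_simps [simp]:
  "carrier (tensor_module S X Y) = carrier (tensor_group S X Y)"
  "\<zero>\<^bsub>tensor_module S X Y\<^esub> = \<zero>\<^bsub>tensor_group S X Y\<^esub>"
  "add (tensor_module S X Y) = add (tensor_group S X Y)"
  "p \<odot>\<^bsub>tensor_module S X Y\<^esub> u = tensor_map S X Y (\<lambda>x. p \<odot>\<^bsub>X\<^esub> x) (\<lambda>y. y) u"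
  by (simp_all add: tensor_module_def)

lemma tensor_bimodule_simps [simp]:
  "carrier (tensor_bimodule S X Y) = carrier (tensor_group S X Y)"
  "\<zero>\<^bsub>tensor_bimodule S X Y\<^esub> = \<zero>\<^bsub>tensor_group S X Y\<^esub>"
  "add (tensor_bimodule S X Y) = add (tensor_group S X Y)"
  "p \<odot>\<^bsub>tensor_bimodule S X Y\<^esub> u = tensor_map S X Y (\<lambda>x. p \<odot>\<^bsub>X\<^esub> x) (\<lambda>y. y) u"
  "u \<odot>\<^sub>r\<^bsub>tensor_bimodule S X Y\<^esub> q = tensor_map S X Y (\<lambda>x. x) (\<lambda>y. y \<odot>\<^sub>r\<^bsub>Y\<^esub> q) u"
  by (simp_all add: tensor_bimodule_def)

lemma id_add_hom: "(\<lambda>x. x) \<in> add_hom G G"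
  by (simp add: add_hom_def)

text \<open>The extra assumption is that the two actions on \<open>X\<close> commute. It makes left
  multiplication by \<open>p\<close> right linear over \<open>S\<close>, so that
  \<open>tensor_map\<close> extends it to the tensor product.\<close>

locale bimodule_tensor_product = tensor_product S X Y + L?: left_module P X
  for P :: "('p, 'k) ring_scheme" and S :: "('s, 'l) ring_scheme"
    and X :: "('p, 's, 'x, 'i) bimodule_scheme" and Y :: "('s, 'y, 'j) module_scheme" +
  assumes smult_rsmult:
    "\<lbrakk>p \<in> carrier P; x \<in> carrier X; s \<in> carrier S\<rbrakk> \<Longrightarrow>
     p \<odot>\<^bsub>X\<^esub> (x \<odot>\<^sub>r\<^bsub>X\<^esub> s) = (p \<odot>\<^bsub>X\<^esub> x) \<odot>\<^sub>r\<^bsub>X\<^esub> s"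
begin

abbreviation "TM \<equiv> tensor_module S X Y"

lemma TM_smult_pure:
  "\<lbrakk>p \<in> carrier P; x \<in> carrier X; y \<in> carrier Y\<rbrakk> \<Longrightarrow> p \<odot>\<^bsub>TM\<^esub> (x \<otimes>\<^sub>t y) = (p \<odot>\<^bsub>X\<^esub> x) \<otimes>\<^sub>t y"
  unfolding tensor_module_simps
  by (rule tensor_map_pure) (auto simp: smult_rsmult id_add_hom L.smult_add_hom)

lemma TM_smult_add_hom: "p \<in> carrier P \<Longrightarrow> (\<lambda>u. p \<odot>\<^bsub>TM\<^esub> u) \<in> add_hom TG TG"
  unfolding tensor_module_simps
  by (rule tensor_map_add_hom) (auto simp: smult_rsmult id_add_hom L.smult_add_hom)

text \<open>The axioms for unit, products and sums of scalars hold on pure tensors and persist under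
  addition.\<close>

lemma TM_left_module: "left_module P TM"
proof -
  interpret TG: abelian_group TG by (rule TG_abelian_group)
  note [simp] = TM_smult_pure L.smult_closed add_hom_add[OF TM_smult_add_hom]
    add_hom_closed[OF TM_smult_add_hom] pure_closed
  show ?thesis
  proof (rule left_moduleI)
    show "ring P" by (rule L.R.ring_axioms)
    show "abelian_group TM"
      by (rule abelian_group_transfer[OF TG_abelian_group]) simp_all
    show "p \<odot>\<^bsub>TM\<^esub> u \<in> carrier TM" if "p \<in> carrier P" "u \<in> carrier TM" for p u
      using add_hom_closed[OF TM_smult_add_hom] that by (simp del: tensor_module_simps(4))
    show "p \<odot>\<^bsub>TM\<^esub> (u \<oplus>\<^bsub>TM\<^esub> v) = p \<odot>\<^bsub>TM\<^esub> u \<oplus>\<^bsub>TM\<^esub> p \<odot>\<^bsub>TM\<^esub> v"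
      if "p \<in> carrier P" "u \<in> carrier TM" "v \<in> carrier TM" for p u v
      using that by (simp del: tensor_module_simps(4))
    fix u assume "u \<in> carrier TM"
    then have u: "u \<in> carrier TG" by simp
    show "\<one>\<^bsub>P\<^esub> \<odot>\<^bsub>TM\<^esub> u = u"
      using u by (induction rule: tensor_induct) (simp_all add: L.smult_one del: tensor_module_simps(4))
    show "(p \<oplus>\<^bsub>P\<^esub> q) \<odot>\<^bsub>TM\<^esub> u = p \<odot>\<^bsub>TM\<^esub> u \<oplus>\<^bsub>TM\<^esub> q \<odot>\<^bsub>TM\<^esub> u"
      if "p \<in> carrier P" "q \<in> carrier P" for p q
      using u that by (induction rule: tensor_induct)
        (simp_all add: L.smult_l_distr pure_add_left TG.a_ac del: tensor_module_simps(4))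
    show "(p \<otimes>\<^bsub>P\<^esub> q) \<odot>\<^bsub>TM\<^esub> u = p \<odot>\<^bsub>TM\<^esub> (q \<odot>\<^bsub>TM\<^esub> u)"
      if "p \<in> carrier P" "q \<in> carrier P" for p q
      using u that by (induction rule: tensor_induct)
        (simp_all add: L.smult_assoc1 del: tensor_module_simps(4))
  qed
qed

end

section \<open>The induced module\<close>

locale induced = frobenius_system R A \<iota> E J x y + T?: left_module R T
  for R :: "('r, 'l) ring_scheme" and A :: "('a, 'k) ring_scheme" and \<iota> and E
    and J :: "'j set" and x y and T :: "('r, 't, 'm) module_scheme"
begin

abbreviation "Al \<equiv> ring_bimodule (\<lambda>a. a) \<iota> A"
abbreviation "U \<equiv> tensor_module R Al T"
abbreviation "UR \<equiv> restrict_scalars \<iota> U"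
abbreviation tensU (infixl \<open>\<otimes>\<^sub>U\<close> 70) where "a \<otimes>\<^sub>U t \<equiv> pure_tensor R Al T a t"
abbreviation "S \<equiv> End_ring R T"
abbreviation "B \<equiv> End_ring A U"
abbreviation "\<rho> \<equiv> induced_endo R A \<iota> T"

lemma Al_left_module: "left_module A Al"
  by (rule ring_bimodule_left_module[OF A.ring_axioms A.ring_axioms]) (auto intro: ring_hom_memI)

sublocale U: bimodule_tensor_product A R Al T
proof -
  interpret Al: left_module A Al by (rule Al_left_module)
  show "bimodule_tensor_product A R Al T"
    by unfold_locales (auto simp: \<iota>_closed A.m_assoc intro!: T.smult_closed)
qed

sublocale UM: left_module A U
  by (rule U.TM_left_module)

sublocale S: ring S
  by (rule T.ring_End_ring)

sublocale B: ring B
  by (rule UM.ring_End_ring)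

lemma U_abelian_group: "abelian_group U"
  by (rule UM.M.abelian_group_axioms)

text \<open>The general tensor results are stated for \<open>tensor_group\<close>, the module
  results for \<open>U\<close>. Both have the same carrier and addition, hence the same additive
  maps.\<close>

lemma add_hom_U_left: "add_hom (tensor_group R Al T) G = add_hom U G"
  by (rule add_hom_carrier_cong) simp_all

lemma add_hom_U_right: "add_hom G (tensor_group R Al T) = add_hom G U"
  by (rule add_hom_carrier_cong) simp_all

lemma UR_left_module: "left_module R UR"
  by (rule restrict_scalars_left_module[OF R.ring_axioms UM.left_module_axioms ring_hom])

lemma tens_closed: "a \<in> carrier A \<Longrightarrow> t \<in> carrier T \<Longrightarrow> a \<otimes>\<^sub>U t \<in> carrier U"
  using U.pure_closed by simp

lemma tens_left_add_hom:
  assumes "t \<in> carrier T"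
  shows "(\<lambda>a. a \<otimes>\<^sub>U t) \<in> add_hom A U"
proof -
  have "add_hom A U = add_hom Al (tensor_group R Al T)"
    by (rule add_hom_carrier_cong) simp_all
  then show ?thesis using U.pure_left_add_hom[OF assms] by simp
qed

lemma tens_right_add_hom: "a \<in> carrier A \<Longrightarrow> (\<lambda>t. a \<otimes>\<^sub>U t) \<in> add_hom T U"
  using U.pure_right_add_hom by (simp add: add_hom_U_right)

lemma tens_smult:
  "c \<in> carrier A \<Longrightarrow> a \<in> carrier A \<Longrightarrow> t \<in> carrier T \<Longrightarrow> c \<odot>\<^bsub>U\<^esub> (a \<otimes>\<^sub>U t) = (c \<otimes>\<^bsub>A\<^esub> a) \<otimes>\<^sub>U t"
  using U.TM_smult_pure by (simp del: tensor_module_simps)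

lemma tens_balanced:
  "a \<in> carrier A \<Longrightarrow> r \<in> carrier R \<Longrightarrow> t \<in> carrier T \<Longrightarrow> (a \<otimes>\<^bsub>A\<^esub> \<iota> r) \<otimes>\<^sub>U t = a \<otimes>\<^sub>U (r \<odot>\<^bsub>T\<^esub> t)"
  using U.pure_balanced by simp

lemma U_hom_eqI:
  assumes "f \<in> add_hom U G" "g \<in> add_hom U G" "u \<in> carrier U"
    and "\<And>a t. a \<in> carrier A \<Longrightarrow> t \<in> carrier T \<Longrightarrow> f (a \<otimes>\<^sub>U t) = g (a \<otimes>\<^sub>U t)"
  shows "f u = g u"
  using U.tensor_hom_eqI[of f G g u] assms by (simp add: add_hom_U_left)

declare tensor_module_simps(4) [simp del]

section \<open>The map from \<open>U\<close> to \<open>T\<close> induced by \<open>E\<close>, and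
  the recovery of \<open>U\<close> from it\<close>

definition ET where "ET = tensor_lift T (\<lambda>a t. E a \<odot>\<^bsub>T\<^esub> t)"

text \<open>Right linearity of \<open>E\<close> enters here: \<open>E (a \<iota> r)\<close> acting
  on \<open>t\<close> is \<open>E a\<close> acting on \<open>r t\<close>.\<close>

lemma ET_balanced: "U.balanced T (\<lambda>a t. E a \<odot>\<^bsub>T\<^esub> t)"
  by (rule U.balancedI)
    (auto intro!: add_homI simp: E_closed T.smult_closed E_right add_hom_add[OF E_add_hom]
      T.smult_l_distr T.smult_r_distr T.smult_assoc1)

lemma ET_tens: "a \<in> carrier A \<Longrightarrow> t \<in> carrier T \<Longrightarrow> ET (a \<otimes>\<^sub>U t) = E a \<odot>\<^bsub>T\<^esub> t"
  unfolding ET_def using U.tensor_lift_pure[OF T.M.abelian_group_axioms ET_balanced] by simp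

lemma ET_add_hom: "ET \<in> add_hom U T"
  unfolding ET_def using U.tensor_lift_add_hom[OF T.M.abelian_group_axioms ET_balanced]
  by (simp add: add_hom_U_left)

lemma ET_closed: "u \<in> carrier U \<Longrightarrow> ET u \<in> carrier T"
  by (rule add_hom_closed[OF ET_add_hom])

text \<open>This is \<open>expand_y\<close> tensored with \<open>T\<close>: on
  \<open>a \<otimes> t\<close> the scalar \<open>E (x j a)\<close> crosses the tensor sign from
  \<open>t\<close> to \<open>y j\<close>.\<close>

lemma U_expand:
  assumes "u \<in> carrier U"
  shows "(\<Oplus>\<^bsub>U\<^esub>j\<in>J. y j \<otimes>\<^sub>U ET (x j \<odot>\<^bsub>U\<^esub> u)) = u"
proof (rule U_hom_eqI[OF _ id_add_hom assms])
  show "(\<lambda>u. \<Oplus>\<^bsub>U\<^esub>j\<in>J. y j \<otimes>\<^sub>U ET (x j \<odot>\<^bsub>U\<^esub> u)) \<in> add_hom U U"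
    by (intro finsum_add_hom_family U_abelian_group add_hom_compose[OF tens_right_add_hom]
        add_hom_compose[OF ET_add_hom UM.smult_add_hom] x_closed y_closed)
  fix a t assume at: "a \<in> carrier A" "t \<in> carrier T"
  have "(\<Oplus>\<^bsub>U\<^esub>j\<in>J. y j \<otimes>\<^sub>U ET (x j \<odot>\<^bsub>U\<^esub> (a \<otimes>\<^sub>U t)))
      = (\<Oplus>\<^bsub>U\<^esub>j\<in>J. (y j \<otimes>\<^bsub>A\<^esub> \<iota> (E (x j \<otimes>\<^bsub>A\<^esub> a))) \<otimes>\<^sub>U t)"
    using at by (intro UM.M.finsum_cong' Pi_I tens_closed)
      (auto simp: tens_smult ET_tens tens_balanced x_closed y_closed E_closed \<iota>_closed
        simp del: tensor_module_simps)
  also have "\<dots> = (\<Oplus>\<^bsub>A\<^esub>j\<in>J. y j \<otimes>\<^bsub>A\<^esub> \<iota> (E (x j \<otimes>\<^bsub>A\<^esub> a))) \<otimes>\<^sub>U t"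
    using at by (intro add_hom_finsum[symmetric, OF A.abelian_group_axioms U_abelian_group tens_left_add_hom])
      (auto simp: x_closed y_closed E_closed \<iota>_closed)
  also have "\<dots> = a \<otimes>\<^sub>U t" using expand_y[OF at(1)] by simp
  finally show "(\<Oplus>\<^bsub>U\<^esub>j\<in>J. y j \<otimes>\<^sub>U ET (x j \<odot>\<^bsub>U\<^esub> (a \<otimes>\<^sub>U t))) = a \<otimes>\<^sub>U t" .
qed

text \<open>Injectivity of the comparison map from \<open>U\<close> to the coinduced module, which
  sends \<open>u\<close> to \<open>c \<mapsto> ET (c u)\<close>: by \<open>U_expand\<close> the
  values at the \<open>x j\<close> already determine \<open>u\<close>.\<close>

lemma ET_separates:
  assumes "u \<in> carrier U" "v \<in> carrier U"
    and "\<And>c. c \<in> carrier A \<Longrightarrow> ET (c \<odot>\<^bsub>U\<^esub> u) = ET (c \<odot>\<^bsub>U\<^esub> v)"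
  shows "u = v"
proof -
  have "(\<Oplus>\<^bsub>U\<^esub>j\<in>J. y j \<otimes>\<^sub>U ET (x j \<odot>\<^bsub>U\<^esub> u)) = (\<Oplus>\<^bsub>U\<^esub>j\<in>J. y j \<otimes>\<^sub>U ET (x j \<odot>\<^bsub>U\<^esub> v))"
    using assms(2) by (intro UM.M.finsum_cong' Pi_I tens_closed ET_closed UM.smult_closed)
      (auto simp: assms(3) x_closed y_closed)
  then show ?thesis using U_expand assms by simp
qed

section \<open>Linearity and equality criteria for elements of \<open>S\<close> and
  \<open>B\<close>\<close>

lemma B_closed: "b \<in> carrier B \<Longrightarrow> u \<in> carrier U \<Longrightarrow> b u \<in> carrier U"
  by (auto simp: lmod_hom_def simp del: tensor_module_simps)

lemma B_smult: "b \<in> carrier B \<Longrightarrow> c \<in> carrier A \<Longrightarrow> u \<in> carrier U \<Longrightarrow> b (c \<odot>\<^bsub>U\<^esub> u) = c \<odot>\<^bsub>U\<^esub> b u"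
  by (auto simp: lmod_hom_def simp del: tensor_module_simps)

lemma B_add_hom: "b \<in> carrier B \<Longrightarrow> b \<in> add_hom U U"
  by (auto intro: lmod_hom_add_hom simp del: tensor_module_simps)

lemma S_closed: "s \<in> carrier S \<Longrightarrow> t \<in> carrier T \<Longrightarrow> s t \<in> carrier T"
  by (auto simp: lmod_hom_def)

lemma S_smult: "s \<in> carrier S \<Longrightarrow> r \<in> carrier R \<Longrightarrow> t \<in> carrier T \<Longrightarrow> s (r \<odot>\<^bsub>T\<^esub> t) = r \<odot>\<^bsub>T\<^esub> s t"
  by (auto simp: lmod_hom_def)

lemma S_add_hom: "s \<in> carrier S \<Longrightarrow> s \<in> add_hom T T"
  by (auto intro: lmod_hom_add_hom)

lemma B_memI:
  assumes "h \<in> add_hom U U"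
    and "\<And>c u. c \<in> carrier A \<Longrightarrow> u \<in> carrier U \<Longrightarrow> h (c \<odot>\<^bsub>U\<^esub> u) = c \<odot>\<^bsub>U\<^esub> h u"
  shows "restrict h (carrier U) \<in> carrier B"
  using UM.restrict_lmod_hom[OF lmod_homI[OF assms]] by simp

lemma smult_one_tens: "a \<in> carrier A \<Longrightarrow> t \<in> carrier T \<Longrightarrow> a \<otimes>\<^sub>U t = a \<odot>\<^bsub>U\<^esub> (\<one>\<^bsub>A\<^esub> \<otimes>\<^sub>U t)"
  by (simp add: tens_smult)

text \<open>The elements \<open>1 \<otimes> t\<close> generate \<open>U\<close> as an
  \<open>A\<close>-module, so an \<open>A\<close>-linear map is fixed by its values there.\<close>

lemma B_eqI:
  assumes b: "b \<in> carrier B" and c: "c \<in> carrier B"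
    and eq: "\<And>t. t \<in> carrier T \<Longrightarrow> b (\<one>\<^bsub>A\<^esub> \<otimes>\<^sub>U t) = c (\<one>\<^bsub>A\<^esub> \<otimes>\<^sub>U t)"
  shows "b = c"
proof (rule UM.End_ring_eqI[OF b c])
  fix u assume "u \<in> carrier U"
  then show "b u = c u"
  proof (rule U_hom_eqI[OF B_add_hom[OF b] B_add_hom[OF c]])
    show "b (a \<otimes>\<^sub>U t) = c (a \<otimes>\<^sub>U t)" if "a \<in> carrier A" "t \<in> carrier T" for a t
      unfolding smult_one_tens[OF that] using b c that
      by (simp only: B_smult tens_closed A.one_closed eq)
  qed
qed

section \<open>Lifting linear maps between \<open>T\<close> and \<open>U\<close> to endomorphisms of
  \<open>U\<close>\<close>

definition up where
  "up q = restrict (tensor_lift U (\<lambda>a t. a \<odot>\<^bsub>U\<^esub> q t)) (carrier U)"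

context
  fixes q assumes q: "q \<in> lmod_hom R T UR"
begin

lemma q_closed: "t \<in> carrier T \<Longrightarrow> q t \<in> carrier U"
  using lmod_hom_closed[OF q] by simp

text \<open>Linearity of \<open>q\<close> into the restricted module means
  \<open>q (r t) = \<iota> r (q t)\<close>, which is the balancing condition. The construction is
  the adjunction between extension and restriction of scalars.\<close>

lemma up_balanced: "U.balanced U (\<lambda>a t. a \<odot>\<^bsub>U\<^esub> q t)"
proof (rule U.balancedI)
  show "(\<lambda>a. a \<odot>\<^bsub>U\<^esub> q t) \<in> add_hom Al U" if "t \<in> carrier T" for t
    using UM.smult_add_hom_scalar[OF q_closed[OF that]] by (simp add: add_hom_def)
  show "(\<lambda>t. a \<odot>\<^bsub>U\<^esub> q t) \<in> add_hom T U" if "a \<in> carrier Al" for a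
    using lmod_hom_add_hom[OF q] that
    by (intro add_hom_compose[OF UM.smult_add_hom]) (auto simp: add_hom_def)
  show "(a \<odot>\<^sub>r\<^bsub>Al\<^esub> r) \<odot>\<^bsub>U\<^esub> q t = a \<odot>\<^bsub>U\<^esub> q (r \<odot>\<^bsub>T\<^esub> t)"
    if "a \<in> carrier Al" "r \<in> carrier R" "t \<in> carrier T" for a r t
    using that lmod_hom_smult[OF q that(2,3)] q_closed[OF that(3)] UM.smult_assoc1[of a "\<iota> r" "q t"]
    by (simp add: \<iota>_closed)
qed

lemma up_tens: "a \<in> carrier A \<Longrightarrow> t \<in> carrier T \<Longrightarrow> up q (a \<otimes>\<^sub>U t) = a \<odot>\<^bsub>U\<^esub> q t"
  using U.tensor_lift_pure[OF U_abelian_group up_balanced] tens_closed by (simp add: up_def)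

lemma up_one_tens: "t \<in> carrier T \<Longrightarrow> up q (\<one>\<^bsub>A\<^esub> \<otimes>\<^sub>U t) = q t"
  using up_tens q_closed UM.smult_one by simp

lemma up_closed: "up q \<in> carrier B"
  unfolding up_def
proof (rule B_memI)
  let ?h = "tensor_lift U (\<lambda>a t. a \<odot>\<^bsub>U\<^esub> q t)"
  show h: "?h \<in> add_hom U U"
    using U.tensor_lift_add_hom[OF U_abelian_group up_balanced] by (simp add: add_hom_U_left)
  fix c u assume c: "c \<in> carrier A" and u: "u \<in> carrier U"
  show "?h (c \<odot>\<^bsub>U\<^esub> u) = c \<odot>\<^bsub>U\<^esub> ?h u"
  proof (rule U_hom_eqI[OF add_hom_compose[OF h UM.smult_add_hom[OF c]]
          add_hom_compose[OF UM.smult_add_hom[OF c] h] u])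
    fix a t assume at: "a \<in> carrier A" "t \<in> carrier T"
    have lift: "?h (a' \<otimes>\<^sub>U t) = a' \<odot>\<^bsub>U\<^esub> q t" if "a' \<in> carrier A" for a'
      using U.tensor_lift_pure[OF U_abelian_group up_balanced] that at(2) by simp
    show "?h (c \<odot>\<^bsub>U\<^esub> (a \<otimes>\<^sub>U t)) = c \<odot>\<^bsub>U\<^esub> ?h (a \<otimes>\<^sub>U t)"
      using c at q_closed[OF at(2)] by (simp add: tens_smult lift UM.smult_assoc1)
  qed
qed

end

text \<open>The inverse of the bijection \<open>b \<mapsto> ET \<circ> b\<close> from \<open>B\<close> to \<open>Hom\<^sub>R(U, T)\<close>.\<close>

definition down where
  "down p = (\<lambda>u\<in>carrier U. \<Oplus>\<^bsub>U\<^esub>j\<in>J. y j \<otimes>\<^sub>U p (x j \<odot>\<^bsub>U\<^esub> u))"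

context
  fixes p assumes p: "p \<in> lmod_hom R UR T"
begin

lemma p_closed: "u \<in> carrier U \<Longrightarrow> p u \<in> carrier T"
  using lmod_hom_closed[OF p] by simp

lemma p_add_hom: "p \<in> add_hom U T"
  using lmod_hom_add_hom[OF p] by (simp add: add_hom_def)

lemma p_smult: "r \<in> carrier R \<Longrightarrow> u \<in> carrier U \<Longrightarrow> p (\<iota> r \<odot>\<^bsub>U\<^esub> u) = r \<odot>\<^bsub>T\<^esub> p u"
  using lmod_hom_smult[OF p] by simp

lemma down_terms:
  "u \<in> carrier U \<Longrightarrow> (\<lambda>j. y j \<otimes>\<^sub>U p (x j \<odot>\<^bsub>U\<^esub> u)) \<in> J \<rightarrow> carrier U"
  by (intro Pi_I tens_closed y_closed p_closed UM.smult_closed x_closed)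

lemma down_closed_U: "u \<in> carrier U \<Longrightarrow> down p u \<in> carrier U"
  using UM.M.finsum_closed[OF down_terms] by (simp add: down_def)

text \<open>After \<open>ET\<close> is applied, the \<open>j\<close>-th term is
  \<open>E (c y j)\<close> acting on \<open>p (x j u)\<close>. Linearity of \<open>p\<close>
  collects these terms into \<open>p\<close> of the first expansion of \<open>c\<close> acting on
  \<open>u\<close>. So \<open>expand_x\<close> is the identity used here, as opposed to
  \<open>U_expand\<close>.\<close>

lemma ET_down:
  assumes c: "c \<in> carrier A" and u: "u \<in> carrier U"
  shows "ET (c \<odot>\<^bsub>U\<^esub> down p u) = p (c \<odot>\<^bsub>U\<^esub> u)"
proof -
  have xu: "x j \<odot>\<^bsub>U\<^esub> u \<in> carrier U" if "j \<in> J" for j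
    using x_closed[OF that] u by (rule UM.smult_closed)
  have "ET (c \<odot>\<^bsub>U\<^esub> down p u) = (\<Oplus>\<^bsub>T\<^esub>j\<in>J. ET (c \<odot>\<^bsub>U\<^esub> (y j \<otimes>\<^sub>U p (x j \<odot>\<^bsub>U\<^esub> u))))"
    using add_hom_finsum[OF U_abelian_group T.M.abelian_group_axioms
        add_hom_compose[OF ET_add_hom UM.smult_add_hom[OF c]] down_terms[OF u]] u
    by (simp add: down_def)
  also have "\<dots> = (\<Oplus>\<^bsub>T\<^esub>j\<in>J. p ((\<iota> (E (c \<otimes>\<^bsub>A\<^esub> y j)) \<otimes>\<^bsub>A\<^esub> x j) \<odot>\<^bsub>U\<^esub> u))"
  proof (rule T.M.finsum_cong'[OF refl])
    show "(\<lambda>j. p ((\<iota> (E (c \<otimes>\<^bsub>A\<^esub> y j)) \<otimes>\<^bsub>A\<^esub> x j) \<odot>\<^bsub>U\<^esub> u)) \<in> J \<rightarrow> carrier T"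
      using c u by (intro Pi_I p_closed UM.smult_closed A.m_closed \<iota>_closed E_closed x_closed y_closed)
    fix j assume j: "j \<in> J"
    have "ET (c \<odot>\<^bsub>U\<^esub> (y j \<otimes>\<^sub>U p (x j \<odot>\<^bsub>U\<^esub> u))) = E (c \<otimes>\<^bsub>A\<^esub> y j) \<odot>\<^bsub>T\<^esub> p (x j \<odot>\<^bsub>U\<^esub> u)"
      using c j by (simp add: tens_smult y_closed p_closed[OF xu] ET_tens)
    also have "\<dots> = p (\<iota> (E (c \<otimes>\<^bsub>A\<^esub> y j)) \<odot>\<^bsub>U\<^esub> (x j \<odot>\<^bsub>U\<^esub> u))"
      using c j by (simp add: p_smult xu E_closed y_closed del: tensor_module_simps)
    finally show "ET (c \<odot>\<^bsub>U\<^esub> (y j \<otimes>\<^sub>U p (x j \<odot>\<^bsub>U\<^esub> u)))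
        = p ((\<iota> (E (c \<otimes>\<^bsub>A\<^esub> y j)) \<otimes>\<^bsub>A\<^esub> x j) \<odot>\<^bsub>U\<^esub> u)"
      using c j u by (simp add: UM.smult_assoc1 \<iota>_closed E_closed y_closed x_closed)
  qed
  also have "\<dots> = p ((\<Oplus>\<^bsub>A\<^esub>j\<in>J. \<iota> (E (c \<otimes>\<^bsub>A\<^esub> y j)) \<otimes>\<^bsub>A\<^esub> x j) \<odot>\<^bsub>U\<^esub> u)"
    using c by (intro add_hom_finsum[symmetric, OF A.abelian_group_axioms T.M.abelian_group_axioms
          add_hom_compose[OF p_add_hom UM.smult_add_hom_scalar[OF u]]] Pi_I
        A.m_closed \<iota>_closed E_closed x_closed y_closed)
  also have "\<dots> = p (c \<odot>\<^bsub>U\<^esub> u)"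
    using expand_x[OF c] by simp
  finally show ?thesis .
qed

lemma ET_down_one: "u \<in> carrier U \<Longrightarrow> ET (down p u) = p u"
  using ET_down[of "\<one>\<^bsub>A\<^esub>" u] UM.smult_one[of u] UM.smult_one[OF down_closed_U] by simp

text \<open>Commutation with \<open>A\<close> is not visible in the formula, where the
  \<open>x j\<close> stand to the left of \<open>c\<close>. By \<open>ET_separates\<close> it
  suffices to compare values of \<open>ET\<close>, and \<open>ET_down\<close> evaluates both sides
  to \<open>p (d c u)\<close>.\<close>

lemma down_closed: "down p \<in> carrier B"
proof -
  have "(\<lambda>u. \<Oplus>\<^bsub>U\<^esub>j\<in>J. y j \<otimes>\<^sub>U p (x j \<odot>\<^bsub>U\<^esub> u)) \<in> add_hom U U"
    by (intro finsum_add_hom_family U_abelian_group add_hom_compose[OF tens_right_add_hom]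
        add_hom_compose[OF p_add_hom UM.smult_add_hom] x_closed y_closed)
  moreover have "(\<Oplus>\<^bsub>U\<^esub>j\<in>J. y j \<otimes>\<^sub>U p (x j \<odot>\<^bsub>U\<^esub> (c \<odot>\<^bsub>U\<^esub> u)))
      = c \<odot>\<^bsub>U\<^esub> (\<Oplus>\<^bsub>U\<^esub>j\<in>J. y j \<otimes>\<^sub>U p (x j \<odot>\<^bsub>U\<^esub> u))"
    if c: "c \<in> carrier A" and u: "u \<in> carrier U" for c u
  proof -
    have cu: "c \<odot>\<^bsub>U\<^esub> u \<in> carrier U" by (rule UM.smult_closed[OF c u])
    have "down p (c \<odot>\<^bsub>U\<^esub> u) = c \<odot>\<^bsub>U\<^esub> down p u"
    proof (rule ET_separates[OF down_closed_U[OF cu] UM.smult_closed[OF c down_closed_U[OF u]]])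
      fix d assume d: "d \<in> carrier A"
      show "ET (d \<odot>\<^bsub>U\<^esub> down p (c \<odot>\<^bsub>U\<^esub> u)) = ET (d \<odot>\<^bsub>U\<^esub> (c \<odot>\<^bsub>U\<^esub> down p u))"
        using ET_down[OF d cu] ET_down[OF A.m_closed[OF d c] u]
          UM.smult_assoc1[OF d c u] UM.smult_assoc1[OF d c down_closed_U[OF u]] by simp
    qed
    then show ?thesis using u cu by (simp only: down_def restrict_apply')
  qed
  ultimately show ?thesis
    unfolding down_def by (rule B_memI)
qed

end

section \<open>The homomorphism from \<open>S\<close> to \<open>B\<close> and the Frobenius
  functional on \<open>B\<close>\<close>

context
  fixes s assumes s: "s \<in> carrier S"
begin

lemma \<rho>_map_conditions:
  "(\<lambda>a. a) \<in> add_hom Al Al" "s \<in> add_hom T T"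
  "\<And>a r. a \<in> carrier Al \<Longrightarrow> r \<in> carrier R \<Longrightarrow> a \<odot>\<^sub>r\<^bsub>Al\<^esub> r = a \<odot>\<^sub>r\<^bsub>Al\<^esub> r"
  "\<And>r t. r \<in> carrier R \<Longrightarrow> t \<in> carrier T \<Longrightarrow> s (r \<odot>\<^bsub>T\<^esub> t) = r \<odot>\<^bsub>T\<^esub> s t"
  using s by (auto simp: id_add_hom S_add_hom S_smult simp del: End_ring_simps)

lemma \<rho>_tens: "a \<in> carrier A \<Longrightarrow> t \<in> carrier T \<Longrightarrow> \<rho> s (a \<otimes>\<^sub>U t) = a \<otimes>\<^sub>U s t"
  using U.tensor_map_pure[OF \<rho>_map_conditions] U.pure_closed
  by (simp add: induced_endo_def induced_module_def)

lemma \<rho>_closed: "\<rho> s \<in> carrier B"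
proof -
  let ?h = "tensor_map R Al T (\<lambda>a. a) s"
  have h: "?h \<in> add_hom U U"
    using U.tensor_map_add_hom[OF \<rho>_map_conditions] by (simp add: add_hom_U_left add_hom_U_right)
  have lin: "?h (c \<odot>\<^bsub>U\<^esub> u) = c \<odot>\<^bsub>U\<^esub> ?h u" if c: "c \<in> carrier A" and u: "u \<in> carrier U" for c u
  proof (rule U_hom_eqI[OF add_hom_compose[OF h UM.smult_add_hom[OF c]]
          add_hom_compose[OF UM.smult_add_hom[OF c] h] u])
    fix a t assume at: "a \<in> carrier A" "t \<in> carrier T"
    have map: "?h (a' \<otimes>\<^sub>U t) = a' \<otimes>\<^sub>U s t" if "a' \<in> carrier A" for a'
      using U.tensor_map_pure[OF \<rho>_map_conditions] that at(2) by simp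
    show "?h (c \<odot>\<^bsub>U\<^esub> (a \<otimes>\<^sub>U t)) = c \<odot>\<^bsub>U\<^esub> ?h (a \<otimes>\<^sub>U t)"
      using c at S_closed[OF s at(2)] by (simp add: tens_smult map)
  qed
  show ?thesis
    unfolding induced_endo_def induced_module_def by (rule B_memI[OF h lin])
qed

text \<open>Naturality of \<open>ET\<close> in \<open>T\<close>: \<open>s\<close> is
  \<open>R\<close>-linear and commutes with the scalar \<open>E a\<close>. This will yield the right
  linearity of \<open>EB\<close>.\<close>

lemma ET_\<rho>:
  assumes "u \<in> carrier U"
  shows "ET (\<rho> s u) = s (ET u)"
  by (rule U_hom_eqI[OF add_hom_compose[OF ET_add_hom B_add_hom[OF \<rho>_closed]]
        add_hom_compose[OF S_add_hom[OF s] ET_add_hom] assms])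
    (simp add: \<rho>_tens ET_tens S_closed[OF s] S_smult[OF s] E_closed)

end

lemma B_mult_apply: "u \<in> carrier U \<Longrightarrow> (b \<otimes>\<^bsub>B\<^esub> c) u = c (b u)"
  by (simp add: compose_def)

lemma B_add_apply: "u \<in> carrier U \<Longrightarrow> (b \<oplus>\<^bsub>B\<^esub> c) u = b u \<oplus>\<^bsub>U\<^esub> c u"
  by simp

lemma \<rho>_ring_hom: "\<rho> \<in> ring_hom S B"
proof (rule ring_hom_memI)
  note one_tens = tens_closed[OF A.one_closed]
  show "\<rho> s \<in> carrier B" if "s \<in> carrier S" for s
    using that by (rule \<rho>_closed)
  show "\<rho> (r \<otimes>\<^bsub>S\<^esub> s) = \<rho> r \<otimes>\<^bsub>B\<^esub> \<rho> s" if "r \<in> carrier S" "s \<in> carrier S" for r s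
  proof (rule B_eqI[OF \<rho>_closed B.m_closed])
    fix t assume t: "t \<in> carrier T"
    show "\<rho> (r \<otimes>\<^bsub>S\<^esub> s) (\<one>\<^bsub>A\<^esub> \<otimes>\<^sub>U t) = (\<rho> r \<otimes>\<^bsub>B\<^esub> \<rho> s) (\<one>\<^bsub>A\<^esub> \<otimes>\<^sub>U t)"
      \<comment> \<open>Both rings multiply in reversed order of composition, so
        \<open>\<rho>\<close> preserves the order of factors: \<open>r\<close> acts before
        \<open>s\<close> on either side.\<close>
      unfolding B_mult_apply[OF one_tens[OF t]]
      using \<rho>_tens[OF S.m_closed[OF that] A.one_closed t] \<rho>_tens[OF that(1) A.one_closed t]
        \<rho>_tens[OF that(2) A.one_closed S_closed[OF that(1) t]] t
      by (simp add: compose_def)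
  qed (use that in \<open>blast intro: \<rho>_closed S.m_closed\<close>)+
  show "\<rho> (r \<oplus>\<^bsub>S\<^esub> s) = \<rho> r \<oplus>\<^bsub>B\<^esub> \<rho> s" if "r \<in> carrier S" "s \<in> carrier S" for r s
  proof (rule B_eqI[OF \<rho>_closed B.a_closed])
    fix t assume t: "t \<in> carrier T"
    show "\<rho> (r \<oplus>\<^bsub>S\<^esub> s) (\<one>\<^bsub>A\<^esub> \<otimes>\<^sub>U t) = (\<rho> r \<oplus>\<^bsub>B\<^esub> \<rho> s) (\<one>\<^bsub>A\<^esub> \<otimes>\<^sub>U t)"
      unfolding B_add_apply[OF one_tens[OF t]]
      using \<rho>_tens[OF S.a_closed[OF that] A.one_closed t] \<rho>_tens[OF that(1) A.one_closed t]
        \<rho>_tens[OF that(2) A.one_closed t] t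
        add_hom_add[OF tens_right_add_hom[OF A.one_closed] S_closed[OF that(1) t] S_closed[OF that(2) t]]
      by simp
  qed (use that in \<open>blast intro: \<rho>_closed S.a_closed\<close>)+
  show "\<rho> \<one>\<^bsub>S\<^esub> = \<one>\<^bsub>B\<^esub>"
  proof (rule B_eqI[OF \<rho>_closed[OF S.one_closed] B.one_closed])
    fix t assume t: "t \<in> carrier T"
    show "\<rho> \<one>\<^bsub>S\<^esub> (\<one>\<^bsub>A\<^esub> \<otimes>\<^sub>U t) = \<one>\<^bsub>B\<^esub> (\<one>\<^bsub>A\<^esub> \<otimes>\<^sub>U t)"
      using \<rho>_tens[OF S.one_closed A.one_closed t] t one_tens[OF t] by simp
  qed
qed

definition EB where "EB b = (\<lambda>t\<in>carrier T. ET (b (\<one>\<^bsub>A\<^esub> \<otimes>\<^sub>U t)))"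

text \<open>\<open>EB b\<close> is a composite of three \<open>R\<close>-linear maps:
  \<open>t \<mapsto> 1 \<otimes> t\<close>, then \<open>b\<close>, then \<open>ET\<close>. The
  middle one is linear even over \<open>A\<close>.\<close>

lemma EB_closed:
  assumes b: "b \<in> carrier B"
  shows "EB b \<in> carrier S"
proof -
  have "(\<lambda>t. ET (b (\<one>\<^bsub>A\<^esub> \<otimes>\<^sub>U t))) \<in> lmod_hom R T T"
  proof (rule lmod_homI)
    show "(\<lambda>t. ET (b (\<one>\<^bsub>A\<^esub> \<otimes>\<^sub>U t))) \<in> add_hom T T"
      by (intro add_hom_compose[OF ET_add_hom] add_hom_compose[OF B_add_hom[OF b]]
          tens_right_add_hom A.one_closed)
    fix r t assume rt: "r \<in> carrier R" "t \<in> carrier T"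
    let ?v = "b (\<one>\<^bsub>A\<^esub> \<otimes>\<^sub>U t)"
    have v: "?v \<in> carrier U" by (rule B_closed[OF b tens_closed[OF A.one_closed rt(2)]])
    have "\<one>\<^bsub>A\<^esub> \<otimes>\<^sub>U (r \<odot>\<^bsub>T\<^esub> t) = \<iota> r \<odot>\<^bsub>U\<^esub> (\<one>\<^bsub>A\<^esub> \<otimes>\<^sub>U t)"
      using tens_balanced[OF A.one_closed rt] rt by (simp add: tens_smult \<iota>_closed)
    then have "b (\<one>\<^bsub>A\<^esub> \<otimes>\<^sub>U (r \<odot>\<^bsub>T\<^esub> t)) = \<iota> r \<odot>\<^bsub>U\<^esub> ?v"
      using B_smult[OF b \<iota>_closed[OF rt(1)] tens_closed[OF A.one_closed rt(2)]] by simp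
    \<comment> \<open>Left linearity of \<open>E\<close> carries over to \<open>ET\<close>.\<close>
    moreover have "ET (\<iota> r \<odot>\<^bsub>U\<^esub> v) = r \<odot>\<^bsub>T\<^esub> ET v" if "v \<in> carrier U" for v
      by (rule U_hom_eqI[OF add_hom_compose[OF ET_add_hom UM.smult_add_hom[OF \<iota>_closed[OF rt(1)]]]
            add_hom_compose[OF T.smult_add_hom[OF rt(1)] ET_add_hom] that])
        (simp add: tens_smult ET_tens \<iota>_closed rt(1) E_left E_closed T.smult_assoc1)
    ultimately show "ET (b (\<one>\<^bsub>A\<^esub> \<otimes>\<^sub>U (r \<odot>\<^bsub>T\<^esub> t))) = r \<odot>\<^bsub>T\<^esub> ET ?v"
      using v by simp
  qed
  then show ?thesis
    using T.restrict_lmod_hom by (simp add: EB_def)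
qed

end

section \<open>The induced Frobenius extension\<close>

locale induced_in_add = induced +
  fixes n :: nat and p q
  assumes p: "\<And>j. p j \<in> lmod_hom R UR T" and q: "\<And>j. q j \<in> lmod_hom R T UR"
    and qp: "\<And>u. u \<in> carrier U \<Longrightarrow> (\<Oplus>\<^bsub>U\<^esub>j\<in>{..<n}. q j (p j u)) = u"
begin

text \<open>An additive map applied to the decomposition of \<open>u\<close> yields a decomposition
  of its value; this form allows targets other than \<open>U\<close>.\<close>

lemma qp_hom:
  assumes h: "h \<in> add_hom U G" and G: "abelian_group G" and u: "u \<in> carrier U"
  shows "(\<Oplus>\<^bsub>G\<^esub>j\<in>{..<n}. h (q j (p j u))) = h u"
proof -
  have "h (\<Oplus>\<^bsub>U\<^esub>j\<in>{..<n}. q j (p j u)) = (\<Oplus>\<^bsub>G\<^esub>j\<in>{..<n}. h (q j (p j u)))"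
    using q_closed[OF q p_closed[OF p u]] by (intro add_hom_finsum[OF U_abelian_group G h]) blast
  then show ?thesis using qp[OF u] by simp
qed

lemma one_tens: "t \<in> carrier T \<Longrightarrow> \<one>\<^bsub>A\<^esub> \<otimes>\<^sub>U t \<in> carrier U"
  by (rule tens_closed[OF A.one_closed])

lemma EB_apply: "t \<in> carrier T \<Longrightarrow> EB b t = ET (b (\<one>\<^bsub>A\<^esub> \<otimes>\<^sub>U t))"
  by (simp add: EB_def)

text \<open>The coefficients in the expansion of \<open>b\<close> over \<open>S\<close>: composing
  with \<open>down (p j)\<close> and applying \<open>EB\<close> amounts to following
  \<open>b\<close> by \<open>p j\<close> on the elements \<open>1 \<otimes> t\<close>.\<close>

lemma EB_down:
  assumes b: "b \<in> carrier B" and t: "t \<in> carrier T"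
  shows "EB (b \<otimes>\<^bsub>B\<^esub> down (p j)) t = p j (b (\<one>\<^bsub>A\<^esub> \<otimes>\<^sub>U t))"
  unfolding EB_apply[OF t] B_mult_apply[OF one_tens[OF t]]
  by (rule ET_down_one[OF p B_closed[OF b one_tens[OF t]]])

text \<open>Both sides are compared on \<open>1 \<otimes> t\<close>. There the \<open>j\<close>-th
  term gives \<open>q j (p j v)\<close> with \<open>v\<close> the image of
  \<open>1 \<otimes> t\<close> under \<open>b\<close>, and these add up to \<open>v\<close>.\<close>

lemma expand_up:
  assumes b: "b \<in> carrier B"
  shows "(\<Oplus>\<^bsub>B\<^esub>j\<in>{..<n}. \<rho> (EB (b \<otimes>\<^bsub>B\<^esub> down (p j))) \<otimes>\<^bsub>B\<^esub> up (q j)) = b"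
    (is "finsum B ?f _ = b")
proof -
  have EBc: "EB (b \<otimes>\<^bsub>B\<^esub> down (p j)) \<in> carrier S" for j
    by (rule EB_closed[OF B.m_closed[OF b down_closed[OF p]]])
  have f: "?f \<in> {..<n} \<rightarrow> carrier B"
    by (intro Pi_I B.m_closed \<rho>_closed[OF EBc] up_closed[OF q])
  show ?thesis
  proof (rule B_eqI[OF B.finsum_closed[OF f] b])
    fix t assume t: "t \<in> carrier T"
    let ?u = "\<one>\<^bsub>A\<^esub> \<otimes>\<^sub>U t"
    have u: "?u \<in> carrier U" by (rule one_tens[OF t])
    have bu: "b ?u \<in> carrier U" by (rule B_closed[OF b u])
    have "?f j ?u = q j (p j (b ?u))" for j
    proof -
      have "?f j ?u = up (q j) (\<rho> (EB (b \<otimes>\<^bsub>B\<^esub> down (p j))) ?u)"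
        by (rule B_mult_apply[OF u])
      also have "\<dots> = up (q j) (\<one>\<^bsub>A\<^esub> \<otimes>\<^sub>U EB (b \<otimes>\<^bsub>B\<^esub> down (p j)) t)"
        by (simp only: \<rho>_tens[OF EBc A.one_closed t])
      also have "\<dots> = q j (EB (b \<otimes>\<^bsub>B\<^esub> down (p j)) t)"
        by (rule up_one_tens[OF q S_closed[OF EBc t]])
      finally show ?thesis by (simp only: EB_down[OF b t])
    qed
    then show "finsum B ?f {..<n} ?u = b ?u"
      using UM.End_finsum_apply[OF u f] qp[OF bu] by simp
  qed
qed

text \<open>The values of \<open>down (p j)\<close> on \<open>1 \<otimes> t\<close> have no simple
  form; only their images under \<open>ET\<close> do. The comparison is thus made after
  \<open>ET\<close>, at all multiples \<open>c u\<close>.\<close>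

lemma expand_down:
  assumes b: "b \<in> carrier B"
  shows "(\<Oplus>\<^bsub>B\<^esub>j\<in>{..<n}. down (p j) \<otimes>\<^bsub>B\<^esub> \<rho> (EB (up (q j) \<otimes>\<^bsub>B\<^esub> b))) = b"
    (is "finsum B ?f _ = b")
proof -
  have EBc: "EB (up (q j) \<otimes>\<^bsub>B\<^esub> b) \<in> carrier S" for j
    by (rule EB_closed[OF B.m_closed[OF up_closed[OF q] b]])
  have f: "?f \<in> {..<n} \<rightarrow> carrier B"
    by (intro Pi_I B.m_closed \<rho>_closed[OF EBc] down_closed[OF p])
  have fc: "finsum B ?f {..<n} \<in> carrier B"
    by (rule B.finsum_closed[OF f])
  show ?thesis
  proof (rule UM.End_ring_eqI[OF fc b])
    fix u assume u: "u \<in> carrier U"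
    show "finsum B ?f {..<n} u = b u"
    proof (rule ET_separates[OF B_closed[OF fc u] B_closed[OF b u]])
      fix c assume c: "c \<in> carrier A"
      have cu: "c \<odot>\<^bsub>U\<^esub> u \<in> carrier U" by (rule UM.smult_closed[OF c u])
      have fj: "?f j \<in> carrier B" for j
        by (intro B.m_closed \<rho>_closed[OF EBc] down_closed[OF p])
      have ET_term: "ET (?f j (c \<odot>\<^bsub>U\<^esub> u)) = ET (b (q j (p j (c \<odot>\<^bsub>U\<^esub> u))))" for j
      proof -
        have pt: "p j (c \<odot>\<^bsub>U\<^esub> u) \<in> carrier T" by (rule p_closed[OF p cu])
        have "ET (?f j (c \<odot>\<^bsub>U\<^esub> u)) = ET (\<rho> (EB (up (q j) \<otimes>\<^bsub>B\<^esub> b)) (down (p j) (c \<odot>\<^bsub>U\<^esub> u)))"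
          by (simp only: B_mult_apply[OF cu])
        also have "\<dots> = EB (up (q j) \<otimes>\<^bsub>B\<^esub> b) (p j (c \<odot>\<^bsub>U\<^esub> u))"
          by (simp only: ET_\<rho>[OF EBc down_closed_U[OF p cu]] ET_down_one[OF p cu])
        also have "\<dots> = ET (b (q j (p j (c \<odot>\<^bsub>U\<^esub> u))))"
          by (simp only: EB_apply[OF pt] B_mult_apply[OF one_tens[OF pt]] up_one_tens[OF q pt])
        finally show ?thesis .
      qed
      \<comment> \<open>Linearity over \<open>A\<close> moves \<open>c\<close> into the argument,
        where \<open>ET_term\<close> applies with \<open>c u\<close> in place of
        \<open>u\<close>.\<close>
      have "ET (c \<odot>\<^bsub>U\<^esub> finsum B ?f {..<n} u) = ET (finsum B ?f {..<n} (c \<odot>\<^bsub>U\<^esub> u))"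
        by (simp only: B_smult[OF fc c u])
      also have "\<dots> = ET (\<Oplus>\<^bsub>U\<^esub>j\<in>{..<n}. ?f j (c \<odot>\<^bsub>U\<^esub> u))"
        by (simp only: UM.End_finsum_apply[OF cu f])
      also have "\<dots> = (\<Oplus>\<^bsub>T\<^esub>j\<in>{..<n}. ET (?f j (c \<odot>\<^bsub>U\<^esub> u)))"
        by (intro add_hom_finsum[OF U_abelian_group T.M.abelian_group_axioms ET_add_hom] Pi_I
            B_closed[OF fj cu])
      also have "\<dots> = ET (b (c \<odot>\<^bsub>U\<^esub> u))"
        unfolding ET_term
        by (rule qp_hom[OF add_hom_compose[OF ET_add_hom B_add_hom[OF b]] T.M.abelian_group_axioms cu])
      finally show "ET (c \<odot>\<^bsub>U\<^esub> finsum B ?f {..<n} u) = ET (c \<odot>\<^bsub>U\<^esub> b u)"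
        by (simp only: B_smult[OF b c u])
    qed
  qed
qed

text \<open>The two linearity laws of \<open>EB\<close> have different sources: the left one comes
  from \<open>\<rho> s\<close> sending \<open>1 \<otimes> t\<close> to
  \<open>1 \<otimes> s t\<close>, the right one from \<open>ET_\<rho>\<close>.\<close>

lemma frobenius_system_B:
  "frobenius_system S B \<rho> EB {..<n} (\<lambda>j. up (q j)) (\<lambda>j. down (p j))"
proof (intro frobenius_system.intro frobenius_system_axioms.intro S.ring_axioms B.ring_axioms
    \<rho>_ring_hom finite_lessThan up_closed[OF q] down_closed[OF p] expand_up expand_down)
  show "EB \<in> add_hom B S"
  proof (rule add_homI[OF EB_closed])
    fix b c assume bc: "b \<in> carrier B" "c \<in> carrier B"
    show "EB (b \<oplus>\<^bsub>B\<^esub> c) = EB b \<oplus>\<^bsub>S\<^esub> EB c"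
    proof (rule T.End_ring_eqI[OF EB_closed[OF B.a_closed[OF bc]]
          S.a_closed[OF EB_closed[OF bc(1)] EB_closed[OF bc(2)]]])
      fix t assume t: "t \<in> carrier T"
      show "EB (b \<oplus>\<^bsub>B\<^esub> c) t = (EB b \<oplus>\<^bsub>S\<^esub> EB c) t"
        unfolding EB_apply[OF t] B_add_apply[OF one_tens[OF t]]
        using add_hom_add[OF ET_add_hom B_closed[OF bc(1) one_tens[OF t]] B_closed[OF bc(2) one_tens[OF t]]]
          EB_apply t by simp
    qed
  qed
next
  fix s b assume s: "s \<in> carrier S" and b: "b \<in> carrier B"
  note EBb = EB_closed[OF b]
  show "EB (\<rho> s \<otimes>\<^bsub>B\<^esub> b) = s \<otimes>\<^bsub>S\<^esub> EB b"
  proof (rule T.End_ring_eqI[OF EB_closed[OF B.m_closed[OF \<rho>_closed[OF s] b]] S.m_closed[OF s EBb]])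
    fix t assume t: "t \<in> carrier T"
    show "EB (\<rho> s \<otimes>\<^bsub>B\<^esub> b) t = (s \<otimes>\<^bsub>S\<^esub> EB b) t"
      unfolding EB_apply[OF t] B_mult_apply[OF one_tens[OF t]] \<rho>_tens[OF s A.one_closed t]
      using EB_apply[OF S_closed[OF s t]] t by (simp add: compose_def)
  qed
  show "EB (b \<otimes>\<^bsub>B\<^esub> \<rho> s) = EB b \<otimes>\<^bsub>S\<^esub> s"
  proof (rule T.End_ring_eqI[OF EB_closed[OF B.m_closed[OF b \<rho>_closed[OF s]]] S.m_closed[OF EBb s]])
    fix t assume t: "t \<in> carrier T"
    show "EB (b \<otimes>\<^bsub>B\<^esub> \<rho> s) t = (EB b \<otimes>\<^bsub>S\<^esub> s) t"
      unfolding EB_apply[OF t] B_mult_apply[OF one_tens[OF t]] ET_\<rho>[OF s B_closed[OF b one_tens[OF t]]]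
      using EB_apply[OF t] t by (simp add: compose_def)
  qed
qed

section \<open>The evaluation map and its inverse\<close>

abbreviation "Bl \<equiv> ring_bimodule \<rho> (\<lambda>b. b) B"
abbreviation "W \<equiv> tensor_bimodule S (End_bimodule T) Bl"
abbreviation tensW (infixl \<open>\<otimes>\<^sub>W\<close> 70) where "t \<otimes>\<^sub>W b \<equiv> pure_tensor S (End_bimodule T) Bl t b"

lemma End_bimodule_left_module: "left_module R (End_bimodule T)"
  by (rule left_moduleI[OF R.ring_axioms abelian_group_transfer[OF T.M.abelian_group_axioms]])
    (simp_all add: T.smult_closed T.smult_l_distr T.smult_r_distr T.smult_assoc1 T.smult_one)

sublocale W: bimodule_tensor_product R S "End_bimodule T" Bl
proof -
  interpret E: left_module R "End_bimodule T" by (rule End_bimodule_left_module)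
  interpret Bl: abelian_group Bl by (rule ring_bimodule_abelian_group[OF B.ring_axioms])
  show "bimodule_tensor_product R S (End_bimodule T) Bl"
  proof unfold_locales
    show "t \<odot>\<^sub>r\<^bsub>End_bimodule T\<^esub> s \<in> carrier (End_bimodule T)"
      if "t \<in> carrier (End_bimodule T)" "s \<in> carrier S" for t s
      using S_closed that by simp
    show "s \<odot>\<^bsub>Bl\<^esub> b \<in> carrier Bl" if "s \<in> carrier S" "b \<in> carrier Bl" for s b
      using B.m_closed \<rho>_closed that unfolding ring_bimodule_simps by blast
    \<comment> \<open>The actions of \<open>R\<close> and \<open>S\<close> on \<open>T\<close>
      commute because the elements of \<open>S\<close> are \<open>R\<close>-linear.\<close>
    show "r \<odot>\<^bsub>End_bimodule T\<^esub> (t \<odot>\<^sub>r\<^bsub>End_bimodule T\<^esub> s) = (r \<odot>\<^bsub>End_bimodule T\<^esub> t) \<odot>\<^sub>r\<^bsub>End_bimodule T\<^esub> s"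
      if "r \<in> carrier R" "t \<in> carrier (End_bimodule T)" "s \<in> carrier S" for r t s
      using S_smult that by simp
  qed
qed

lemma W_abelian_group: "abelian_group W"
  by (rule abelian_group_transfer[OF W.TG_abelian_group]) simp_all

lemma add_hom_W_left: "add_hom (tensor_group S (End_bimodule T) Bl) G = add_hom W G"
  by (rule add_hom_carrier_cong) simp_all

lemma add_hom_W_right: "add_hom G (tensor_group S (End_bimodule T) Bl) = add_hom G W"
  by (rule add_hom_carrier_cong) simp_all

lemma W_pure_closed: "t \<in> carrier T \<Longrightarrow> b \<in> carrier B \<Longrightarrow> t \<otimes>\<^sub>W b \<in> carrier W"
  using W.pure_closed by simp

lemma W_hom_eqI:
  assumes "f \<in> add_hom W G" "g \<in> add_hom W G" "w \<in> carrier W"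
    and "\<And>t b. t \<in> carrier T \<Longrightarrow> b \<in> carrier B \<Longrightarrow> f (t \<otimes>\<^sub>W b) = g (t \<otimes>\<^sub>W b)"
  shows "f w = g w"
  using W.tensor_hom_eqI[of f G g w] assms by (simp add: add_hom_W_left)

abbreviation "ev \<equiv> canonical_eval R A \<iota> T"

text \<open>In right-action notation both sides are
  \<open>(1 \<otimes> t) \<rho>(s) b\<close>.\<close>

lemma ev_balanced: "W.balanced U (\<lambda>t b. b (\<one>\<^bsub>A\<^esub> \<otimes>\<^sub>U t))"
proof (rule W.balancedI)
  show "(\<lambda>t. b (\<one>\<^bsub>A\<^esub> \<otimes>\<^sub>U t)) \<in> add_hom (End_bimodule T) U" if "b \<in> carrier Bl" for b
    using add_hom_compose[OF B_add_hom tens_right_add_hom[OF A.one_closed]] that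
      add_hom_carrier_cong[of "End_bimodule T" T U U]
    unfolding ring_bimodule_simps by simp
  show "(\<lambda>b. b (\<one>\<^bsub>A\<^esub> \<otimes>\<^sub>U t)) \<in> add_hom Bl U" if "t \<in> carrier (End_bimodule T)" for t
    using UM.End_eval_add_hom[OF one_tens] that add_hom_carrier_cong[of Bl B U U] by simp
  show "b (\<one>\<^bsub>A\<^esub> \<otimes>\<^sub>U (t \<odot>\<^sub>r\<^bsub>End_bimodule T\<^esub> s)) = (s \<odot>\<^bsub>Bl\<^esub> b) (\<one>\<^bsub>A\<^esub> \<otimes>\<^sub>U t)"
    if "t \<in> carrier (End_bimodule T)" "s \<in> carrier S" "b \<in> carrier Bl" for t s b
    using that unfolding ring_bimodule_simps End_bimodule_simps
    by (simp only: B_mult_apply[OF one_tens] \<rho>_tens A.one_closed)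
qed

lemma ev_pure: "t \<in> carrier T \<Longrightarrow> b \<in> carrier B \<Longrightarrow> ev (t \<otimes>\<^sub>W b) = b (\<one>\<^bsub>A\<^esub> \<otimes>\<^sub>U t)"
  unfolding canonical_eval_def induced_module_def
  using W.tensor_lift_pure[OF U_abelian_group ev_balanced] by simp

lemma ev_add_hom: "ev \<in> add_hom W U"
  unfolding canonical_eval_def induced_module_def
  using W.tensor_lift_add_hom[OF U_abelian_group ev_balanced] by (simp add: add_hom_W_left)

lemma W_smult_add_hom: "r \<in> carrier R \<Longrightarrow> (\<lambda>w. r \<odot>\<^bsub>W\<^esub> w) \<in> add_hom W W"
  using W.TM_smult_add_hom
  by (simp add: tensor_module_simps(4) add_hom_W_left add_hom_W_right del: End_bimodule_simps)

lemma W_smult_pure: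
  "r \<in> carrier R \<Longrightarrow> t \<in> carrier T \<Longrightarrow> b \<in> carrier B \<Longrightarrow> r \<odot>\<^bsub>W\<^esub> (t \<otimes>\<^sub>W b) = (r \<odot>\<^bsub>T\<^esub> t) \<otimes>\<^sub>W b"
  using W.TM_smult_pure[of r t b] by (simp add: tensor_module_simps(4))

context
  fixes c assumes c: "c \<in> carrier B"
begin

text \<open>The last condition is associativity in \<open>B\<close>: right multiplication by
  \<open>c\<close> commutes with left multiplication by \<open>\<rho> s\<close>.\<close>

lemma W_rsmult_conditions:
  "(\<lambda>t. t) \<in> add_hom (End_bimodule T) (End_bimodule T)"
  "(\<lambda>b. b \<odot>\<^sub>r\<^bsub>Bl\<^esub> c) \<in> add_hom Bl Bl"
  "\<And>t s. t \<in> carrier (End_bimodule T) \<Longrightarrow> s \<in> carrier S \<Longrightarrow>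
     t \<odot>\<^sub>r\<^bsub>End_bimodule T\<^esub> s = t \<odot>\<^sub>r\<^bsub>End_bimodule T\<^esub> s"
  "\<And>s b. s \<in> carrier S \<Longrightarrow> b \<in> carrier Bl \<Longrightarrow> (s \<odot>\<^bsub>Bl\<^esub> b) \<odot>\<^sub>r\<^bsub>Bl\<^esub> c = s \<odot>\<^bsub>Bl\<^esub> (b \<odot>\<^sub>r\<^bsub>Bl\<^esub> c)"
proof -
  show "(\<lambda>b. b \<odot>\<^sub>r\<^bsub>Bl\<^esub> c) \<in> add_hom Bl Bl"
    using B.mult_right_add_hom[OF c] add_hom_carrier_cong[of Bl B Bl B]
    unfolding ring_bimodule_simps by simp
  show "(s \<odot>\<^bsub>Bl\<^esub> b) \<odot>\<^sub>r\<^bsub>Bl\<^esub> c = s \<odot>\<^bsub>Bl\<^esub> (b \<odot>\<^sub>r\<^bsub>Bl\<^esub> c)" if "s \<in> carrier S" "b \<in> carrier Bl" for s b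
    using that c unfolding ring_bimodule_simps by (intro B.m_assoc \<rho>_closed)
qed (simp_all add: id_add_hom)

lemma W_rsmult_add_hom: "(\<lambda>w. w \<odot>\<^sub>r\<^bsub>W\<^esub> c) \<in> add_hom W W"
  using W.tensor_map_add_hom[OF W_rsmult_conditions]
  unfolding tensor_bimodule_simps add_hom_W_left add_hom_W_right .

lemma W_rsmult_pure:
  "t \<in> carrier T \<Longrightarrow> b \<in> carrier B \<Longrightarrow> (t \<otimes>\<^sub>W b) \<odot>\<^sub>r\<^bsub>W\<^esub> c = t \<otimes>\<^sub>W (b \<otimes>\<^bsub>B\<^esub> c)"
  using W.tensor_map_pure[OF W_rsmult_conditions, of t b]
  unfolding tensor_bimodule_simps End_bimodule_simps ring_bimodule_simps .

end

definition ev_inv where "ev_inv u = (\<Oplus>\<^bsub>W\<^esub>j\<in>{..<n}. p j u \<otimes>\<^sub>W up (q j))"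

lemma ev_inv_terms: "u \<in> carrier U \<Longrightarrow> (\<lambda>j. p j u \<otimes>\<^sub>W up (q j)) \<in> {..<n} \<rightarrow> carrier W"
  by (intro Pi_I W_pure_closed p_closed[OF p] up_closed[OF q])

lemma ev_inv_closed: "u \<in> carrier U \<Longrightarrow> ev_inv u \<in> carrier W"
  unfolding ev_inv_def
  by (rule abelian_monoid.finsum_closed[OF abelian_group.axioms(1)[OF W_abelian_group] ev_inv_terms])

lemma W_left_add_hom: "b \<in> carrier B \<Longrightarrow> (\<lambda>t. t \<otimes>\<^sub>W b) \<in> add_hom T W"
  using W.pure_left_add_hom[of b] add_hom_carrier_cong[of "End_bimodule T" T W W]
  unfolding ring_bimodule_simps by (simp add: add_hom_W_right)

lemma W_right_add_hom: "t \<in> carrier T \<Longrightarrow> (\<lambda>b. t \<otimes>\<^sub>W b) \<in> add_hom B W"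
  using W.pure_right_add_hom[of t] add_hom_carrier_cong[of Bl B W W]
  by (simp add: add_hom_W_right)

lemma ev_inv_add_hom: "ev_inv \<in> add_hom U W"
proof -
  have "(\<lambda>u. \<Oplus>\<^bsub>W\<^esub>j\<in>{..<n}. p j u \<otimes>\<^sub>W up (q j)) \<in> add_hom U W"
    by (intro finsum_add_hom_family U_abelian_group W_abelian_group
        add_hom_compose[OF W_left_add_hom[OF up_closed[OF q]] p_add_hom[OF p]])
  then show ?thesis by (simp only: ev_inv_def[abs_def])
qed

lemma ev_ev_inv:
  assumes u: "u \<in> carrier U"
  shows "ev (ev_inv u) = u"
proof -
  have "ev (ev_inv u) = (\<Oplus>\<^bsub>U\<^esub>j\<in>{..<n}. ev (p j u \<otimes>\<^sub>W up (q j)))"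
    unfolding ev_inv_def
    by (rule add_hom_finsum[OF W_abelian_group U_abelian_group ev_add_hom ev_inv_terms[OF u]])
  also have "\<dots> = (\<Oplus>\<^bsub>U\<^esub>j\<in>{..<n}. q j (p j u))"
    by (simp only: ev_pure[OF p_closed[OF p u] up_closed[OF q]] up_one_tens[OF q p_closed[OF p u]])
  finally show ?thesis by (simp only: qp[OF u])
qed

text \<open>On \<open>t \<otimes> b\<close> the coefficient \<open>p j ((1 \<otimes> t) b)\<close>
  equals \<open>t\<close> acted on by \<open>?s j\<close>, an element of \<open>S\<close>. It
  crosses the tensor sign as \<open>\<rho> (?s j)\<close>, and \<open>expand_up\<close> reassembles
  \<open>b\<close>.\<close>

lemma ev_inv_ev:
  assumes w: "w \<in> carrier W"
  shows "ev_inv (ev w) = w"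
proof (rule W_hom_eqI[OF add_hom_compose[OF ev_inv_add_hom ev_add_hom] id_add_hom w])
  interpret W': abelian_group W by (rule W_abelian_group)
  fix t b assume t: "t \<in> carrier T" and b: "b \<in> carrier B"
  let ?s = "\<lambda>j. EB (b \<otimes>\<^bsub>B\<^esub> down (p j))"
  have s: "?s j \<in> carrier S" for j
    by (rule EB_closed[OF B.m_closed[OF b down_closed[OF p]]])
  \<comment> \<open>\<open>EB_down\<close> read backwards exhibits the left factor as the right
    action of \<open>?s j\<close> on \<open>t\<close>, ready for balancing.\<close>
  have "p j (b (\<one>\<^bsub>A\<^esub> \<otimes>\<^sub>U t)) \<otimes>\<^sub>W up (q j) = t \<otimes>\<^sub>W (\<rho> (?s j) \<otimes>\<^bsub>B\<^esub> up (q j))" for j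
    using W.pure_balanced[of t "?s j" "up (q j)"] t s up_closed[OF q]
    unfolding End_bimodule_simps ring_bimodule_simps by (simp only: EB_down[OF b t])
  then have "ev_inv (ev (t \<otimes>\<^sub>W b)) = (\<Oplus>\<^bsub>W\<^esub>j\<in>{..<n}. t \<otimes>\<^sub>W (\<rho> (?s j) \<otimes>\<^bsub>B\<^esub> up (q j)))"
    by (simp only: ev_inv_def ev_pure[OF t b])
  also have "\<dots> = t \<otimes>\<^sub>W (\<Oplus>\<^bsub>B\<^esub>j\<in>{..<n}. \<rho> (?s j) \<otimes>\<^bsub>B\<^esub> up (q j))"
    by (intro add_hom_finsum[symmetric, OF B.abelian_group_axioms W_abelian_group W_right_add_hom[OF t]]
        Pi_I B.m_closed \<rho>_closed s up_closed[OF q])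
  finally show "ev_inv (ev (t \<otimes>\<^sub>W b)) = t \<otimes>\<^sub>W b"
    by (simp only: expand_up[OF b])
qed

text \<open>Left linearity rests on \<open>1 \<otimes> r t = \<iota> r (1 \<otimes> t)\<close> and
  on \<open>b\<close> being \<open>A\<close>-linear; right linearity holds because the product
  \<open>b c\<close> applies \<open>b\<close> before \<open>c\<close>.\<close>

lemma ev_iso: "ev \<in> bimodule_iso R B W (End_bimodule UR)"
  unfolding bimodule_iso_def lmod_iso_def
proof (intro CollectI conjI ballI lmod_homI)
  show "ev \<in> add_hom W (End_bimodule UR)"
    using ev_add_hom add_hom_carrier_cong[of W W "End_bimodule UR" U] by simp
  show "bij_betw ev (carrier W) (carrier (End_bimodule UR))"
    by (rule bij_betw_byWitness[where f' = ev_inv])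
      (use ev_inv_ev ev_ev_inv add_hom_closed[OF ev_add_hom] ev_inv_closed in
        \<open>auto simp del: tensor_bimodule_simps tensor_module_simps\<close>)
  fix w assume w: "w \<in> carrier W"
  fix r assume r: "r \<in> carrier R"
  have "ev (r \<odot>\<^bsub>W\<^esub> w) = \<iota> r \<odot>\<^bsub>U\<^esub> ev w"
  proof (rule W_hom_eqI[OF add_hom_compose[OF ev_add_hom W_smult_add_hom[OF r]]
        add_hom_compose[OF UM.smult_add_hom[OF \<iota>_closed[OF r]] ev_add_hom] w])
    fix t b assume t: "t \<in> carrier T" and b: "b \<in> carrier B"
    have "b (\<one>\<^bsub>A\<^esub> \<otimes>\<^sub>U (r \<odot>\<^bsub>T\<^esub> t)) = b (\<iota> r \<odot>\<^bsub>U\<^esub> (\<one>\<^bsub>A\<^esub> \<otimes>\<^sub>U t))"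
      using tens_balanced[OF A.one_closed r t] tens_smult[OF \<iota>_closed[OF r] A.one_closed t]
      by (simp add: \<iota>_closed r)
    then show "ev (r \<odot>\<^bsub>W\<^esub> (t \<otimes>\<^sub>W b)) = \<iota> r \<odot>\<^bsub>U\<^esub> ev (t \<otimes>\<^sub>W b)"
      by (simp only: W_smult_pure[OF r t b] ev_pure[OF T.smult_closed[OF r t] b] ev_pure[OF t b]
          B_smult[OF b \<iota>_closed[OF r] one_tens[OF t]])
  qed
  then show "ev (r \<odot>\<^bsub>W\<^esub> w) = r \<odot>\<^bsub>End_bimodule UR\<^esub> ev w"
    by (simp only: End_bimodule_simps restrict_scalars_simps)
next
  fix w c assume w: "w \<in> carrier W" and c: "c \<in> carrier B"
  have "ev (w \<odot>\<^sub>r\<^bsub>W\<^esub> c) = c (ev w)"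
  proof (rule W_hom_eqI[OF add_hom_compose[OF ev_add_hom W_rsmult_add_hom[OF c]]
        add_hom_compose[OF B_add_hom[OF c] ev_add_hom] w])
    fix t b assume t: "t \<in> carrier T" and b: "b \<in> carrier B"
    show "ev ((t \<otimes>\<^sub>W b) \<odot>\<^sub>r\<^bsub>W\<^esub> c) = c (ev (t \<otimes>\<^sub>W b))"
      by (simp only: W_rsmult_pure[OF c t b] ev_pure[OF t B.m_closed[OF b c]] ev_pure[OF t b]
          B_mult_apply[OF one_tens[OF t]])
  qed
  then show "ev (w \<odot>\<^sub>r\<^bsub>W\<^esub> c) = ev w \<odot>\<^sub>r\<^bsub>End_bimodule UR\<^esub> c"
    by (simp only: End_bimodule_simps)
qed

end

theorem theorem3p2:
  fixes R :: "'r ring" and A :: "'a ring" and \<iota> :: "'r \<Rightarrow> 'a" and T :: "('r, 't) module"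
  assumes frob: "frobenius_extension R A \<iota>"
    and T: "left_module R T"
    and U: "U = induced_module R A \<iota> T"
    and S: "S = End_ring R T"
    and B: "B = End_ring A U"
    and \<rho>: "\<rho> = induced_endo R A \<iota> T"
    and add: "in_add R (restrict_scalars \<iota> U) T"
  shows "frobenius_extension S B \<rho> \<and>
         canonical_eval R A \<iota> T \<in>
           bimodule_iso R B
             (tensor_bimodule S (End_bimodule T) (ring_bimodule \<rho> (\<lambda>b. b) B))
             (End_bimodule (restrict_scalars \<iota> U))"
proof -
  obtain E and J :: "'a set" and x y where "frobenius_system R A \<iota> E J x y"
    by (rule frobenius_extension_system[OF frob]) (rule that)
  then interpret I: induced R A \<iota> E J x y T
    using T by (rule induced.intro)
  have U': "U = tensor_module R (ring_bimodule (\<lambda>a. a) \<iota> A) T"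
    by (simp add: U induced_module_def)
  obtain n :: nat and p q where
    "\<And>j. p j \<in> lmod_hom R I.UR T" "\<And>j. q j \<in> lmod_hom R T I.UR"
    "\<And>u. u \<in> carrier I.UR \<Longrightarrow> (\<Oplus>\<^bsub>I.UR\<^esub>j\<in>{..<n}. q j (p j u)) = u"
    by (rule in_add_decomposition[OF T I.UR_left_module add[unfolded U']]) (rule that)
  note pq = this
  \<comment> \<open>The decomposition was obtained for the restricted module \<open>I.UR\<close>;
    its sums agree with those of \<open>I.U\<close>, where the remaining argument takes
    place.\<close>
  have "(\<Oplus>\<^bsub>I.U\<^esub>j\<in>{..<n}. q j (p j u)) = u" if u: "u \<in> carrier I.U" for u
  proof -
    have "(\<lambda>j. q j (p j u)) \<in> {..<n} \<rightarrow> carrier I.U"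
      by (intro Pi_I I.q_closed[OF pq(2)] I.p_closed[OF pq(1)] u)
    then have "finsum I.UR (\<lambda>j. q j (p j u)) {..<n} = finsum I.U (\<lambda>j. q j (p j u)) {..<n}"
      by (intro finsum_transfer[OF I.U_abelian_group]) simp_all
    then show ?thesis using pq(3) u by simp
  qed
  then interpret I: induced_in_add R A \<iota> E J x y T n p q
    using pq(1,2) by unfold_locales auto
  show ?thesis
    unfolding \<rho> B S U'
    using frobenius_system.frobenius_extension[OF I.frobenius_system_B] I.ev_iso by (rule conjI)
qed

end
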